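(* Let $\mathfrak{u}$ be a compact Lie algebra, let $I$ be an admissible $\mathfrak{b}^+$-complex structure on $\mathfrak{u}$ and let $J$ match $I$. Then each of the subspaces $\mathfrak{e}$ and $\mathcal{V}$ is $J$-stable. Moreover, for each $X\in\mathfrak{e}\oplus\mathcal{V}$ we have $JX=\mathbf{c}\,I\,\mathbf{c}^{-1}X$, where $\mathbf{c}=\mathbf{c}[\rho]$ is the Cayley transform with parameters $\rho_\gamma=i\,\gamma(JE_{-\gamma})$ for each $\gamma\in\Gamma$.
   Context: $\mathfrak{u}$ is a compact Lie algebra, $\mathfrak{g}=\mathfrak{u}^{\mathbb C}$, $\tau$ the conjugation of $\mathfrak{g}$ with respect to $\mathfrak{u}$, $\mathfrak{h}$ a $\tau$-stable Cartan subalgebra of $\mathfrak{g}$, $\Delta\subset\mathfrak{h}^*$ the roots, $\Delta^+$ a system of positive roots, $\mathfrak{g}(\alpha)$ the root spaces, $\mathfrak{n}^+=\bigoplus_{\alpha\in\Delta^+}\mathfrak{g}(\alpha)$, $\mathfrak{b}^+=\mathfrak{h}\oplus\mathfrak{n}^+$, $H_\alpha\in\mathfrak{h}$ the coroot of $\alpha$ ($\alpha(H_\alpha)=2$). Fix a Weyl–Chevalley basis: $E_\alpha\in\mathfrak{g}(\alpha)$, $[E_\alpha,E_{-\alpha}]=H_\alpha$, $[E_\alpha,E_\beta]=N_{\alpha,\beta}E_{\alpha+\beta}$ for $\alpha,\beta,\alpha+\beta\in\Delta$, with integers $N_{\alpha,\beta}=-N_{-\alpha,-\beta}$, $|N_{\alpha,\beta}|=1-p_0$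 where $\beta+n\alpha$, $p_0\le n\le q_0$, is the $\alpha$-series of $\beta$; and $\tau(E_\alpha)=-E_{-\alpha}$, $\tau(H_\alpha)=-H_\alpha$. Stem: $\Phi_\gamma^+=\{\alpha\in\Delta^+\mid\gamma-\alpha\in\Delta^+\}$; $\Gamma$ is the unique subset of $\Delta^+$ with $\Delta^+=\Gamma\cup\bigcup_{\gamma\in\Gamma}\Phi_\gamma^+$ (disjoint union). $\Phi^+=\bigcup_{\gamma\in\Gamma}\Phi_\gamma^+$ and $\mathcal{V}=\bigoplus_{\alpha\in\Phi^+}(\mathfrak{g}(\alpha)\oplus\mathfrak{g}(-\alpha))\subset\mathfrak{g}$. A complex structure on $\mathfrak{u}$ is a linear $I:\mathfrak{u}\to\mathfrak{u}$ with $I^2=-1$, extended $\mathbb C$-linearly to $\mathfrak{g}$; $\mathfrak{m}_I^{+}=\{X\in\mathfrak{g}\mid IX=iX\}$. $I$ is integrable if $\mathfrak{m}_I^+$ is a subalgebra. $I$ is a $\mathfrak{b}^+$-complex structure if it is integrable and the normalizer of $\mathfrak{m}_I^+$ in $\mathfrak{g}$ is $\mathfrak{b}^+$ (then $\mathfrak m_I^+=(\mathfrak h\cap\mathfrak m_I^+)\oplus\mathfrak n^+$). $J$ matches $I$ if $J$ is an integrable complex structure on $\mathfrak{u}$ with $IJ=-JI$; $I$ is admissible if some $J$ matches $I$. In this situation it is known that for $\gamma\in\Gamma$ one has $JE_{\pm\gamma}\in\mathfrak{h}$ and $|\gamma(JE_{-\gamma})|=1$. $W_\gamma=\frac i2H_\gamma$,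 $\mathfrak{w}=\operatorname{span}_{\mathbb R}\{W_\gamma\mid\gamma\in\Gamma\}$. $\mathfrak{f}=\bigoplus_{\gamma\in\Gamma}\operatorname{span}_{\mathbb C}\{E_\gamma,E_{-\gamma},H_\gamma\}$ (stem subalgebra), $\mathfrak{f}_u=\mathfrak{f}\cap\mathfrak{u}$, and $\mathfrak{e}=\mathfrak{f}_u+I(\mathfrak{w})\subset\mathfrak{u}$ (extended stem subalgebra). For a family $\rho=(\rho_\gamma)_{\gamma\in\Gamma}$ of complex numbers of modulus $1$: $X_\gamma(\rho)=\frac12(\rho_\gamma E_\gamma-\overline{\rho_\gamma}E_{-\gamma})$ and the Cayley transform is $\mathbf{c}[\rho]=\exp\left(\frac\pi2\,\mathrm{ad}\sum_{\gamma\in\Gamma}X_\gamma(\rho)\right)$. *)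

theory Defs
  imports
    "HOL-Analysis.Analysis"
    "HOL-Library.Function_Algebras"
    "HOL-Library.Set_Algebras"
begin

text \<open>
  A finite-dimensional real Lie algebra is a bracket on a Euclidean space. The inner product that
  comes with the type plays no role for the Lie algebra; it only provides the (unique) vector space
  topology in which the exponential series is summed.
\<close>

locale lie_algebra =
  fixes br :: "'u::euclidean_space \<Rightarrow> 'u \<Rightarrow> 'u"
  assumes bracket_bilinear: "bilinear br"
    and bracket_self: "br x x = 0"
    and jacobi: "br x (br y z) + br y (br z x) + br z (br x y) = 0"

text \<open>Compact: there is a positive definite symmetric bilinear form that is ad-invariant.\<close>

locale compact_lie_algebra = lie_algebra br for br :: "'u::euclidean_space \<Rightarrow> 'u \<Rightarrow> 'u" +
  assumes invariant_form:
    "\<exists>Q :: 'u \<Rightarrow> 'u \<Rightarrow> real. bilinear Q \<and> (\<forall>x y. Q x y = Q y x) \<and> (\<forall>x. x \<noteq> 0 \<longrightarrow> Q x x > 0)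
       \<and> (\<forall>x y z. Q (br x y) z = - Q y (br x z))"

text \<open>The pair \<open>(x, y)\<close> stands for \<open>x + i y\<close>.\<close>

definition cscale :: "complex \<Rightarrow> 'u::real_vector \<times> 'u \<Rightarrow> 'u \<times> 'u" where
  "cscale z X = (Re z *\<^sub>R fst X - Im z *\<^sub>R snd X, Re z *\<^sub>R snd X + Im z *\<^sub>R fst X)"

interpretation cx: vector_space cscale
  by unfold_locales (auto simp: cscale_def algebra_simps)

definition cbracket :: "('u::real_vector \<Rightarrow> 'u \<Rightarrow> 'u) \<Rightarrow> 'u \<times> 'u \<Rightarrow> 'u \<times> 'u \<Rightarrow> 'u \<times> 'u" where
  "cbracket br X Y = (br (fst X) (fst Y) - br (snd X) (snd Y), br (fst X) (snd Y) + br (snd X) (fst Y))"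

definition conjugation :: "'u::real_vector \<times> 'u \<Rightarrow> 'u \<times> 'u" where
  "conjugation X = (fst X, - snd X)"

definition real_form :: "('u::real_vector \<times> 'u) set" where
  "real_form = range (\<lambda>x. (x, 0))"

definition cext :: "('u \<Rightarrow> 'u) \<Rightarrow> 'u::real_vector \<times> 'u \<Rightarrow> 'u \<times> 'u" where
  "cext T X = (T (fst X), T (snd X))"

definition is_csubalgebra :: "('u::real_vector \<Rightarrow> 'u \<Rightarrow> 'u) \<Rightarrow> ('u \<times> 'u) set \<Rightarrow> bool" where
  "is_csubalgebra br s \<longleftrightarrow> cx.subspace s \<and> (\<forall>X\<in>s. \<forall>Y\<in>s. cbracket br X Y \<in> s)"

definition normalizer :: "('u::real_vector \<Rightarrow> 'u \<Rightarrow> 'u) \<Rightarrow> ('u \<times> 'u) set \<Rightarrow> ('u \<times> 'u) set" where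
  "normalizer br s = {X. \<forall>Y\<in>s. cbracket br X Y \<in> s}"

fun lower_central :: "('u::real_vector \<Rightarrow> 'u \<Rightarrow> 'u) \<Rightarrow> ('u \<times> 'u) set \<Rightarrow> nat \<Rightarrow> ('u \<times> 'u) set" where
  "lower_central br s 0 = s"
| "lower_central br s (Suc n) = cx.span {cbracket br X Y | X Y. X \<in> s \<and> Y \<in> lower_central br s n}"

definition is_cartan_subalgebra :: "('u::real_vector \<Rightarrow> 'u \<Rightarrow> 'u) \<Rightarrow> ('u \<times> 'u) set \<Rightarrow> bool" where
  "is_cartan_subalgebra br h \<longleftrightarrow>
     is_csubalgebra br h \<and> (\<exists>n. lower_central br h n = {0}) \<and> normalizer br h = h"

text \<open>
  An element of the dual space of \<open>h\<close> is represented by a function on the whole complexification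
  that is linear on \<open>h\<close> and vanishes outside \<open>h\<close>; thus equality, sums and differences of
  functionals on \<open>h\<close> are those of functions.
\<close>

type_synonym 'u functional = "'u \<times> 'u \<Rightarrow> complex"

definition dual_space :: "('u::real_vector \<times> 'u) set \<Rightarrow> 'u functional set" where
  "dual_space h = {\<alpha>. (\<forall>X\<in>h. \<forall>Y\<in>h. \<alpha> (X + Y) = \<alpha> X + \<alpha> Y)
     \<and> (\<forall>z. \<forall>X\<in>h. \<alpha> (cscale z X) = z * \<alpha> X) \<and> (\<forall>X. X \<notin> h \<longrightarrow> \<alpha> X = 0)}"

definition root_space ::
    "('u::real_vector \<Rightarrow> 'u \<Rightarrow> 'u) \<Rightarrow> ('u \<times> 'u) set \<Rightarrow> 'u functional \<Rightarrow> ('u \<times> 'u) set" where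
  "root_space br h \<alpha> = {X. \<forall>H\<in>h. cbracket br H X = cscale (\<alpha> H) X}"

definition roots :: "('u::real_vector \<Rightarrow> 'u \<Rightarrow> 'u) \<Rightarrow> ('u \<times> 'u) set \<Rightarrow> 'u functional set" where
  "roots br h = {\<alpha> \<in> dual_space h. \<alpha> \<noteq> 0 \<and> root_space br h \<alpha> \<noteq> {0}}"

definition is_positive_system ::
    "('u::real_vector \<Rightarrow> 'u \<Rightarrow> 'u) \<Rightarrow> ('u \<times> 'u) set \<Rightarrow> 'u functional set \<Rightarrow> bool" where
  "is_positive_system br h P \<longleftrightarrow>
     roots br h = P \<union> uminus ` P \<and> P \<inter> uminus ` P = {} \<and>
     (\<forall>\<alpha>\<in>P. \<forall>\<beta>\<in>P. \<alpha> + \<beta> \<in> roots br h \<longrightarrow> \<alpha> + \<beta> \<in> P)"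

definition nilradical_plus ::
    "('u::real_vector \<Rightarrow> 'u \<Rightarrow> 'u) \<Rightarrow> ('u \<times> 'u) set \<Rightarrow> 'u functional set \<Rightarrow> ('u \<times> 'u) set" where
  "nilradical_plus br h P = cx.span (\<Union>\<alpha>\<in>P. root_space br h \<alpha>)"

definition borel_plus ::
    "('u::real_vector \<Rightarrow> 'u \<Rightarrow> 'u) \<Rightarrow> ('u \<times> 'u) set \<Rightarrow> 'u functional set \<Rightarrow> ('u \<times> 'u) set" where
  "borel_plus br h P = h + nilradical_plus br h P"

text \<open>
  For the algebras considered here \<open>[g(\<alpha>), g(-\<alpha>)]\<close> is a line in \<open>h\<close> on which \<open>\<alpha>\<close> does not vanish,
  so the description below is definite.
\<close>

definition coroot ::
    "('u::real_vector \<Rightarrow> 'u \<Rightarrow> 'u) \<Rightarrow> ('u \<times> 'u) set \<Rightarrow> 'u functional \<Rightarrow> 'u \<times> 'u" where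
  "coroot br h \<alpha> = (THE H.
     H \<in> cx.span {cbracket br X Y | X Y. X \<in> root_space br h \<alpha> \<and> Y \<in> root_space br h (- \<alpha>)} \<and>
     \<alpha> H = 2)"

text \<open>
  Only the values of \<open>E\<close> and \<open>N\<close> on roots matter. The interval \<open>{p..q}\<close> is the range of the
  \<open>\<alpha>\<close>-series of \<open>\<beta>\<close>.
\<close>

definition is_weyl_chevalley_basis ::
    "('u::real_vector \<Rightarrow> 'u \<Rightarrow> 'u) \<Rightarrow> ('u \<times> 'u) set \<Rightarrow> ('u functional \<Rightarrow> 'u \<times> 'u) \<Rightarrow> bool" where
  "is_weyl_chevalley_basis br h E \<longleftrightarrow>
     (\<forall>\<alpha>\<in>roots br h. E \<alpha> \<in> root_space br h \<alpha> \<and> cbracket br (E \<alpha>) (E (- \<alpha>)) = coroot br h \<alpha> \<and>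
        conjugation (E \<alpha>) = - E (- \<alpha>) \<and> conjugation (coroot br h \<alpha>) = - coroot br h \<alpha>) \<and>
     (\<exists>N :: 'u functional \<Rightarrow> 'u functional \<Rightarrow> int.
        \<forall>\<alpha>\<in>roots br h. \<forall>\<beta>\<in>roots br h. \<alpha> + \<beta> \<in> roots br h \<longrightarrow>
          cbracket br (E \<alpha>) (E \<beta>) = cscale (of_int (N \<alpha> \<beta>)) (E (\<alpha> + \<beta>)) \<and>
          N \<alpha> \<beta> = - N (- \<alpha>) (- \<beta>) \<and>
          (\<exists>p q. {n :: int. (\<lambda>H. \<beta> H + of_int n * \<alpha> H) \<in> roots br h} = {p..q} \<and>
             \<bar>N \<alpha> \<beta>\<bar> = 1 - p))"

definition Phi_plus :: "'u::real_vector functional set \<Rightarrow> 'u functional \<Rightarrow> 'u functional set" where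
  "Phi_plus P \<gamma> = {\<alpha> \<in> P. \<gamma> - \<alpha> \<in> P}"

text \<open>
  The decomposition of \<open>P\<close> is disjoint in all its pieces; a set \<open>\<Gamma>\<close> with this property is uniquely
  determined by \<open>P\<close>.
\<close>

definition is_stem :: "'u::real_vector functional set \<Rightarrow> 'u functional set \<Rightarrow> bool" where
  "is_stem P \<Gamma> \<longleftrightarrow> \<Gamma> \<subseteq> P \<and> P = \<Gamma> \<union> (\<Union>\<gamma>\<in>\<Gamma>. Phi_plus P \<gamma>) \<and>
     \<Gamma> \<inter> (\<Union>\<gamma>\<in>\<Gamma>. Phi_plus P \<gamma>) = {} \<and> disjoint_family_on (Phi_plus P) \<Gamma>"

definition V_space ::
    "('u::real_vector \<Rightarrow> 'u \<Rightarrow> 'u) \<Rightarrow> ('u \<times> 'u) set \<Rightarrow> 'u functional set \<Rightarrow> 'u functional set \<Rightarrow> ('u \<times> 'u) set" where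
  "V_space br h P \<Gamma> =
     cx.span (\<Union>\<alpha>\<in>(\<Union>\<gamma>\<in>\<Gamma>. Phi_plus P \<gamma>). root_space br h \<alpha> \<union> root_space br h (- \<alpha>))"

text \<open>The span over the reals: \<open>scaleR\<close> on pairs is \<open>cscale\<close> restricted to real numbers.\<close>

definition w_space ::
    "('u::real_vector \<Rightarrow> 'u \<Rightarrow> 'u) \<Rightarrow> ('u \<times> 'u) set \<Rightarrow> 'u functional set \<Rightarrow> ('u \<times> 'u) set" where
  "w_space br h \<Gamma> = span ((\<lambda>\<gamma>. cscale (\<i> / 2) (coroot br h \<gamma>)) ` \<Gamma>)"

definition stem_subalgebra ::
    "('u::real_vector \<Rightarrow> 'u \<Rightarrow> 'u) \<Rightarrow> ('u \<times> 'u) set \<Rightarrow> 'u functional set \<Rightarrow> ('u functional \<Rightarrow> 'u \<times> 'u) \<Rightarrow>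
     ('u \<times> 'u) set" where
  "stem_subalgebra br h \<Gamma> E = cx.span (\<Union>\<gamma>\<in>\<Gamma>. {E \<gamma>, E (- \<gamma>), coroot br h \<gamma>})"

definition extended_stem_subalgebra ::
    "('u::real_vector \<Rightarrow> 'u \<Rightarrow> 'u) \<Rightarrow> ('u \<times> 'u) set \<Rightarrow> 'u functional set \<Rightarrow> ('u functional \<Rightarrow> 'u \<times> 'u) \<Rightarrow>
     ('u \<Rightarrow> 'u) \<Rightarrow> ('u \<times> 'u) set" where
  "extended_stem_subalgebra br h \<Gamma> E I =
     (stem_subalgebra br h \<Gamma> E \<inter> real_form) + cext I ` w_space br h \<Gamma>"

definition is_complex_structure :: "('u::real_vector \<Rightarrow> 'u) \<Rightarrow> bool" where
  "is_complex_structure I \<longleftrightarrow> linear I \<and> (\<forall>x. I (I x) = - x)"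

definition m_plus :: "('u::real_vector \<Rightarrow> 'u) \<Rightarrow> ('u \<times> 'u) set" where
  "m_plus I = {X. cext I X = cscale \<i> X}"

definition is_integrable :: "('u::real_vector \<Rightarrow> 'u \<Rightarrow> 'u) \<Rightarrow> ('u \<Rightarrow> 'u) \<Rightarrow> bool" where
  "is_integrable br I \<longleftrightarrow> is_csubalgebra br (m_plus I)"

definition is_borel_complex_structure ::
    "('u::real_vector \<Rightarrow> 'u \<Rightarrow> 'u) \<Rightarrow> ('u \<times> 'u) set \<Rightarrow> 'u functional set \<Rightarrow> ('u \<Rightarrow> 'u) \<Rightarrow> bool" where
  "is_borel_complex_structure br h P I \<longleftrightarrow>
     is_complex_structure I \<and> is_integrable br I \<and> normalizer br (m_plus I) = borel_plus br h P"

definition matches :: "('u::real_vector \<Rightarrow> 'u \<Rightarrow> 'u) \<Rightarrow> ('u \<Rightarrow> 'u) \<Rightarrow> ('u \<Rightarrow> 'u) \<Rightarrow> bool" where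
  "matches br J I \<longleftrightarrow>
     is_complex_structure J \<and> is_integrable br J \<and> (\<forall>x. I (J x) = - J (I x))"

definition is_admissible :: "('u::real_vector \<Rightarrow> 'u \<Rightarrow> 'u) \<Rightarrow> ('u \<Rightarrow> 'u) \<Rightarrow> bool" where
  "is_admissible br I \<longleftrightarrow> (\<exists>J. matches br J I)"

definition exp_op :: "('v::real_normed_vector \<Rightarrow> 'v) \<Rightarrow> 'v \<Rightarrow> 'v" where
  "exp_op A X = (\<Sum>n. (1 / fact n) *\<^sub>R (A ^^ n) X)"

definition X_vec :: "('u functional \<Rightarrow> 'u::real_vector \<times> 'u) \<Rightarrow> ('u functional \<Rightarrow> complex) \<Rightarrow> 'u functional \<Rightarrow> 'u \<times> 'u" where
  "X_vec E \<rho> \<gamma> = cscale (1 / 2) (cscale (\<rho> \<gamma>) (E \<gamma>) - cscale (cnj (\<rho> \<gamma>)) (E (- \<gamma>)))"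

definition cayley ::
    "('u::real_normed_vector \<Rightarrow> 'u \<Rightarrow> 'u) \<Rightarrow> 'u functional set \<Rightarrow> ('u functional \<Rightarrow> 'u \<times> 'u) \<Rightarrow>
     ('u functional \<Rightarrow> complex) \<Rightarrow> 'u \<times> 'u \<Rightarrow> 'u \<times> 'u" where
  "cayley br \<Gamma> E \<rho> = exp_op (\<lambda>X. (pi / 2) *\<^sub>R cbracket br (\<Sum>\<gamma>\<in>\<Gamma>. X_vec E \<rho> \<gamma>) X)"

end

(*
  Let <X, Y> be the Hermitian form that extends an invariant form of the compact algebra; then
  ad X and - ad (conjugation X) are adjoint, and the identity
  |[E_-alpha, Y]|^2 = beta(H_alpha) |Y|^2 + |[E_alpha, Y]|^2 for Y in g(beta) yields the facts
  about roots.

  Put M = m_I^+.  Since b^+ normalizes M, one gets g = M + conjugation M = h + sum of the g(alpha),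
  and the root vectors of n^+ lie in M.  Modulo M, the integrability of J says that
  J : M -> g/M is a 1-cocycle.  As h acts on cocycles, its components of nonzero weight are
  coboundaries: they are given by a vector sum of v_beta E_-beta over positive beta.  Going down
  along the stem, J^2 = -1 forces |v_gamma| = 1 on the stem, v_beta = 0 off the stem, and
  delta(I H_gamma) = 0 for gamma, delta in the stem.  Hence J E_gamma is v_gamma times the
  (-i)-part of H_gamma, and on the sum of the g(alpha) and g(-alpha) with alpha in Phi_gamma^+ one
  has I = ad(i H_gamma) and J = ad(Z_gamma), where Z_gamma = cnj v_gamma E_gamma - v_gamma E_-gamma.

  The Cayley transform is an automorphism and sends i H_gamma to Z_gamma, which gives the claim on
  V; on the extended stem subalgebra it is a rotation by pi/2 in the plane of H_gamma and
  rho_gamma E_gamma + cnj rho_gamma E_-gamma, and it fixes I H_gamma.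
*)
theory Submission
  imports Defs
begin

section \<open>Exponentials of linear operators\<close>

text \<open>Only half of h lies in M, so the cocycle J can be tested only against h \<inter> M. A
  root beta remains visible there: on the M-part H_beta^+ of its coroot it takes the value 1 - (i/2)
  beta(I H_beta). Here beta(I H_beta) is real, so the value never vanishes and the coefficients
  v_beta can be found by division. The condition J^2 = -1 becomes useful only once J E_gamma is
  known to lie in h, and this requires v to vanish at all roots gamma + beta; hence the induction
  starts at the highest roots. It then reduces to the scalar equations v_gamma cnj(v_beta)
  cnj(beta(H_gamma^+)) = 1 for beta = gamma, and = 0 for every other positive beta. All values of v
  and of the stem roots on I H_gamma are read off from these. The parameters are forced: c maps
  H_gamma to -(rho_gamma E_gamma + cnj rho_gamma E_-gamma), so i H_gamma goes to Z_gamma exactly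
  when rho_gamma = i cnj(v_gamma).\<close>

lemma linear_power_bound:
  fixes A :: "'a::euclidean_space \<Rightarrow> 'a"
  assumes "linear A"
  obtains K where "K \<ge> 0" "\<And>n x. norm ((A ^^ n) x) \<le> K ^ n * norm x"
proof -
  from linear_bounded_pos[OF assms] obtain K where K: "K > 0" "\<And>x. norm (A x) \<le> K * norm x" by blast
  have "norm ((A ^^ n) x) \<le> K ^ n * norm x" for n x
  proof (induction n)
    case (Suc n)
    have "norm ((A ^^ Suc n) x) \<le> K * norm ((A ^^ n) x)" using K(2) by simp
    also have "\<dots> \<le> K * (K ^ n * norm x)" using Suc K(1) by simp
    finally show ?case by (simp add: mult.assoc)
  qed simp
  with K(1) show ?thesis by (intro that[of K]) auto
qed

lemma exp_op_summable:
  fixes A :: "'a::euclidean_space \<Rightarrow> 'a"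
  assumes "linear A"
  shows "summable (\<lambda>n. norm ((1 / fact n) *\<^sub>R (A ^^ n) x))"
proof -
  obtain K where K: "K \<ge> 0" "\<And>n x. norm ((A ^^ n) x) \<le> K ^ n * norm x"
    using linear_power_bound[OF assms] by blast
  have "summable (\<lambda>n. norm x * (inverse (fact n) * K ^ n))"
    by (intro summable_mult summable_exp)
  moreover have "norm (norm ((1 / fact n) *\<^sub>R (A ^^ n) x)) \<le> norm x * (inverse (fact n) * K ^ n)" for n
    using mult_left_mono[OF K(2)[of n x], of "inverse (fact n)"] by (simp add: divide_inverse ac_simps)
  ultimately show ?thesis
    by (intro summable_comparison_test[of "\<lambda>n. norm ((1 / fact n) *\<^sub>R (A ^^ n) x)"
          "\<lambda>n. norm x * (inverse (fact n) * K ^ n)"]) blast+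
qed

lemma exp_op_sums:
  fixes A :: "'a::euclidean_space \<Rightarrow> 'a"
  assumes "linear A"
  shows "(\<lambda>n. (1 / fact n) *\<^sub>R (A ^^ n) x) sums exp_op A x"
  unfolding exp_op_def by (rule summable_sums[OF summable_norm_cancel[OF exp_op_summable[OF assms]]])

lemma linear_funpow: "linear A \<Longrightarrow> linear (A ^^ n)" for A :: "'a::real_vector \<Rightarrow> 'a"
proof (induction n)
  case 0 then show ?case by (simp add: linear_id[unfolded id_def] id_def)
next
  case (Suc n) then show ?case using linear_compose[of "A ^^ n" A] by (simp add: o_def)
qed

lemma linear_exp_op:
  fixes A :: "'a::euclidean_space \<Rightarrow> 'a"
  assumes "linear A"
  shows "linear (exp_op A)"
proof (rule linearI)
  note lin = linear_funpow[OF assms] and sums = exp_op_sums[OF assms]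
  show "exp_op A (x + y) = exp_op A x + exp_op A y" for x y
    using sums_add[OF sums[of x] sums[of y]] sums[of "x + y"]
    by (simp add: linear_add[OF lin] scaleR_add_right sums_unique2)
  show "exp_op A (r *\<^sub>R x) = r *\<^sub>R exp_op A x" for r x
  proof -
    have "(\<lambda>n. r *\<^sub>R ((1 / fact n) *\<^sub>R (A ^^ n) x)) sums (r *\<^sub>R exp_op A x)"
      by (rule sums_scaleR_right[OF sums])
    moreover have "(\<lambda>n. r *\<^sub>R ((1 / fact n) *\<^sub>R (A ^^ n) x)) = (\<lambda>n. (1 / fact n) *\<^sub>R (A ^^ n) (r *\<^sub>R x))"
      by (simp add: linear_scale[OF lin] mult.commute)
    ultimately show ?thesis using sums[of "r *\<^sub>R x"] by (simp add: sums_unique2)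
  qed
qed

text \<open>In coordinates a bilinear map is a finite sum of products of linear functionals, so the
  Cauchy product of real series applies to each pair of coordinates.\<close>

lemma bilinear_Cauchy_product_sums:
  fixes b :: "'a::euclidean_space \<Rightarrow> 'b::euclidean_space \<Rightarrow> 'c::real_normed_vector"
  assumes "bilinear b" and a: "summable (\<lambda>n. norm (a n))" and d: "summable (\<lambda>n. norm (d n))"
  shows "(\<lambda>n. \<Sum>k\<le>n. b (a k) (d (n - k))) sums b (suminf a) (suminf d)"
proof -
  have expand: "b u w = (\<Sum>i\<in>Basis. \<Sum>j\<in>Basis. ((u \<bullet> i) * (w \<bullet> j)) *\<^sub>R b i j)" for u w
  proof -
    have "b u w = b (\<Sum>i\<in>Basis. (u \<bullet> i) *\<^sub>R i) (\<Sum>j\<in>Basis. (w \<bullet> j) *\<^sub>R j)"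
      by (simp add: euclidean_representation)
    also have "\<dots> = (\<Sum>i\<in>Basis. \<Sum>j\<in>Basis. b ((u \<bullet> i) *\<^sub>R i) ((w \<bullet> j) *\<^sub>R j))"
      by (subst bilinear_sum[OF assms(1)]) (simp add: sum.cartesian_product)
    finally show ?thesis
      by (simp add: bilinear_lmul[OF assms(1)] bilinear_rmul[OF assms(1)] mult.commute)
  qed
  have comp: "(\<lambda>n. \<Sum>k\<le>n. (a k \<bullet> i) * (d (n - k) \<bullet> j)) sums ((suminf a \<bullet> i) * (suminf d \<bullet> j))"
    if "i \<in> Basis" "j \<in> Basis" for i j
  proof -
    have "summable (\<lambda>n. norm (a n \<bullet> i))"
      by (rule summable_comparison_test[OF exI[of _ 0] a]) (simp add: Basis_le_norm that)
    moreover have "summable (\<lambda>n. norm (d n \<bullet> j))"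
      by (rule summable_comparison_test[OF exI[of _ 0] d]) (simp add: Basis_le_norm that)
    ultimately have "(\<lambda>n. \<Sum>k\<le>n. (a k \<bullet> i) * (d (n - k) \<bullet> j)) sums ((\<Sum>n. a n \<bullet> i) * (\<Sum>n. d n \<bullet> j))"
      by (rule Cauchy_product_sums)
    moreover have "(\<Sum>n. a n \<bullet> i) = suminf a \<bullet> i" "(\<Sum>n. d n \<bullet> j) = suminf d \<bullet> j"
      using bounded_linear.suminf[OF bounded_linear_inner_left summable_norm_cancel[OF a], of i]
        bounded_linear.suminf[OF bounded_linear_inner_left summable_norm_cancel[OF d], of j]
      by (simp_all only:)
    ultimately show ?thesis by (simp only:)
  qed
  have "(\<lambda>n. \<Sum>i\<in>Basis. \<Sum>j\<in>Basis. (\<Sum>k\<le>n. (a k \<bullet> i) * (d (n - k) \<bullet> j)) *\<^sub>R b i j)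
      sums b (suminf a) (suminf d)"
    unfolding expand[of "suminf a" "suminf d"] by (intro sums_sum sums_scaleR_left comp)
  moreover have "(\<Sum>i\<in>Basis. \<Sum>j\<in>Basis. (\<Sum>k\<le>n. (a k \<bullet> i) * (d (n - k) \<bullet> j)) *\<^sub>R b i j)
      = (\<Sum>k\<le>n. b (a k) (d (n - k)))" for n
  proof -
    have "(\<Sum>k\<le>n. b (a k) (d (n - k)))
        = (\<Sum>k\<le>n. \<Sum>i\<in>Basis. \<Sum>j\<in>Basis. ((a k \<bullet> i) * (d (n - k) \<bullet> j)) *\<^sub>R b i j)"
      by (intro sum.cong refl expand)
    also have "\<dots> = (\<Sum>i\<in>Basis. \<Sum>k\<le>n. \<Sum>j\<in>Basis. ((a k \<bullet> i) * (d (n - k) \<bullet> j)) *\<^sub>R b i j)"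
      by (rule sum.swap)
    also have "\<dots> = (\<Sum>i\<in>Basis. \<Sum>j\<in>Basis. \<Sum>k\<le>n. ((a k \<bullet> i) * (d (n - k) \<bullet> j)) *\<^sub>R b i j)"
      by (intro sum.cong refl sum.swap)
    finally show ?thesis by (simp only: scaleR_sum_left)
  qed
  ultimately show ?thesis by simp
qed

text \<open>A Leibniz rule for the generators integrates to the exponentials. It serves three times:
  for the bracket (the exponential of a derivation is an automorphism), for \<open>cscale\<close>
  with \<open>A = 0\<close> (complex linearity), and for the real part of the Hermitian form with
  \<open>C = 0\<close> (isometry).\<close>

lemma exp_op_bilinear:
  fixes b :: "'a::euclidean_space \<Rightarrow> 'b::euclidean_space \<Rightarrow> 'c::euclidean_space"
  assumes "linear A" "linear B" "linear C" and b: "bilinear b"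
    and deriv: "\<And>x y. C (b x y) = b (A x) y + b x (B y)"
  shows "exp_op C (b x y) = b (exp_op A x) (exp_op B y)"
proof -
  define a where "a n = (1 / fact n) *\<^sub>R (A ^^ n) x" for n
  define d where "d n = (1 / fact n) *\<^sub>R (B ^^ n) y" for n
  have A_a: "A (a n) = real (Suc n) *\<^sub>R a (Suc n)" for n
    by (simp add: a_def linear_scale[OF assms(1)] divide_simps del: of_nat_Suc)
  have B_d: "B (d n) = real (Suc n) *\<^sub>R d (Suc n)" for n
    by (simp add: d_def linear_scale[OF assms(2)] divide_simps del: of_nat_Suc)
  have leibniz: "(1 / fact n) *\<^sub>R (C ^^ n) (b x y) = (\<Sum>k\<le>n. b (a k) (d (n - k)))" for n
  proof (induction n)
    case 0 then show ?case by (simp add: a_def d_def)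
  next
    case (Suc n)
    let ?s = "\<lambda>k. b (a k) (d (Suc n - k))"
    \<comment> \<open>The factor n + 1 turns the divided powers into a recursion: the weights k and
      n + 1 - k of the two shifted sums add up to it.\<close>
    have "real (Suc n) *\<^sub>R ((1 / fact (Suc n)) *\<^sub>R (C ^^ Suc n) (b x y)) = C ((1 / fact n) *\<^sub>R (C ^^ n) (b x y))"
      by (simp add: linear_scale[OF assms(3)] divide_simps del: of_nat_Suc)
    also have "\<dots> = (\<Sum>k\<le>n. real (Suc k) *\<^sub>R b (a (Suc k)) (d (n - k)))
        + (\<Sum>k\<le>n. real (Suc n - k) *\<^sub>R ?s k)"
      by (simp add: Suc.IH linear_sum[OF assms(3)] deriv A_a B_d sum.distrib bilinear_lmul[OF b]
          bilinear_rmul[OF b] Suc_diff_le del: of_nat_Suc)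
    also have "(\<Sum>k\<le>n. real (Suc k) *\<^sub>R b (a (Suc k)) (d (n - k))) = (\<Sum>k\<le>Suc n. real k *\<^sub>R ?s k)"
      by (subst sum.atMost_Suc_shift) simp
    also have "(\<Sum>k\<le>n. real (Suc n - k) *\<^sub>R ?s k) = (\<Sum>k\<le>Suc n. real (Suc n - k) *\<^sub>R ?s k)"
      by simp
    also have "(\<Sum>k\<le>Suc n. real k *\<^sub>R ?s k) + (\<Sum>k\<le>Suc n. real (Suc n - k) *\<^sub>R ?s k)
        = (\<Sum>k\<le>Suc n. real (Suc n) *\<^sub>R ?s k)"
      by (subst sum.distrib[symmetric], intro sum.cong refl)
        (auto simp: of_nat_diff algebra_simps)
    also have "\<dots> = real (Suc n) *\<^sub>R (\<Sum>k\<le>Suc n. ?s k)"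
      by (simp only: scaleR_sum_right)
    finally show ?case by (simp only: scaleR_cancel_left of_nat_eq_0_iff nat.distinct simp_thms)
  qed
  have "(\<lambda>n. \<Sum>k\<le>n. b (a k) (d (n - k))) sums b (suminf a) (suminf d)"
    by (intro bilinear_Cauchy_product_sums b exp_op_summable[OF assms(1), of x, folded a_def]
        exp_op_summable[OF assms(2), of y, folded d_def])
  then have "(\<lambda>n. \<Sum>k\<le>n. b (a k) (d (n - k))) sums b (exp_op A x) (exp_op B y)"
    by (simp only: exp_op_def a_def[abs_def] d_def[abs_def])
  with exp_op_sums[OF assms(3), of "b x y"] show ?thesis
    by (simp add: leibniz sums_unique2)
qed

text \<open>The partial sums stay in \<open>S\<close>, and a subspace of a finite-dimensional space
  is closed.\<close>

lemma exp_op_mem_subspace: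
  fixes A :: "'a::euclidean_space \<Rightarrow> 'a"
  assumes "linear A" "subspace S" "\<And>x. x \<in> S \<Longrightarrow> A x \<in> S" "x \<in> S"
  shows "exp_op A x \<in> S"
proof -
  have "(A ^^ n) x \<in> S" for n by (induction n) (auto simp: assms)
  then have "(\<Sum>k<n. (1 / fact k) *\<^sub>R (A ^^ k) x) \<in> S" for n
    by (intro subspace_sum subspace_scale assms(2))
  then show ?thesis
    by (rule closed_sequentially[OF closed_subspace[OF assms(2)]])
      (rule exp_op_sums[OF assms(1), unfolded sums_def])
qed

lemma exp_op_zero: "exp_op (\<lambda>_. 0) x = x" for x :: "'a::real_normed_vector"
proof -
  have "(1 / fact n) *\<^sub>R ((\<lambda>_. 0) ^^ n) x = (if n = 0 then x else 0)" for n
    by (cases n) auto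
  then show ?thesis using sums_unique[OF sums_single[of 0 "\<lambda>_. x"]] by (simp add: exp_op_def)
qed

section \<open>The complexification and its Hermitian form\<close>

declare split_paired_All [simp del] split_paired_Ex [simp del]

lemma cscale_of_real: "cscale (of_real r) X = r *\<^sub>R X"
  by (simp add: cscale_def prod_eq_iff)

lemma conjugation_simps [simp]:
  "conjugation (X + Y) = conjugation X + conjugation Y"
  "conjugation (X - Y) = conjugation X - conjugation Y"
  "conjugation (- X) = - conjugation X"
  "conjugation 0 = 0"
  "conjugation (cscale z X) = cscale (cnj z) (conjugation X)"
  "conjugation (conjugation X) = X"
  by (auto simp: conjugation_def cscale_def prod_eq_iff)

lemma conjugation_sum: "conjugation (\<Sum>i\<in>A. f i) = (\<Sum>i\<in>A. conjugation (f i))"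
  by (induction A rule: infinite_finite_induct) auto

lemma conjugation_eq_0_iff [simp]: "conjugation X = 0 \<longleftrightarrow> X = 0"
  by (auto simp: conjugation_def prod_eq_iff)

lemma neg_eq_self_iff: "- x = x \<longleftrightarrow> x = 0" for x :: "'a::real_vector"
proof
  assume "- x = x"
  then have "2 *\<^sub>R x = 0" by (metis add.right_inverse scaleR_2)
  then show "x = 0" by simp
qed simp

lemma real_form_iff: "X \<in> real_form \<longleftrightarrow> conjugation X = X"
  by (auto simp: real_form_def conjugation_def prod_eq_iff image_iff neg_eq_self_iff)

lemma cext_simps:
  assumes "linear T"
  shows "cext T (X + Y) = cext T X + cext T Y"
    and "cext T (X - Y) = cext T X - cext T Y"
    and "cext T (- X) = - cext T X"
    and "cext T 0 = 0"
    and "cext T (cscale z X) = cscale z (cext T X)"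
    and "cext T (conjugation X) = conjugation (cext T X)"
  by (auto simp: cext_def conjugation_def cscale_def prod_eq_iff linear_add[OF assms]
      linear_diff[OF assms] linear_neg[OF assms] linear_scale[OF assms] linear_0[OF assms])

text \<open>The sesquilinear extension of \<open>Q\<close>: linear in the first argument,
  conjugate-linear in the second.\<close>

definition hermitian_ext :: "('u \<Rightarrow> 'u \<Rightarrow> real) \<Rightarrow> 'u \<times> 'u \<Rightarrow> 'u \<times> 'u \<Rightarrow> complex" where
  "hermitian_ext Q X Y = Complex (Q (fst X) (fst Y) + Q (snd X) (snd Y))
     (Q (snd X) (fst Y) - Q (fst X) (snd Y))"

context lie_algebra
begin

lemmas br_simps = bilinear_ladd[OF bracket_bilinear] bilinear_radd[OF bracket_bilinear]
  bilinear_lmul[OF bracket_bilinear] bilinear_rmul[OF bracket_bilinear]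
  bilinear_lneg[OF bracket_bilinear] bilinear_rneg[OF bracket_bilinear]
  bilinear_lsub[OF bracket_bilinear] bilinear_rsub[OF bracket_bilinear]
  bilinear_lzero[OF bracket_bilinear] bilinear_rzero[OF bracket_bilinear]

lemma br_skew: "br x y = - br y x"
proof -
  have "br x x + br y x + (br x y + br y y) = 0"
    using bracket_self[of "x + y"] by (simp only: br_simps)
  then have "br x y + br y x = 0"
    by (simp only: bracket_self add_0_left add_0_right add.commute)
  then show ?thesis by (simp only: eq_neg_iff_add_eq_0)
qed

lemma br_derivation: "br x (br y z) = br (br x y) z + br y (br x z)"
  using jacobi[of x y z] br_skew[of z "br x y"] br_skew[of z x]
  by (simp add: br_simps algebra_simps eq_neg_iff_add_eq_0)

abbreviation cb where "cb \<equiv> cbracket br"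

lemma cb_simps:
  "cb (X + Y) Z = cb X Z + cb Y Z"
  "cb Z (X + Y) = cb Z X + cb Z Y"
  "cb (X - Y) Z = cb X Z - cb Y Z"
  "cb Z (X - Y) = cb Z X - cb Z Y"
  "cb (- X) Z = - cb X Z"
  "cb Z (- X) = - cb Z X"
  "cb (cscale z X) Z = cscale z (cb X Z)"
  "cb Z (cscale z X) = cscale z (cb Z X)"
  "cb 0 Z = 0"
  "cb Z 0 = 0"
  by (auto simp: cbracket_def cscale_def prod_eq_iff br_simps algebra_simps)

lemma cb_sum: "cb (\<Sum>i\<in>A. f i) Z = (\<Sum>i\<in>A. cb (f i) Z)" "cb Z (\<Sum>i\<in>A. f i) = (\<Sum>i\<in>A. cb Z (f i))"
  by (induction A rule: infinite_finite_induct) (auto simp: cb_simps)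

lemma cb_scaleR: "cb (r *\<^sub>R X) Z = r *\<^sub>R cb X Z" "cb Z (r *\<^sub>R X) = r *\<^sub>R cb Z X"
  by (simp_all add: cb_simps flip: cscale_of_real)

lemma bilinear_cb: "bilinear cb"
  unfolding bilinear_def by (intro conjI allI linearI) (simp_all add: cb_simps cb_scaleR)

lemma linear_cb: "linear (cb X)"
  by (intro linearI) (simp_all add: cb_simps cb_scaleR)

lemma cb_skew: "cb X Y = - cb Y X"
  using br_skew[of "fst X" "fst Y"] br_skew[of "snd X" "fst Y"] br_skew[of "fst X" "snd Y"]
    br_skew[of "snd X" "snd Y"]
  by (simp add: cbracket_def prod_eq_iff)

lemma cb_self [simp]: "cb X X = 0"
  using br_skew[of "fst X" "snd X"] by (simp add: cbracket_def bracket_self prod_eq_iff)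

lemma cb_derivation: "cb X (cb Y Z) = cb (cb X Y) Z + cb Y (cb X Z)"
proof -
  obtain x x' y y' z z' where [simp]: "X = (x, x')" "Y = (y, y')" "Z = (z, z')"
    by (cases X; cases Y; cases Z)
  show ?thesis
    using br_derivation[of x y z] br_derivation[of x y' z'] br_derivation[of x' y z']
      br_derivation[of x' y' z] br_derivation[of x' y' z'] br_derivation[of x' y z]
      br_derivation[of x y' z] br_derivation[of x y z']
    by (simp add: cbracket_def br_simps algebra_simps)
qed

lemma conjugation_cb [simp]: "conjugation (cb X Y) = cb (conjugation X) (conjugation Y)"
  by (simp add: cbracket_def conjugation_def br_simps)

end

section \<open>Positivity of the invariant form\<close>

locale compact_form = lie_algebra br for br :: "'u::euclidean_space \<Rightarrow> 'u \<Rightarrow> 'u" +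
  fixes Q :: "'u \<Rightarrow> 'u \<Rightarrow> real"
  assumes Q_bilinear: "bilinear Q"
    and Q_sym: "Q x y = Q y x"
    and Q_pos: "x \<noteq> 0 \<Longrightarrow> Q x x > 0"
    and Q_invariant: "Q (br x y) z = - Q y (br x z)"
begin

abbreviation hf where "hf \<equiv> hermitian_ext Q"

lemmas Q_simps = bilinear_ladd[OF Q_bilinear] bilinear_radd[OF Q_bilinear]
  bilinear_lmul[OF Q_bilinear] bilinear_rmul[OF Q_bilinear]
  bilinear_lneg[OF Q_bilinear] bilinear_rneg[OF Q_bilinear]
  bilinear_lsub[OF Q_bilinear] bilinear_rsub[OF Q_bilinear]
  bilinear_lzero[OF Q_bilinear] bilinear_rzero[OF Q_bilinear]

lemma hf_simps:
  "hf (X + Y) Z = hf X Z + hf Y Z"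
  "hf Z (X + Y) = hf Z X + hf Z Y"
  "hf (X - Y) Z = hf X Z - hf Y Z"
  "hf Z (X - Y) = hf Z X - hf Z Y"
  "hf (- X) Z = - hf X Z"
  "hf Z (- X) = - hf Z X"
  "hf (cscale z X) Z = z * hf X Z"
  "hf Z (cscale z X) = cnj z * hf Z X"
  "hf 0 Z = 0"
  "hf Z 0 = 0"
  by (auto simp: hermitian_ext_def cscale_def complex_eq_iff Q_simps algebra_simps)

lemma cnj_hf: "cnj (hf X Y) = hf Y X"
  using Q_sym by (simp add: hermitian_ext_def complex_eq_iff)

lemma hf_conjugation: "hf (conjugation X) (conjugation Y) = hf Y X"
  using Q_sym by (simp add: hermitian_ext_def conjugation_def complex_eq_iff Q_simps)

lemma hf_cb: "hf (cb X Y) Z = - hf Y (cb (conjugation X) Z)"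
  by (simp add: hermitian_ext_def cbracket_def conjugation_def complex_eq_iff Q_simps br_simps Q_invariant)

lemma hf_self: "hf X X = of_real (Re (hf X X))"
  using cnj_hf[of X X] by (simp add: complex_eq_iff)

lemma hf_self_nonneg: "0 \<le> Re (hf X X)"
  using Q_pos[of "fst X"] Q_pos[of "snd X"]
  by (cases "fst X = 0"; cases "snd X = 0") (auto simp: hermitian_ext_def Q_simps)

lemma hf_self_pos: "X \<noteq> 0 \<Longrightarrow> 0 < Re (hf X X)"
  using Q_pos[of "fst X"] Q_pos[of "snd X"]
  by (cases "fst X = 0"; cases "snd X = 0") (auto simp: hermitian_ext_def Q_simps prod_eq_iff)

lemma hf_self_eq_0_iff [simp]: "hf X X = 0 \<longleftrightarrow> X = 0"
  using hf_self_pos[of X] by (cases "X = 0") (auto simp: hf_simps)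

text \<open>For real \<open>H\<close> the operator \<open>cb H\<close> is skew-adjoint, so
  |[H, Y]|^2 = -<Y, [H, [H, Y]]>. Whatever its square annihilates is already annihilated by
  \<open>cb H\<close>, and the exponent descends to 1.\<close>

lemma skew_nilpotent:
  assumes "conjugation H = H" "(cb H ^^ n) X = 0"
  shows "cb H X = 0"
  using assms(2)
proof (induction n)
  case 0 then show ?case by (simp add: cb_simps)
next
  case (Suc m)
  show ?case
  proof (cases m)
    case 0 with Suc.prems show ?thesis by simp
  next
    case (Suc k)
    let ?Y = "(cb H ^^ k) X"
    have "hf (cb H ?Y) (cb H ?Y) = - hf ?Y (cb H (cb H ?Y))"
      by (simp add: hf_cb assms(1))
    also have "cb H (cb H ?Y) = 0" using Suc.prems Suc by simp
    finally have "(cb H ^^ m) X = 0" by (simp add: Suc hf_simps)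
    with Suc.IH show ?thesis by blast
  qed
qed

end

section \<open>Roots of a conjugation-stable Cartan subalgebra\<close>

locale compact_cartan = compact_form br Q for br :: "'u::euclidean_space \<Rightarrow> 'u \<Rightarrow> 'u" and Q +
  fixes h :: "('u \<times> 'u) set"
  assumes cartan: "is_cartan_subalgebra br h" and conj_image: "conjugation ` h = h"
begin

lemma subspace_h: "cx.subspace h"
  using cartan by (simp add: is_cartan_subalgebra_def is_csubalgebra_def)

lemmas h_closed = cx.subspace_0[OF subspace_h] cx.subspace_add[OF subspace_h]
  cx.subspace_diff[OF subspace_h] cx.subspace_neg[OF subspace_h] cx.subspace_scale[OF subspace_h]

lemma conjugation_h: "H \<in> h \<Longrightarrow> conjugation H \<in> h"
  using conj_image by blast

lemma normalizer_h: "normalizer br h = h"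
  using cartan by (simp add: is_cartan_subalgebra_def)

text \<open>Nilpotency of \<open>h\<close> makes \<open>cb H\<close> nilpotent on \<open>h\<close>;
  skew-adjointness then makes it vanish there for real \<open>H\<close>.\<close>

lemma h_abelian:
  assumes "H \<in> h" "X \<in> h"
  shows "cb H X = 0"
proof -
  obtain n where n: "lower_central br h n = {0}"
    using cartan by (auto simp: is_cartan_subalgebra_def)
  have real: "cb H X = 0" if "H \<in> h" "conjugation H = H" for H
  proof -
    have "(cb H ^^ k) X \<in> lower_central br h k" for k
      using that(1) assms(2) by (induction k) (auto intro!: cx.span_base simp del: split_paired_Ex)
    with n have "(cb H ^^ n) X = 0" by blast
    with that(2) show ?thesis by (rule skew_nilpotent)
  qed
  \<comment> \<open>Both are real elements of \<open>h\<close>, because \<open>h\<close> is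
    conjugation-stable, and 2 H = U - i V.\<close>
  let ?U = "H + conjugation H" and ?V = "cscale \<i> (H - conjugation H)"
  have "cb ?U X = 0"
    by (rule real) (auto simp: assms(1) h_closed conjugation_h add.commute)
  moreover have "cb ?V X = 0"
    by (rule real) (auto simp: assms(1) h_closed conjugation_h cx.scale_right_diff_distrib)
  ultimately have "cb H X + cb H X = 0" by (simp add: cb_simps)
  then show ?thesis by (simp add: prod_eq_iff flip: scaleR_2)
qed

abbreviation rs where "rs \<equiv> root_space br h"
abbreviation \<Delta> where "\<Delta> \<equiv> roots br h"
abbreviation cr where "cr \<equiv> coroot br h"

lemma rs_D: "X \<in> rs \<alpha> \<Longrightarrow> H \<in> h \<Longrightarrow> cb H X = cscale (\<alpha> H) X"
  by (simp add: root_space_def)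

lemma rs_D': "X \<in> rs \<alpha> \<Longrightarrow> H \<in> h \<Longrightarrow> cb X H = cscale (- \<alpha> H) X"
  using cb_skew[of X H] by (simp add: root_space_def)

lemma dual_simps:
  assumes "\<alpha> \<in> dual_space h"
  shows "X \<in> h \<Longrightarrow> Y \<in> h \<Longrightarrow> \<alpha> (X + Y) = \<alpha> X + \<alpha> Y"
    and "X \<in> h \<Longrightarrow> \<alpha> (cscale z X) = z * \<alpha> X"
    and "X \<notin> h \<Longrightarrow> \<alpha> X = 0"
    and "X \<in> h \<Longrightarrow> \<alpha> (- X) = - \<alpha> X"
    and "X \<in> h \<Longrightarrow> Y \<in> h \<Longrightarrow> \<alpha> (X - Y) = \<alpha> X - \<alpha> Y"
    and "\<alpha> 0 = 0"
proof -
  show add: "\<alpha> (X + Y) = \<alpha> X + \<alpha> Y" if "X \<in> h" "Y \<in> h" for X Y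
    using assms that by (auto simp: dual_space_def)
  show scale: "\<alpha> (cscale z X) = z * \<alpha> X" if "X \<in> h" for X z
    using assms that by (auto simp: dual_space_def)
  show "X \<notin> h \<Longrightarrow> \<alpha> X = 0"
    using assms by (auto simp: dual_space_def)
  show neg: "\<alpha> (- X) = - \<alpha> X" if "X \<in> h" for X
    using scale[OF that, of "-1"] by simp
  show "\<alpha> (X - Y) = \<alpha> X - \<alpha> Y" if "X \<in> h" "Y \<in> h"
    using add[OF that(1), of "- Y"] that neg[OF that(2)] h_closed by simp
  show "\<alpha> 0 = 0" using scale[OF h_closed(1), of 0] by simp
qed

lemma dual_closed:
  "\<alpha> \<in> dual_space h \<Longrightarrow> \<beta> \<in> dual_space h \<Longrightarrow> \<alpha> + \<beta> \<in> dual_space h"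
  "\<alpha> \<in> dual_space h \<Longrightarrow> \<beta> \<in> dual_space h \<Longrightarrow> \<alpha> - \<beta> \<in> dual_space h"
  "\<alpha> \<in> dual_space h \<Longrightarrow> - \<alpha> \<in> dual_space h"
  "0 \<in> dual_space h"
  by (auto simp: dual_space_def algebra_simps)

lemma root_dual: "\<alpha> \<in> \<Delta> \<Longrightarrow> \<alpha> \<in> dual_space h"
  by (simp add: roots_def)

lemma dual_eqI:
  assumes "\<alpha> \<in> dual_space h" "\<beta> \<in> dual_space h" "\<And>H. H \<in> h \<Longrightarrow> \<alpha> H = \<beta> H"
  shows "\<alpha> = \<beta>"
  using assms dual_simps(3) by (metis ext)

lemma subspace_rs: "cx.subspace (rs \<alpha>)"
  by (auto simp: cx.subspace_def root_space_def cb_simps cx.scale_right_distrib cx.scale_scale mult.commute)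

lemmas rs_closed = cx.subspace_0[OF subspace_rs] cx.subspace_add[OF subspace_rs]
  cx.subspace_diff[OF subspace_rs] cx.subspace_neg[OF subspace_rs] cx.subspace_scale[OF subspace_rs]

lemma rs_zero: "rs 0 = h"
proof
  show "h \<subseteq> rs 0" by (auto simp: root_space_def h_abelian)
  have "X \<in> normalizer br h" if "X \<in> rs 0" for X
    using rs_D'[OF that] h_closed by (auto simp: normalizer_def)
  then show "rs 0 \<subseteq> h" using normalizer_h by blast
qed

lemma rootI:
  assumes "\<alpha> \<in> dual_space h" "X \<in> rs \<alpha>" "X \<noteq> 0"
  shows "\<alpha> = 0 \<or> \<alpha> \<in> \<Delta>"
  using assms by (auto simp: roots_def)

lemma root_nonzero: "\<alpha> \<in> \<Delta> \<Longrightarrow> \<alpha> \<noteq> 0"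
  by (simp add: roots_def)

lemma root_vector:
  assumes "\<alpha> \<in> \<Delta>" obtains X where "X \<in> rs \<alpha>" "X \<noteq> 0"
  using assms rs_closed(1)[of \<alpha>] by (auto simp: roots_def)

lemma cb_rs: "X \<in> rs \<alpha> \<Longrightarrow> Y \<in> rs \<beta> \<Longrightarrow> cb X Y \<in> rs (\<alpha> + \<beta>)"
  by (auto simp: root_space_def cb_derivation[of _ X Y] cb_simps cx.scale_left_distrib)

text \<open>Pairing an eigenvector of \<open>cb H\<close> with itself moves the operator to the
  other side as minus \<open>cb (conjugation H)\<close>, where the eigenvalue equation applies
  again. Consequently roots are imaginary on real elements of \<open>h\<close>.\<close>

lemma root_conjugation:
  assumes "\<alpha> \<in> \<Delta>" "H \<in> h"
  shows "\<alpha> (conjugation H) = - cnj (\<alpha> H)"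
proof -
  obtain X where X: "X \<in> rs \<alpha>" "X \<noteq> 0" using root_vector[OF assms(1)] .
  have "\<alpha> H * hf X X = - hf X (cb (conjugation H) X)"
    using rs_D[OF X(1) assms(2)] hf_cb[of H X X] by (simp add: hf_simps)
  also have "\<dots> = - cnj (\<alpha> (conjugation H)) * hf X X"
    using rs_D[OF X(1) conjugation_h[OF assms(2)]] by (simp add: hf_simps)
  finally have "\<alpha> H = - cnj (\<alpha> (conjugation H))" using X(2) by (simp only: mult_cancel_right hf_self_eq_0_iff simp_thms)
  then show ?thesis by (metis complex_cnj_cnj complex_cnj_minus minus_minus)
qed

lemma conjugation_rs:
  assumes "\<alpha> \<in> \<Delta>" "X \<in> rs \<alpha>"
  shows "conjugation X \<in> rs (- \<alpha>)"
  unfolding root_space_def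
proof safe
  fix H assume H: "H \<in> h"
  have "cb H (conjugation X) = conjugation (cb (conjugation H) X)" by simp
  also have "\<dots> = conjugation (cscale (\<alpha> (conjugation H)) X)"
    using rs_D[OF assms(2) conjugation_h[OF H]] by simp
  finally show "cb H (conjugation X) = cscale ((- \<alpha>) H) (conjugation X)"
    using root_conjugation[OF assms(1) H] by simp
qed

lemma uminus_root: "\<alpha> \<in> \<Delta> \<Longrightarrow> - \<alpha> \<in> \<Delta>"
proof -
  assume a: "\<alpha> \<in> \<Delta>"
  then obtain X where "X \<in> rs \<alpha>" "X \<noteq> 0" using root_vector by blast
  with a rootI[of "- \<alpha>" "conjugation X"] conjugation_rs[OF a] root_nonzero[OF a] show ?thesis
    by (auto simp: dual_closed root_dual)
qed

lemma uminus_root_iff [simp]: "- \<alpha> \<in> \<Delta> \<longleftrightarrow> \<alpha> \<in> \<Delta>"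
  using uminus_root[of \<alpha>] uminus_root[of "- \<alpha>"] by auto

text \<open>An \<open>H\<close> that separates the two weights produces two different multiples of
  one and the same pairing.\<close>

lemma rs_orthogonal:
  assumes "\<alpha> = 0 \<or> \<alpha> \<in> \<Delta>" "\<beta> = 0 \<or> \<beta> \<in> \<Delta>" "\<alpha> \<noteq> \<beta>" "X \<in> rs \<alpha>" "Y \<in> rs \<beta>"
  shows "hf X Y = 0"
proof -
  have "\<alpha> \<in> dual_space h" "\<beta> \<in> dual_space h"
    using assms(1,2) root_dual dual_closed by auto
  then obtain H where H: "H \<in> h" "\<alpha> H \<noteq> \<beta> H" using dual_eqI assms(3) by blast
  have "\<alpha> H * hf X Y = - hf X (cb (conjugation H) Y)"
    using rs_D[OF assms(4) H(1)] hf_cb[of H X Y] by (simp add: hf_simps)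
  also have "\<dots> = \<beta> H * hf X Y"
    using rs_D[OF assms(5) conjugation_h[OF H(1)]] root_conjugation[of \<beta> H] assms(2) H(1)
    by (auto simp: hf_simps)
  finally show ?thesis using H(2) by simp
qed

lemma hf_h_eq_0:
  assumes "X \<in> h" "\<And>H. H \<in> h \<Longrightarrow> hf X H = 0"
  shows "X = 0"
  using assms(2)[OF assms(1)] by simp

lemma hf_cb_rs:
  assumes "\<alpha> \<in> \<Delta>" "Y \<in> rs \<alpha>" "H \<in> h"
  shows "hf (cb Y Z) H = - cnj (\<alpha> H) * hf Z (conjugation Y)"
proof -
  have "hf (cb Y Z) H = hf Z (cb H (conjugation Y))"
    using hf_cb[of Y Z H] cb_skew[of H "conjugation Y"] by (simp add: hf_simps)
  then show ?thesis
    using rs_D[OF conjugation_rs[OF assms(1,2)] assms(3)] by (simp add: hf_simps)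
qed

text \<open>\<open>[g(\<alpha>), g(-\<alpha>)]\<close> is a line because each of its elements pairs with \<open>h\<close> like a multiple
  of \<open>\<alpha>\<close>.\<close>

lemma cb_opposite_rs:
  assumes "\<alpha> \<in> \<Delta>" "X \<in> rs \<alpha>" "X \<noteq> 0" "Y \<in> rs \<alpha>" "Z \<in> rs (- \<alpha>)"
  shows "cb Y Z = cscale (hf Z (conjugation Y) / hf X X) (cb X (conjugation X))" (is "_ = ?r")
proof -
  have "cb Y Z \<in> h" "cb X (conjugation X) \<in> h"
    using cb_rs[OF assms(4,5)] cb_rs[OF assms(2) conjugation_rs[OF assms(1,2)]] by (auto simp: rs_zero)
  then have mem: "cb Y Z - ?r \<in> h" by (simp add: h_closed)
  have "hf (cb Y Z - ?r) H = 0" if "H \<in> h" for H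
    using hf_cb_rs[OF assms(1,4) that] hf_cb_rs[OF assms(1,2) that] assms(3)
    by (simp add: hf_simps hf_conjugation)
  from hf_h_eq_0[OF mem this] show ?thesis by simp
qed

text \<open>By \<open>hf_cb_rs\<close> the bracket pairs with \<open>h\<close> like -|X|^2 times the
  conjugate of alpha. If alpha vanished on it, it would be orthogonal to itself, hence 0, and alpha
  would vanish on all of \<open>h\<close>.\<close>

lemma cb_conjugation_rs:
  assumes "\<alpha> \<in> \<Delta>" "X \<in> rs \<alpha>" "X \<noteq> 0"
  shows "cb X (conjugation X) \<in> h" "\<alpha> (cb X (conjugation X)) \<noteq> 0"
proof -
  let ?T = "cb X (conjugation X)"
  show T: "?T \<in> h"
    using cb_rs[OF assms(2) conjugation_rs[OF assms(1,2)]] by (auto simp: rs_zero)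
  have pair: "hf ?T H = - cnj (\<alpha> H) * hf X X" if "H \<in> h" for H
    using hf_cb_rs[OF assms(1,2) that] by (simp add: hf_conjugation)
  show "\<alpha> ?T \<noteq> 0"
  proof
    assume "\<alpha> ?T = 0"
    with pair[OF T] have "?T = 0" by simp
    with pair assms(3) have "\<alpha> H = 0" if "H \<in> h" for H using that by (simp add: hf_simps)
    then have "\<alpha> = 0" by (intro dual_eqI) (auto simp: root_dual dual_closed assms(1))
    with assms(1) root_nonzero show False by blast
  qed
qed

text \<open>The brackets of the two root spaces span the line through T = [X, conjugation X], and
  alpha(T) is not 0. So exactly one multiple of T fits the definite description.\<close>

lemma coroot:
  assumes "\<alpha> \<in> \<Delta>"
  shows "cr \<alpha> \<in> h" "\<alpha> (cr \<alpha>) = 2"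
proof -
  obtain X where X: "X \<in> rs \<alpha>" "X \<noteq> 0" using root_vector[OF assms] .
  let ?T = "cb X (conjugation X)"
  let ?S = "{cb X Y | X Y. X \<in> rs \<alpha> \<and> Y \<in> rs (- \<alpha>)}"
  note T = cb_conjugation_rs[OF assms X]
  have 1: "cx.span ?S \<subseteq> cx.span {?T}"
    by (intro cx.span_minimal cx.subspace_span)
      (auto simp: cb_opposite_rs[OF assms X] intro!: cx.span_scale cx.span_base[OF singletonI] simp del: split_paired_All)
  have span: "cx.span ?S = range (\<lambda>c. cscale c ?T)"
  proof
    show "cx.span ?S \<subseteq> range (\<lambda>c. cscale c ?T)" using 1 by (simp add: cx.span_singleton)
    have "?T \<in> ?S" using X conjugation_rs[OF assms] by blast
    from cx.span_scale[OF cx.span_base[OF this]] show "range (\<lambda>c. cscale c ?T) \<subseteq> cx.span ?S"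
      by (simp add: image_subset_iff)
  qed
  have "\<exists>!H. H \<in> cx.span ?S \<and> \<alpha> H = 2"
  proof (rule ex1I)
    show "cscale (2 / \<alpha> ?T) ?T \<in> cx.span ?S \<and> \<alpha> (cscale (2 / \<alpha> ?T) ?T) = 2"
      using T unfolding span by (auto simp: dual_simps[OF root_dual[OF assms]])
    show "H = cscale (2 / \<alpha> ?T) ?T" if "H \<in> cx.span ?S \<and> \<alpha> H = 2" for H
    proof -
      from that obtain c where c: "H = cscale c ?T" unfolding span by blast
      with that T have "c = 2 / \<alpha> ?T"
        by (simp add: dual_simps[OF root_dual[OF assms]] field_simps)
      with c show ?thesis by simp
    qed
  qed
  from theI'[OF this] have *: "cr \<alpha> \<in> cx.span ?S \<and> \<alpha> (cr \<alpha>) = 2"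
    unfolding coroot_def .
  then show "\<alpha> (cr \<alpha>) = 2" by blast
  from * show "cr \<alpha> \<in> h" unfolding span using T by (auto simp: h_closed)
qed

end

section \<open>Root strings, positive roots and the stem\<close>

locale chevalley_basis = compact_cartan br Q h
  for br :: "'u::euclidean_space \<Rightarrow> 'u \<Rightarrow> 'u" and Q h +
  fixes E :: "'u functional \<Rightarrow> 'u \<times> 'u"
  assumes basis: "is_weyl_chevalley_basis br h E"
begin

lemma E_rs: "\<alpha> \<in> \<Delta> \<Longrightarrow> E \<alpha> \<in> rs \<alpha>"
  and cb_E: "\<alpha> \<in> \<Delta> \<Longrightarrow> cb (E \<alpha>) (E (- \<alpha>)) = cr \<alpha>"
  and conjugation_E: "\<alpha> \<in> \<Delta> \<Longrightarrow> conjugation (E \<alpha>) = - E (- \<alpha>)"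
  and conjugation_cr: "\<alpha> \<in> \<Delta> \<Longrightarrow> conjugation (cr \<alpha>) = - cr \<alpha>"
  using basis by (auto simp: is_weyl_chevalley_basis_def)

lemma cr_uminus: "\<alpha> \<in> \<Delta> \<Longrightarrow> cr (- \<alpha>) = - cr \<alpha>"
  using cb_E[of \<alpha>] cb_E[of "- \<alpha>"] cb_skew[of "E (- \<alpha>)" "E \<alpha>"] by simp

lemma cb_E': "\<alpha> \<in> \<Delta> \<Longrightarrow> cb (E (- \<alpha>)) (E \<alpha>) = - cr \<alpha>"
  using cb_E[of "- \<alpha>"] cr_uminus by simp

lemma E_nonzero: "\<alpha> \<in> \<Delta> \<Longrightarrow> E \<alpha> \<noteq> 0"
  using cb_E[of \<alpha>] coroot[of \<alpha>] by (auto simp: cb_simps dual_simps(6)[OF root_dual])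

text \<open>Coroots are negated by conjugation, and \<open>root_conjugation\<close> turns this into
  reality.\<close>

lemma root_cr_real:
  assumes "\<alpha> \<in> \<Delta>" "\<beta> \<in> \<Delta>"
  shows "\<beta> (cr \<alpha>) = of_real (Re (\<beta> (cr \<alpha>)))"
  using root_conjugation[OF assms(2) coroot(1)[OF assms(1)]] coroot(1)[OF assms(1)]
  by (simp add: conjugation_cr assms dual_simps[OF root_dual[OF assms(2)]] complex_eq_iff)

text \<open>The sign in \<open>conjugation (E \<alpha>) = - E (- \<alpha>)\<close> cancels the one
  in \<open>hf_cb\<close>, so opposite root vectors act as adjoint operators.\<close>

lemma hf_cb_E:
  assumes "\<alpha> \<in> \<Delta>"
  shows "hf (cb (E \<alpha>) Y) Z = hf Y (cb (E (- \<alpha>)) Z)"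
  by (simp add: hf_cb conjugation_E[OF assms] cb_simps hf_simps)

definition nrm :: "'u \<times> 'u \<Rightarrow> real" where "nrm X = Re (hf X X)"

lemma nrm_pos: "X \<noteq> 0 \<Longrightarrow> 0 < nrm X"
  and nrm_nonneg: "0 \<le> nrm X"
  by (auto simp: nrm_def hf_self_pos hf_self_nonneg)

lemma nrm_eq_0_iff [simp]: "nrm X = 0 \<longleftrightarrow> X = 0"
  using nrm_pos[of X] by (cases "X = 0") (auto simp: nrm_def hf_simps)

lemma nrm_zero [simp]: "nrm 0 = 0"
  by simp

lemma nrm_scale: "nrm (cscale z X) = (cmod z)\<^sup>2 * nrm X"
  using hf_self[of X] cmod_power2[of z]
  by (simp add: nrm_def hf_simps complex_eq_iff algebra_simps power2_eq_square)

lemma sl2_step: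
  assumes "\<alpha> \<in> \<Delta>" "Y \<in> rs \<beta>"
  shows "cb (E \<alpha>) (cb (E (- \<alpha>)) Y) = cscale (\<beta> (cr \<alpha>)) Y + cb (E (- \<alpha>)) (cb (E \<alpha>) Y)"
  using cb_derivation[of "E \<alpha>" "E (- \<alpha>)" Y] rs_D[OF assms(2) coroot(1)[OF assms(1)]]
  by (simp add: cb_E[OF assms(1)])

text \<open>Adjointness turns |E_-alpha Y|^2 into <E_alpha E_-alpha Y, Y>, and
  \<open>sl2_step\<close> exchanges the two operators at the cost of the weight. The lemmas
  \<open>rs_eq\<close>, \<open>root_diff\<close> and \<open>string_end\<close> are read off from the
  signs in this identity.\<close>

lemma nrm_cb_E:
  assumes "\<alpha> \<in> \<Delta>" "Y \<in> rs \<beta>"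
  shows "nrm (cb (E (- \<alpha>)) Y) = Re (\<beta> (cr \<alpha>)) * nrm Y + nrm (cb (E \<alpha>) Y)"
proof -
  have "hf (cb (E (- \<alpha>)) Y) (cb (E (- \<alpha>)) Y) = hf (cb (E \<alpha>) (cb (E (- \<alpha>)) Y)) Y"
    by (simp add: hf_cb_E[OF assms(1)])
  also have "\<dots> = \<beta> (cr \<alpha>) * hf Y Y + hf (cb (E \<alpha>) Y) (cb (E \<alpha>) Y)"
    using hf_cb_E[of "- \<alpha>" "cb (E \<alpha>) Y" Y] assms(1)
    by (simp add: sl2_step[OF assms] hf_simps)
  also have "\<beta> (cr \<alpha>) * hf Y Y = \<beta> (cr \<alpha>) * of_real (nrm Y)"
    unfolding nrm_def by (subst hf_self) simp
  finally have "Re (hf (cb (E (- \<alpha>)) Y) (cb (E (- \<alpha>)) Y))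
      = Re (\<beta> (cr \<alpha>) * of_real (nrm Y) + hf (cb (E \<alpha>) Y) (cb (E \<alpha>) Y))"
    by (rule arg_cong)
  then show ?thesis by (simp only: nrm_def plus_complex.sel times_complex.sel Re_complex_of_real
        Im_complex_of_real mult_zero_right diff_zero)
qed

text \<open>The coordinate is an orthogonal projection, so it makes sense on the whole
  complexification before a root space decomposition is established.\<close>

definition root_coeff :: "'u functional \<Rightarrow> 'u \<times> 'u \<Rightarrow> complex" where
  "root_coeff \<alpha> X = hf X (E \<alpha>) / hf (E \<alpha>) (E \<alpha>)"

lemma root_coeff_simps:
  "root_coeff \<alpha> (X + Y) = root_coeff \<alpha> X + root_coeff \<alpha> Y"
  "root_coeff \<alpha> (X - Y) = root_coeff \<alpha> X - root_coeff \<alpha> Y"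
  "root_coeff \<alpha> (- X) = - root_coeff \<alpha> X"
  "root_coeff \<alpha> (cscale z X) = z * root_coeff \<alpha> X"
  "root_coeff \<alpha> 0 = 0"
  by (auto simp: root_coeff_def hf_simps add_divide_distrib diff_divide_distrib)

lemma root_coeff_sum: "root_coeff \<alpha> (\<Sum>i\<in>A. f i) = (\<Sum>i\<in>A. root_coeff \<alpha> (f i))"
  by (induction A rule: infinite_finite_induct) (auto simp: root_coeff_simps)

lemma root_coeff_E: "\<alpha> \<in> \<Delta> \<Longrightarrow> root_coeff \<alpha> (E \<alpha>) = 1"
  by (simp add: root_coeff_def E_nonzero)

lemma root_coeff_rs_other: "\<alpha> \<in> \<Delta> \<Longrightarrow> \<beta> = 0 \<or> \<beta> \<in> \<Delta> \<Longrightarrow> \<alpha> \<noteq> \<beta> \<Longrightarrow> X \<in> rs \<beta> \<Longrightarrow> root_coeff \<alpha> X = 0"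
  using rs_orthogonal[of \<beta> \<alpha> X "E \<alpha>"] E_rs by (auto simp: root_coeff_def)

lemma root_coeff_h: "\<alpha> \<in> \<Delta> \<Longrightarrow> X \<in> h \<Longrightarrow> root_coeff \<alpha> X = 0"
  using root_coeff_rs_other[of \<alpha> 0 X] root_nonzero[of \<alpha>] by (auto simp: rs_zero)

text \<open>Any \<open>Y' \<in> g(\<alpha>)\<close> annihilated by \<open>E (- \<alpha>)\<close> satisfies
  \<open>0 = 2 \<bar>Y'\<bar>\<^sup>2 + \<bar>[E \<alpha>, Y']\<bar>\<^sup>2\<close>; hence root spaces are one-dimensional.\<close>

lemma rs_eq:
  assumes "\<alpha> \<in> \<Delta>" "Y \<in> rs \<alpha>"
  shows "Y = cscale (root_coeff \<alpha> Y) (E \<alpha>)"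
proof -
  have uE: "- \<alpha> \<in> \<Delta>" "E (- \<alpha>) \<in> rs (- \<alpha>)" using assms(1) E_rs[of "- \<alpha>"] by auto
  define k where "k = - (hf (E (- \<alpha>)) (conjugation Y) / hf (E \<alpha>) (E \<alpha>))"
  have "cb (E \<alpha>) (conjugation (E \<alpha>)) = - cr \<alpha>"
    by (simp add: conjugation_E[OF assms(1)] cb_simps cb_E[OF assms(1)])
  then have k: "cb Y (E (- \<alpha>)) = cscale k (cr \<alpha>)"
    using cb_opposite_rs[OF assms(1) E_rs[OF assms(1)] E_nonzero[OF assms(1)] assms(2) uE(2)]
    by (simp add: k_def)
  let ?Y = "Y - cscale k (E \<alpha>)"
  have mem: "?Y \<in> rs \<alpha>" by (intro rs_closed assms E_rs)
  have "cb (E (- \<alpha>)) Y = - cscale k (cr \<alpha>)" using k cb_skew[of "E (- \<alpha>)" Y] by simp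
  then have "cb (E (- \<alpha>)) ?Y = 0"
    by (simp add: cb_simps cb_E'[OF assms(1)])
  with nrm_cb_E[OF assms(1) mem] coroot(2)[OF assms(1)]
  have "0 = 2 * nrm ?Y + nrm (cb (E \<alpha>) ?Y)" by (simp add: nrm_def hf_simps)
  then have "?Y = 0" using nrm_nonneg[of ?Y] nrm_nonneg[of "cb (E \<alpha>) ?Y"] nrm_eq_0_iff[of ?Y] by linarith
  then have Y: "Y = cscale k (E \<alpha>)" by simp
  then have "root_coeff \<alpha> Y = k" by (simp add: root_coeff_simps root_coeff_E[OF assms(1)])
  with Y show ?thesis by simp
qed

lemma rs_trivial:
  assumes "\<alpha> \<in> dual_space h" "\<alpha> \<noteq> 0" "\<alpha> \<notin> \<Delta>" "X \<in> rs \<alpha>"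
  shows "X = 0"
  using rootI[OF assms(1,4)] assms(2,3) by blast

lemma cb_E_eq_0:
  assumes "\<alpha> \<in> \<Delta>" "\<beta> \<in> \<Delta>" "\<alpha> + \<beta> \<noteq> 0" "\<alpha> + \<beta> \<notin> \<Delta>"
  shows "cb (E \<alpha>) (E \<beta>) = 0"
  using rs_trivial[OF dual_closed(1)[OF root_dual[OF assms(1)] root_dual[OF assms(2)]] assms(3,4)
      cb_rs[OF E_rs[OF assms(1)] E_rs[OF assms(2)]]] .

text \<open>For a positive weight, \<open>nrm_cb_E\<close> keeps \<open>E (- \<alpha>)\<close> from
  annihilating \<open>E \<beta>\<close>, and the bracket is a nonzero vector of weight beta -
  alpha.\<close>

lemma root_diff:
  assumes "\<alpha> \<in> \<Delta>" "\<beta> \<in> \<Delta>" "Re (\<beta> (cr \<alpha>)) > 0"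
  shows "\<beta> - \<alpha> = 0 \<or> \<beta> - \<alpha> \<in> \<Delta>"
proof -
  have "nrm (cb (E (- \<alpha>)) (E \<beta>)) > 0"
    using nrm_cb_E[OF assms(1) E_rs[OF assms(2)]] assms(3) nrm_pos[OF E_nonzero[OF assms(2)]]
      nrm_nonneg[of "cb (E \<alpha>) (E \<beta>)"] by (simp add: add_pos_nonneg)
  then have "cb (E (- \<alpha>)) (E \<beta>) \<noteq> 0" by (metis less_irrefl nrm_eq_0_iff)
  then have "- \<alpha> + \<beta> = 0 \<or> - \<alpha> + \<beta> \<in> \<Delta>"
    using assms cb_E_eq_0[of "- \<alpha>" \<beta>] by auto
  then show ?thesis by (simp add: add.commute)
qed

lemma root_add:
  assumes "\<alpha> \<in> \<Delta>" "\<beta> \<in> \<Delta>" "Re (\<beta> (cr \<alpha>)) < 0"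
  shows "\<beta> + \<alpha> = 0 \<or> \<beta> + \<alpha> \<in> \<Delta>"
  using root_diff[of "- \<alpha>" \<beta>] assms coroot(1)[OF assms(1)]
  by (simp add: cr_uminus dual_simps[OF root_dual])

text \<open>Beside alpha, only alpha - delta can still occur next to it. Put k = alpha(H_delta), Y =
  E_alpha and Z = [E_-delta, Y]. Then |Z|^2 = k |Y|^2, and \<open>nrm_cb_E\<close> applied to Z
  gives 0 = k (2 k - 2) |Y|^2.\<close>

lemma string_end:
  assumes "\<alpha> \<in> \<Delta>" "\<delta> \<in> \<Delta>" "\<alpha> + \<delta> \<noteq> 0" "\<alpha> + \<delta> \<notin> \<Delta>" "\<alpha> - \<delta> - \<delta> \<noteq> 0" "\<alpha> - \<delta> - \<delta> \<notin> \<Delta>"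
  shows "Re (\<alpha> (cr \<delta>)) = 0 \<or> Re (\<alpha> (cr \<delta>)) = 1"
proof -
  let ?k = "Re (\<alpha> (cr \<delta>))" and ?Y = "E \<alpha>"
  let ?Z = "cb (E (- \<delta>)) ?Y"
  note Y = E_rs[OF assms(1)]
  have EY: "cb (E \<delta>) ?Y = 0"
    using cb_E_eq_0[of \<delta> \<alpha>] assms by (simp add: add.commute)
  have Z: "?Z \<in> rs (- \<delta> + \<alpha>)"
    by (rule cb_rs[OF E_rs Y]) (simp add: assms(2))
  have "cb (E (- \<delta>)) ?Z \<in> rs (- \<delta> + (- \<delta> + \<alpha>))"
    by (rule cb_rs[OF E_rs Z]) (simp add: assms(2))
  moreover have "- \<delta> + (- \<delta> + \<alpha>) = \<alpha> - \<delta> - \<delta>" by (simp add: algebra_simps)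
  moreover have "\<alpha> - \<delta> - \<delta> \<in> dual_space h"
    by (intro dual_closed root_dual assms)
  ultimately have FZ: "cb (E (- \<delta>)) ?Z = 0"
    using rs_trivial assms(5,6) by metis
  have EZ: "cb (E \<delta>) ?Z = cscale (of_real ?k) ?Y"
    using sl2_step[OF assms(2) Y] root_cr_real[OF assms(2,1)] by (simp add: EY cb_simps)
  have nZ: "nrm ?Z = ?k * nrm ?Y"
    using nrm_cb_E[OF assms(2) Y] EY by (simp add: nrm_def hf_simps)
  have "0 = (?k - 2) * nrm ?Z + nrm (cscale (of_real ?k) ?Y)"
    using nrm_cb_E[OF assms(2) Z] FZ coroot[OF assms(2)]
    by (simp add: EZ nrm_def hf_simps algebra_simps)
  then have "0 = ?k * (2 * ?k - 2) * nrm ?Y"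
    by (simp add: nZ nrm_scale power2_eq_square algebra_simps)
  then show ?thesis using nrm_pos[OF E_nonzero[OF assms(1)]] by auto
qed

text \<open>Root vectors of different roots are linearly independent over the reals in a
  finite-dimensional space.\<close>

lemma finite_roots: "finite \<Delta>"
proof -
  have inj: "inj_on E \<Delta>"
  proof (rule inj_onI, rule ccontr)
    fix \<alpha> \<beta> assume a: "\<alpha> \<in> \<Delta>" "\<beta> \<in> \<Delta>" "E \<alpha> = E \<beta>" "\<alpha> \<noteq> \<beta>"
    have "hf (E \<alpha>) (E \<beta>) = 0" by (rule rs_orthogonal[of \<alpha> \<beta>]) (auto simp: a(1,2,4) E_rs)
    with a E_nonzero[of \<beta>] show False by simp
  qed
  have "independent (E ` \<Delta>)"
    unfolding dependent_explicit
  proof safe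
    fix T u X assume T: "finite T" "T \<subseteq> E ` \<Delta>" "(\<Sum>v\<in>T. u v *\<^sub>R v) = 0" and X: "X \<in> T" "u X \<noteq> (0::real)"
    obtain \<alpha> where \<alpha>: "\<alpha> \<in> \<Delta>" "X = E \<alpha>" using T X by blast
    have "root_coeff \<alpha> (u v *\<^sub>R v) = (if v = X then of_real (u X) else 0)" if "v \<in> T" for v
    proof -
      obtain \<beta> where "\<beta> \<in> \<Delta>" "v = E \<beta>" using T \<open>v \<in> T\<close> by blast
      then show ?thesis using root_coeff_E[OF \<alpha>(1)] root_coeff_rs_other[OF \<alpha>(1), of \<beta> v] E_rs[of \<beta>] \<alpha> inj
        by (auto simp: root_coeff_simps inj_on_eq_iff simp flip: cscale_of_real)
    qed
    then have "root_coeff \<alpha> (\<Sum>v\<in>T. u v *\<^sub>R v) = (\<Sum>v\<in>T. if v = X then of_real (u X) else 0)"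
      unfolding root_coeff_sum by (intro sum.cong refl)
    also have "\<dots> = of_real (u X)" using T X by simp
    finally show False using T X by (simp add: root_coeff_simps)
  qed
  then have "finite (E ` \<Delta>)" by (rule finiteI_independent)
  then show ?thesis using inj by (rule finite_imageD)
qed

end

section \<open>Positive roots and induction from the top\<close>

locale positive_roots = chevalley_basis br Q h E
  for br :: "'u::euclidean_space \<Rightarrow> 'u \<Rightarrow> 'u" and Q h E +
  fixes P :: "'u functional set"
  assumes positive: "is_positive_system br h P"
begin

lemma roots_eq: "\<Delta> = P \<union> uminus ` P"
  and P_disjoint: "P \<inter> uminus ` P = {}"
  using positive by (simp_all add: is_positive_system_def)

lemma P_add: "\<alpha> \<in> P \<Longrightarrow> \<beta> \<in> P \<Longrightarrow> \<alpha> + \<beta> \<in> \<Delta> \<Longrightarrow> \<alpha> + \<beta> \<in> P"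
  using positive by (simp add: is_positive_system_def)

lemma P_root: "\<alpha> \<in> P \<Longrightarrow> \<alpha> \<in> \<Delta>"
  using roots_eq by blast

lemma root_P: "\<alpha> \<in> \<Delta> \<Longrightarrow> \<alpha> \<in> P \<or> - \<alpha> \<in> P"
  unfolding roots_eq by auto

lemma P_uminus: "\<alpha> \<in> P \<Longrightarrow> - \<alpha> \<notin> P"
  using P_disjoint by (metis IntI empty_iff image_eqI minus_minus)

lemma root_P_cases:
  assumes "\<alpha> - \<beta> = 0 \<or> \<alpha> - \<beta> \<in> \<Delta>"
  obtains "\<alpha> = \<beta>" | "\<alpha> - \<beta> \<in> P" | "\<beta> - \<alpha> \<in> P"
  using assms root_P[of "\<alpha> - \<beta>"] by auto

lemma sum_list_apply: "sum_list xs H = (\<Sum>x\<leftarrow>xs. x H)" for xs :: "('b \<Rightarrow> complex) list"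
  by (induction xs) auto

text \<open>In a vanishing sum of positive roots, some term pairs negatively with the first one; the
  two can be merged into a single positive root.\<close>

lemma sum_list_P_nonzero:
  "xs \<noteq> [] \<Longrightarrow> set xs \<subseteq> P \<Longrightarrow> sum_list xs \<noteq> 0"
proof (induction xs rule: length_induct)
  case (1 xs)
  show ?case
  proof
    assume z: "sum_list xs = 0"
    from 1 obtain a ys where xs: "xs = a # ys" by (cases xs) auto
    have a: "a \<in> P" "a \<in> \<Delta>" using 1 xs P_root by auto
    have "2 + (\<Sum>y\<leftarrow>ys. Re (y (cr a))) = Re (sum_list xs (cr a))"
      unfolding sum_list_apply xs using coroot(2)[OF a(2)] by (induction ys) auto
    then have neg: "(\<Sum>y\<leftarrow>ys. Re (y (cr a))) < 0" using z by simp
    obtain y where y: "y \<in> set ys" "Re (y (cr a)) < 0"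
    proof (rule ccontr)
      assume "\<not> thesis"
      then have "\<forall>y\<in>set ys. 0 \<le> Re (y (cr a))" using that by force
      then have "0 \<le> (\<Sum>y\<leftarrow>ys. Re (y (cr a)))" by (intro sum_list_nonneg) auto
      with neg show False by simp
    qed
    have yP: "y \<in> P" using y xs 1 by auto
    have "y + a = 0 \<or> y + a \<in> \<Delta>" using root_add[OF a(2) P_root[OF yP] y(2)] .
    moreover have "y + a \<noteq> 0" using P_uminus[OF a(1)] yP by (metis eq_neg_iff_add_eq_0)
    ultimately have ya: "y + a \<in> P" using P_add yP a by blast
    let ?zs = "(y + a) # remove1 y ys"
    have "length ?zs < length xs" using y by (simp add: xs length_remove1) (metis Suc_pred length_pos_if_in_set lessI)
    moreover have "set ?zs \<subseteq> P" using ya 1 xs set_remove1_subset[of y ys] by auto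
    moreover have "sum_list ?zs = sum_list xs"
      using sum_list_map_remove1[OF y(1), of id] by (simp add: xs add_ac)
    ultimately show False using 1 z by (metis list.distinct(1))
  qed
qed

lemma P_sum2: "a \<in> P \<Longrightarrow> b \<in> P \<Longrightarrow> a + b \<noteq> 0"
  and P_sum3: "a \<in> P \<Longrightarrow> b \<in> P \<Longrightarrow> c \<in> P \<Longrightarrow> a + b + c \<noteq> 0"
  using sum_list_P_nonzero[of "[a, b]"] sum_list_P_nonzero[of "[a, b, c]"] by (auto simp: add_ac)

text \<open>The larger root comes first, so well-founded induction along
  \<open>above\<^sup>+\<close> reaches a root after all higher ones. The transitive closure enters
  because a difference along a chain is a sum of positive roots that need not be a root.\<close>

definition above :: "('u functional \<times> 'u functional) set" where
  "above = {(\<beta>, \<alpha>). \<alpha> \<in> P \<and> \<beta> \<in> P \<and> \<beta> - \<alpha> \<in> P}"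

text \<open>A cycle would be a nonempty sum of positive roots equal to 0.\<close>

lemma wf_above: "wf (above\<^sup>+)"
proof (rule wf_trancl, rule finite_acyclic_wf)
  have "above \<subseteq> \<Delta> \<times> \<Delta>" using P_root by (auto simp: above_def)
  then show "finite above" using finite_roots finite_subset finite_cartesian_product by metis
  have "\<exists>xs. xs \<noteq> [] \<and> set xs \<subseteq> P \<and> sum_list xs = \<beta> - \<alpha>" if "(\<beta>, \<alpha>) \<in> above\<^sup>+" for \<alpha> \<beta>
    using that
  proof (induction rule: trancl_induct)
    case (base \<alpha>)
    then show ?case by (intro exI[of _ "[\<beta> - \<alpha>]"]) (auto simp: above_def)
  next
    case (step \<alpha>' \<alpha>)
    then obtain xs where "xs \<noteq> []" "set xs \<subseteq> P" "sum_list xs = \<beta> - \<alpha>'" by blast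
    with step(2) show ?case by (intro exI[of _ "(\<alpha>' - \<alpha>) # xs"]) (auto simp: above_def)
  qed
  then show "acyclic above" using sum_list_P_nonzero unfolding acyclic_def by (metis diff_self)
qed

end

section \<open>Combinatorics of the stem\<close>

locale stem = positive_roots br Q h E P
  for br :: "'u::euclidean_space \<Rightarrow> 'u \<Rightarrow> 'u" and Q h E P +
  fixes \<Gamma> :: "'u functional set"
  assumes is_stem: "is_stem P \<Gamma>"
begin

abbreviation \<Phi> where "\<Phi> \<equiv> Phi_plus P"

lemma \<Gamma>_subset: "\<Gamma> \<subseteq> P"
  and P_eq: "P = \<Gamma> \<union> (\<Union>\<gamma>\<in>\<Gamma>. \<Phi> \<gamma>)"
  and \<Gamma>_\<Phi>_disjoint: "\<Gamma> \<inter> (\<Union>\<gamma>\<in>\<Gamma>. \<Phi> \<gamma>) = {}"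
  and \<Phi>_disjoint: "disjoint_family_on \<Phi> \<Gamma>"
  using is_stem[unfolded is_stem_def] by - (elim conjE; assumption)+

lemma \<Gamma>_P: "\<gamma> \<in> \<Gamma> \<Longrightarrow> \<gamma> \<in> P"
  using \<Gamma>_subset by blast

lemma P_cases: "\<alpha> \<in> P \<Longrightarrow> \<alpha> \<in> \<Gamma> \<or> (\<exists>\<gamma>\<in>\<Gamma>. \<alpha> \<in> \<Phi> \<gamma>)"
  by (subst (asm) P_eq) blast

lemma \<Gamma>_not_\<Phi>: "\<gamma> \<in> \<Gamma> \<Longrightarrow> \<delta> \<in> \<Gamma> \<Longrightarrow> \<gamma> \<notin> \<Phi> \<delta>"
  using \<Gamma>_\<Phi>_disjoint by blast

lemma \<Phi>_unique: "\<gamma> \<in> \<Gamma> \<Longrightarrow> \<delta> \<in> \<Gamma> \<Longrightarrow> \<alpha> \<in> \<Phi> \<gamma> \<Longrightarrow> \<alpha> \<in> \<Phi> \<delta> \<Longrightarrow> \<gamma> = \<delta>"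
  using \<Phi>_disjoint unfolding disjoint_family_on_def by blast

lemma \<Phi>_iff: "\<alpha> \<in> \<Phi> \<gamma> \<longleftrightarrow> \<alpha> \<in> P \<and> \<gamma> - \<alpha> \<in> P"
  by (simp add: Phi_plus_def)

lemma \<Phi>_P: "\<alpha> \<in> \<Phi> \<gamma> \<Longrightarrow> \<alpha> \<in> P"
  by (simp add: \<Phi>_iff)

lemma \<Phi>_reflect: "\<alpha> \<in> \<Phi> \<gamma> \<Longrightarrow> \<gamma> - \<alpha> \<in> \<Phi> \<gamma>"
  by (simp add: \<Phi>_iff)

lemma \<Gamma>_root: "\<gamma> \<in> \<Gamma> \<Longrightarrow> \<gamma> \<in> \<Delta>"
  using \<Gamma>_P P_root by blast

lemma finite_\<Gamma>: "finite \<Gamma>"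
  using \<Gamma>_root by (intro finite_subset[OF _ finite_roots] subsetI)

text \<open>The positive pairing makes x - epsilon zero or a root. It is neither 0 nor positive,
  because epsilon exceeds x by d plus a further positive root; so epsilon - x is positive.\<close>

lemma \<Phi>_if_pairs_positively:
  assumes "\<epsilon> \<in> \<Gamma>" "x \<in> P" "d \<in> P" "\<epsilon> - (x + d) \<in> P" "Re (x (cr \<epsilon>)) > 0"
  shows "x \<in> \<Phi> \<epsilon>"
  using root_diff[OF \<Gamma>_root[OF assms(1)] P_root[OF assms(2)] assms(5)]
proof (rule root_P_cases)
  assume "x = \<epsilon>"
  then show ?thesis using P_sum2[OF assms(4,3)] by simp
next
  assume "x - \<epsilon> \<in> P"
  from P_sum3[OF this assms(4,3)] show ?thesis by simp
next
  assume "\<epsilon> - x \<in> P" then show ?thesis using assms(2) by (simp add: \<Phi>_iff)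
qed

text \<open>If alpha + gamma were a root, it would lie in Phi_delta for a higher stem root delta
  and, by induction, pair to 1 with H_delta. Then alpha or gamma pairs positively with H_delta and
  falls into Phi_delta, against the disjointness of the stem decomposition. The reflection alpha ->
  gamma - alpha excludes alpha - 2 gamma as well, so \<open>string_end\<close> leaves the values 0
  and 1 for the pairing with H_gamma. Its values at alpha and gamma - alpha add up to 2, so both are
  1.\<close>

lemma \<Phi>_heisenberg_aux:
  "\<gamma> \<in> \<Gamma> \<longrightarrow> (\<forall>\<alpha>\<in>\<Phi> \<gamma>. \<alpha> + \<gamma> \<notin> \<Delta> \<and> Re (\<alpha> (cr \<gamma>)) = 1)"
  using wf_above
proof (induction \<gamma> rule: wf_induct_rule)
  case (less \<gamma>)
  show ?case
  proof
    assume \<gamma>: "\<gamma> \<in> \<Gamma>"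
    have not_root: "\<alpha> + \<gamma> \<notin> \<Delta>" if \<alpha>: "\<alpha> \<in> \<Phi> \<gamma>" for \<alpha>
    proof
      assume root: "\<alpha> + \<gamma> \<in> \<Delta>"
      have P: "\<alpha> \<in> P" "\<gamma> \<in> P" using \<alpha> \<gamma> \<Phi>_P \<Gamma>_P by auto
      with root have sP: "\<alpha> + \<gamma> \<in> P" using P_add by blast
      have "\<alpha> + \<gamma> \<notin> \<Gamma>" using \<Gamma>_not_\<Phi>[OF \<gamma>, of "\<alpha> + \<gamma>"] P by (auto simp: \<Phi>_iff)
      then obtain \<delta> where \<delta>: "\<delta> \<in> \<Gamma>" "\<alpha> + \<gamma> \<in> \<Phi> \<delta>" using P_cases[OF sP] by blast
      then have p: "\<delta> - (\<alpha> + \<gamma>) \<in> P" by (simp add: \<Phi>_iff)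
      have "(\<delta>, \<alpha> + \<gamma>) \<in> above" "(\<alpha> + \<gamma>, \<gamma>) \<in> above"
        using p sP \<Gamma>_P[OF \<delta>(1)] P by (auto simp: above_def)
      then have "(\<delta>, \<gamma>) \<in> above\<^sup>+" by auto
      with less \<delta> have "Re (\<alpha> (cr \<delta>)) + Re (\<gamma> (cr \<delta>)) = 1" by fastforce
      then consider "Re (\<alpha> (cr \<delta>)) > 0" | "Re (\<gamma> (cr \<delta>)) > 0" by linarith
      then show False
      proof cases
        case 1
        then have "\<alpha> \<in> \<Phi> \<delta>" using \<Phi>_if_pairs_positively[OF \<delta>(1) P p] by blast
        then have "\<delta> = \<gamma>" using \<Phi>_unique \<alpha> \<gamma> \<delta> by blast
        then show False using P_sum2[OF p P(1)] by simp
      next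
        case 2
        then have "\<gamma> \<in> \<Phi> \<delta>"
          using \<Phi>_if_pairs_positively[OF \<delta>(1) P(2,1)] p by (simp add: add.commute)
        then show False using \<Gamma>_not_\<Phi> \<gamma> \<delta> by blast
      qed
    qed
    have Re01: "Re (\<alpha> (cr \<gamma>)) = 0 \<or> Re (\<alpha> (cr \<gamma>)) = 1" if \<alpha>: "\<alpha> \<in> \<Phi> \<gamma>" for \<alpha>
    proof (rule string_end[OF _ _ _ not_root[OF \<alpha>]])
      show "\<alpha> \<in> \<Delta>" "\<gamma> \<in> \<Delta>" using \<alpha> \<gamma> \<Phi>_P \<Gamma>_root P_root by auto
      show "\<alpha> + \<gamma> \<noteq> 0" using \<alpha> \<gamma> \<Phi>_P \<Gamma>_P P_sum2 by auto
      have eq: "\<alpha> - \<gamma> - \<gamma> = - (\<gamma> - \<alpha> + \<gamma>)" by simp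
      show "\<alpha> - \<gamma> - \<gamma> \<notin> \<Delta>" unfolding eq uminus_root_iff by (rule not_root[OF \<Phi>_reflect[OF \<alpha>]])
      show "\<alpha> - \<gamma> - \<gamma> \<noteq> 0" unfolding eq neg_equal_0_iff_equal
        using \<Phi>_P[OF \<Phi>_reflect[OF \<alpha>]] \<gamma> \<Gamma>_P P_sum2 by blast
    qed
    show "\<forall>\<alpha>\<in>\<Phi> \<gamma>. \<alpha> + \<gamma> \<notin> \<Delta> \<and> Re (\<alpha> (cr \<gamma>)) = 1"
    proof
      fix \<alpha> assume \<alpha>: "\<alpha> \<in> \<Phi> \<gamma>"
      have "Re (\<alpha> (cr \<gamma>)) + Re ((\<gamma> - \<alpha>) (cr \<gamma>)) = 2" using coroot(2)[OF \<Gamma>_root[OF \<gamma>]] by simp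
      then show "\<alpha> + \<gamma> \<notin> \<Delta> \<and> Re (\<alpha> (cr \<gamma>)) = 1"
        using not_root[OF \<alpha>] Re01[OF \<alpha>] Re01[OF \<Phi>_reflect[OF \<alpha>]] by auto
    qed
  qed
qed

lemma \<Phi>_add_\<Gamma>: "\<gamma> \<in> \<Gamma> \<Longrightarrow> \<alpha> \<in> \<Phi> \<gamma> \<Longrightarrow> \<alpha> + \<gamma> \<notin> \<Delta>"
  using \<Phi>_heisenberg_aux by blast

lemma \<Phi>_cr: "\<gamma> \<in> \<Gamma> \<Longrightarrow> \<alpha> \<in> \<Phi> \<gamma> \<Longrightarrow> \<alpha> (cr \<gamma>) = 1"
  using \<Phi>_heisenberg_aux root_cr_real[of \<gamma> \<alpha>] \<Gamma>_root \<Phi>_P P_root by (metis of_real_1)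

text \<open>A sum lying in Phi_epsilon pairs to 1 with H_epsilon, which would put one of the two
  stem roots itself into Phi_epsilon.\<close>

lemma \<Gamma>_add:
  assumes "\<gamma> \<in> \<Gamma>" "\<delta> \<in> \<Gamma>"
  shows "\<gamma> + \<delta> \<notin> \<Delta>"
proof
  assume root: "\<gamma> + \<delta> \<in> \<Delta>"
  have P: "\<gamma> \<in> P" "\<delta> \<in> P" using assms \<Gamma>_P by auto
  with root have sP: "\<gamma> + \<delta> \<in> P" using P_add by blast
  have "\<gamma> + \<delta> \<notin> \<Gamma>" using \<Gamma>_not_\<Phi>[OF assms(1), of "\<gamma> + \<delta>"] P by (auto simp: \<Phi>_iff)
  then obtain \<epsilon> where \<epsilon>: "\<epsilon> \<in> \<Gamma>" "\<gamma> + \<delta> \<in> \<Phi> \<epsilon>" using P_cases[OF sP] by blast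
  then have p: "\<epsilon> - (\<gamma> + \<delta>) \<in> P" by (simp add: \<Phi>_iff)
  have "Re ((\<gamma> + \<delta>) (cr \<epsilon>)) = 1" using \<Phi>_cr[OF \<epsilon>] by (simp only: one_complex.sel)
  then consider "Re (\<gamma> (cr \<epsilon>)) > 0" | "Re (\<delta> (cr \<epsilon>)) > 0" by fastforce
  then show False
    using \<Phi>_if_pairs_positively[OF \<epsilon>(1) P p] \<Phi>_if_pairs_positively[OF \<epsilon>(1) P(2,1)] p
      \<Gamma>_not_\<Phi> assms \<epsilon> by cases (auto simp: add.commute)
qed

lemma \<Gamma>_diff:
  assumes "\<gamma> \<in> \<Gamma>" "\<delta> \<in> \<Gamma>"
  shows "\<gamma> - \<delta> \<notin> \<Delta>"
proof
  assume "\<gamma> - \<delta> \<in> \<Delta>"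
  then consider "\<gamma> - \<delta> \<in> P" | "\<delta> - \<gamma> \<in> P" using root_P by fastforce
  then show False using assms \<Gamma>_not_\<Phi> \<Gamma>_P by cases (auto simp: \<Phi>_iff)
qed

text \<open>A nonzero pairing would make the sum or the difference of two distinct stem roots a
  root.\<close>

lemma \<Gamma>_cr:
  assumes "\<gamma> \<in> \<Gamma>" "\<delta> \<in> \<Gamma>" "\<gamma> \<noteq> \<delta>"
  shows "\<gamma> (cr \<delta>) = 0"
proof -
  note r = \<Gamma>_root[OF assms(2)] \<Gamma>_root[OF assms(1)]
  have "\<gamma> + \<delta> \<noteq> 0" using assms \<Gamma>_P P_sum2 by blast
  then have "\<not> Re (\<gamma> (cr \<delta>)) > 0" "\<not> Re (\<gamma> (cr \<delta>)) < 0"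
    using root_diff[OF r] root_add[OF r] \<Gamma>_add[OF assms(1,2)] \<Gamma>_diff[OF assms(1,2)] assms(3) by auto
  then have "Re (\<gamma> (cr \<delta>)) = 0" by linarith
  then show ?thesis using root_cr_real[OF r] by simp
qed

text \<open>Distinct stem roots are orthogonal, so the Phi_epsilon containing alpha + delta is
  detected by alpha alone: alpha(H_epsilon) = 1, whence epsilon = gamma. This stability is what lets
  the Cayley transform preserve the summands of V.\<close>

lemma \<Phi>_add_other:
  assumes "\<gamma> \<in> \<Gamma>" "\<alpha> \<in> \<Phi> \<gamma>" "\<delta> \<in> \<Gamma>" "\<delta> \<noteq> \<gamma>" "\<alpha> + \<delta> \<in> \<Delta>"
  shows "\<alpha> + \<delta> \<in> \<Phi> \<gamma>"
proof -
  have P: "\<alpha> \<in> P" "\<delta> \<in> P" using assms \<Phi>_P \<Gamma>_P by auto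
  with assms have sP: "\<alpha> + \<delta> \<in> P" using P_add by blast
  have "\<alpha> + \<delta> \<notin> \<Gamma>"
  proof
    assume s: "\<alpha> + \<delta> \<in> \<Gamma>"
    then have "\<alpha> + \<delta> = \<gamma>" using \<Phi>_unique[OF s assms(1), of \<alpha>] assms P by (auto simp: \<Phi>_iff)
    then have "\<delta> \<in> \<Phi> \<gamma>" using P by (auto simp: \<Phi>_iff)
    then show False using \<Gamma>_not_\<Phi> assms by blast
  qed
  then obtain \<epsilon> where \<epsilon>: "\<epsilon> \<in> \<Gamma>" "\<alpha> + \<delta> \<in> \<Phi> \<epsilon>" using P_cases[OF sP] by blast
  then have p: "\<epsilon> - (\<alpha> + \<delta>) \<in> P" by (simp add: \<Phi>_iff)
  have "\<epsilon> \<noteq> \<delta>" using P_sum2[OF p P(1)] by auto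
  then have "\<alpha> (cr \<epsilon>) = 1"
    using \<Phi>_cr[OF \<epsilon>] \<Gamma>_cr[OF assms(3) \<epsilon>(1)] by simp
  then have "\<alpha> \<in> \<Phi> \<epsilon>" using \<Phi>_if_pairs_positively[OF \<epsilon>(1) P p] by simp
  then show ?thesis using \<epsilon> \<Phi>_unique assms by blast
qed

text \<open>The difference is positive, since otherwise alpha would lie in Phi_delta, and it belongs
  to some Phi_epsilon. Adding delta back does not leave Phi_epsilon by
  \<open>\<Phi>_add_other\<close>.\<close>

lemma \<Phi>_diff_other:
  assumes "\<gamma> \<in> \<Gamma>" "\<alpha> \<in> \<Phi> \<gamma>" "\<delta> \<in> \<Gamma>" "\<delta> \<noteq> \<gamma>" "\<alpha> - \<delta> \<in> \<Delta>"
  shows "\<alpha> - \<delta> \<in> \<Phi> \<gamma>"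
proof -
  have P: "\<alpha> \<in> P" "\<delta> \<in> P" using assms \<Phi>_P \<Gamma>_P by auto
  have "\<delta> - \<alpha> \<notin> P" using \<Phi>_unique[OF assms(1,3,2)] P assms(4) by (auto simp: \<Phi>_iff)
  then have dP: "\<alpha> - \<delta> \<in> P" using root_P[OF assms(5)] by simp
  have "\<alpha> - \<delta> \<notin> \<Gamma>" using \<Gamma>_add[OF _ assms(3), of "\<alpha> - \<delta>"] P_root[OF P(1)] by auto
  then obtain \<epsilon> where \<epsilon>: "\<epsilon> \<in> \<Gamma>" "\<alpha> - \<delta> \<in> \<Phi> \<epsilon>" using P_cases[OF dP] by blast
  have "\<epsilon> \<noteq> \<delta>" using \<Phi>_add_\<Gamma>[OF \<epsilon>] P_root[OF P(1)] by auto
  then have "\<alpha> \<in> \<Phi> \<epsilon>"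
    using \<Phi>_add_other[OF \<epsilon> assms(3)] P_root[OF P(1)] by simp
  then show ?thesis using \<epsilon> \<Phi>_unique assms by blast
qed

end

section \<open>The complex structure and the root space decomposition\<close>

locale borel_structure = stem br Q h E P \<Gamma>
  for br :: "'u::euclidean_space \<Rightarrow> 'u \<Rightarrow> 'u" and Q h E P \<Gamma> +
  fixes I :: "'u \<Rightarrow> 'u"
  assumes borel: "is_borel_complex_structure br h P I"
begin

abbreviation cI where "cI \<equiv> cext I"

lemma linear_I: "linear I" and I_I: "I (I x) = - x"
  using borel by (auto simp: is_borel_complex_structure_def is_complex_structure_def)

lemmas cI_simps = cext_simps[OF linear_I]

lemma cI_cI [simp]: "cI (cI X) = - X"
  by (simp add: cext_def I_I prod_eq_iff)

definition M where "M = m_plus I"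
definition M' where "M' = conjugation ` M"

lemma M_iff: "X \<in> M \<longleftrightarrow> cI X = cscale \<i> X"
  by (simp add: M_def m_plus_def)

lemma M'_iff: "X \<in> M' \<longleftrightarrow> conjugation X \<in> M"
  unfolding M'_def by (metis conjugation_simps(6) image_iff)

lemma M'_iff2: "X \<in> M' \<longleftrightarrow> cI X = cscale (- \<i>) X"
  unfolding M'_iff M_iff cI_simps
  by (metis complex_cnj_i conjugation_simps(5,6) complex_cnj_minus minus_minus)

lemma subspace_M: "cx.subspace M" and cb_M: "X \<in> M \<Longrightarrow> Y \<in> M \<Longrightarrow> cb X Y \<in> M"
  using borel
  by (auto simp: is_borel_complex_structure_def is_integrable_def is_csubalgebra_def M_def)

lemma subspace_M': "cx.subspace M'"
  using subspace_M unfolding cx.subspace_def by (simp add: M'_iff)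

lemma cb_M': "X \<in> M' \<Longrightarrow> Y \<in> M' \<Longrightarrow> cb X Y \<in> M'"
  by (simp add: M'_iff cb_M)

lemmas M_closed = cx.subspace_add[OF subspace_M] cx.subspace_diff[OF subspace_M]
  cx.subspace_neg[OF subspace_M] cx.subspace_scale[OF subspace_M]
lemmas M'_closed = cx.subspace_add[OF subspace_M'] cx.subspace_diff[OF subspace_M']
  cx.subspace_neg[OF subspace_M'] cx.subspace_scale[OF subspace_M']

definition plus_part where "plus_part X = cscale (1/2) (X - cscale \<i> (cI X))"
definition minus_part where "minus_part X = cscale (1/2) (X + cscale \<i> (cI X))"

lemma plus_part_M: "plus_part X \<in> M"
  by (simp add: plus_part_def M_iff cI_simps algebra_simps cx.scale_right_distrib cx.scale_right_diff_distrib)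

lemma minus_part_M': "minus_part X \<in> M'"
  by (simp add: minus_part_def M'_iff2 cI_simps algebra_simps cx.scale_right_distrib cx.scale_right_diff_distrib)

lemma plus_part_minus_part: "plus_part X + minus_part X = X"
proof -
  have "plus_part X + minus_part X = cscale (1/2) (X + X)"
    unfolding plus_part_def minus_part_def cx.scale_right_distrib[symmetric] by simp
  also have "\<dots> = cscale (1/2 + 1/2) X"
    unfolding cx.scale_right_distrib cx.scale_left_distrib ..
  finally show ?thesis by simp
qed

lemma minus_part_M: "X \<in> M \<Longrightarrow> minus_part X = 0"
  by (simp add: minus_part_def M_iff)

lemma minus_part_M'_eq: "X \<in> M' \<Longrightarrow> minus_part X = X"
  using plus_part_minus_part[of X] by (simp add: plus_part_def M'_iff2)

lemma minus_part_simps: "minus_part (X + Y) = minus_part X + minus_part Y" "minus_part (X - Y) = minus_part X - minus_part Y" "minus_part (cscale z X) = cscale z (minus_part X)"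
  by (simp_all add: minus_part_def cI_simps cx.scale_right_distrib cx.scale_right_diff_distrib mult.commute)

lemma cI_plus_part: "cI X = cscale \<i> (plus_part X - minus_part X)"
  by (simp add: plus_part_def minus_part_def flip: cx.scale_right_diff_distrib)
    (simp add: cx.scale_right_diff_distrib cx.scale_right_distrib flip: cx.scale_left_distrib)

lemma conjugation_plus_part: "conjugation (plus_part X) = minus_part (conjugation X)"
  by (simp add: plus_part_def minus_part_def cI_simps)

lemma normalizer_M: "normalizer br M = h + cx.span (\<Union>\<alpha>\<in>P. rs \<alpha>)"
  using borel by (simp add: is_borel_complex_structure_def borel_plus_def nilradical_plus_def M_def)

text \<open>Being a subalgebra, \<open>M\<close> lies in its own normalizer.\<close>

lemma M_borel: "M \<subseteq> h + cx.span (\<Union>\<alpha>\<in>P. rs \<alpha>)"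
  using cb_M by (auto simp: normalizer_def simp flip: normalizer_M)

lemma cb_h_M:
  assumes "H \<in> h" "X \<in> M" shows "cb H X \<in> M"
proof -
  have "H + 0 \<in> h + cx.span (\<Union>\<alpha>\<in>P. rs \<alpha>)"
    using assms(1) cx.span_zero by (rule set_plus_intro)
  then show ?thesis using assms(2) by (simp add: normalizer_def flip: normalizer_M)
qed

lemma M_induct_subspace:
  assumes "cx.subspace S" "h \<subseteq> S" "\<And>\<alpha>. \<alpha> \<in> P \<Longrightarrow> rs \<alpha> \<subseteq> S"
  shows "M \<subseteq> S"
proof -
  have "cx.span (\<Union>\<alpha>\<in>P. rs \<alpha>) \<subseteq> S" using assms by (intro cx.span_minimal) auto
  then have "h + cx.span (\<Union>\<alpha>\<in>P. rs \<alpha>) \<subseteq> S"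
    using cx.subspace_add[OF assms(1)] assms(2) by (blast elim: set_plus_elim)
  with M_borel show ?thesis by blast
qed

lemma root_coeff_M: "X \<in> M \<Longrightarrow> \<beta> \<in> P \<Longrightarrow> root_coeff (- \<beta>) X = 0"
proof -
  assume X: "X \<in> M" and \<beta>: "\<beta> \<in> P"
  have "M \<subseteq> {X. root_coeff (- \<beta>) X = 0}"
  proof (rule M_induct_subspace)
    show "cx.subspace {X. root_coeff (- \<beta>) X = 0}" by (simp add: cx.subspace_def root_coeff_simps)
    show "h \<subseteq> {X. root_coeff (- \<beta>) X = 0}" using root_coeff_h[of "- \<beta>"] P_root[OF \<beta>] by auto
    show "rs \<alpha> \<subseteq> {X. root_coeff (- \<beta>) X = 0}" if "\<alpha> \<in> P" for \<alpha>
    proof -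
      have "- \<beta> \<noteq> \<alpha>" using P_uminus[OF \<beta>] that by auto
      then show ?thesis using root_coeff_rs_other[of "- \<beta>" \<alpha>] P_root[OF \<beta>] P_root[OF that] by auto
    qed
  qed
  with X show ?thesis by blast
qed

lemma root_coeff_conjugation: "\<alpha> \<in> \<Delta> \<Longrightarrow> root_coeff \<alpha> (conjugation X) = - cnj (root_coeff (- \<alpha>) X)"
proof -
  assume \<alpha>: "\<alpha> \<in> \<Delta>"
  have "hf (conjugation X) (E \<alpha>) = hf (conjugation (E \<alpha>)) X"
    using hf_conjugation[of X "conjugation (E \<alpha>)"] by simp
  moreover have "hf (E \<alpha>) (E \<alpha>) = hf (conjugation (E \<alpha>)) (conjugation (E \<alpha>))"
    by (simp add: hf_conjugation)
  ultimately show ?thesis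
    by (simp add: root_coeff_def conjugation_E[OF \<alpha>] hf_simps cnj_hf)
qed

lemma root_coeff_M': "X \<in> M' \<Longrightarrow> \<beta> \<in> P \<Longrightarrow> root_coeff \<beta> X = 0"
  using root_coeff_M[of "conjugation X" \<beta>] root_coeff_conjugation[of "- \<beta>" X] P_root[of \<beta>] by (simp add: M'_iff)

text \<open>Merely what remains after all root coordinates are removed; the content of the root
  space decomposition is \<open>h_part_in_h\<close>.\<close>

definition h_part where "h_part X = X - (\<Sum>\<alpha>\<in>\<Delta>. cscale (root_coeff \<alpha> X) (E \<alpha>))"

lemma h_part_simps:
  "h_part (X + Y) = h_part X + h_part Y"
  "h_part (X - Y) = h_part X - h_part Y"
  "h_part (cscale z X) = cscale z (h_part X)"
  "h_part 0 = 0"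
  by (simp_all add: h_part_def root_coeff_simps cx.scale_left_distrib cx.scale_left_diff_distrib sum.distrib
      sum_subtractf cx.scale_right_diff_distrib cx.scale_sum_right)

lemma h_part_sum: "h_part (\<Sum>i\<in>A. f i) = (\<Sum>i\<in>A. h_part (f i))"
  by (induction A rule: infinite_finite_induct) (auto simp: h_part_simps)

lemma h_part_h: "H \<in> h \<Longrightarrow> h_part H = H"
  by (simp add: h_part_def root_coeff_h)

lemma h_part_rs:
  assumes "\<alpha> \<in> \<Delta>" "X \<in> rs \<alpha>" shows "h_part X = 0"
proof -
  have "(\<Sum>\<beta>\<in>\<Delta>. cscale (root_coeff \<beta> X) (E \<beta>)) = (\<Sum>\<beta>\<in>\<Delta>. if \<beta> = \<alpha> then cscale (root_coeff \<alpha> X) (E \<alpha>) else 0)"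
    by (intro sum.cong refl) (auto simp: root_coeff_rs_other[OF _ disjI2[OF assms(1)] _ assms(2)])
  also have "\<dots> = X" using rs_eq[OF assms] assms(1) finite_roots by simp
  finally show ?thesis by (simp add: h_part_def)
qed

text \<open>No spectral theory is needed for the root space decomposition: \<open>\<gg> = M + M'\<close>, and the
  hypothesis on the normalizer puts both summands into the span of \<open>h\<close> and the root spaces.\<close>

lemma h_part_in_h: "h_part X \<in> h"
proof -
  let ?S = "{X. h_part X \<in> h}"
  have S: "cx.subspace ?S" by (simp add: cx.subspace_def h_part_simps h_closed)
  have rs: "rs \<alpha> \<subseteq> ?S" if "\<alpha> \<in> \<Delta>" for \<alpha> using h_part_rs[OF that] h_closed by auto
  have "M \<subseteq> ?S" using S rs by (intro M_induct_subspace) (auto simp: h_part_h P_root)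
  moreover have "M \<subseteq> {X. conjugation X \<in> ?S}"
  proof (rule M_induct_subspace)
    show "cx.subspace {X. conjugation X \<in> ?S}" using S by (simp add: cx.subspace_def h_part_simps h_closed)
    show "h \<subseteq> {X. conjugation X \<in> ?S}" by (auto simp: h_part_h conjugation_h)
    show "rs \<alpha> \<subseteq> {X. conjugation X \<in> ?S}" if "\<alpha> \<in> P" for \<alpha>
      using rs[of "- \<alpha>"] conjugation_rs[of \<alpha>] P_root[OF that] by auto
  qed
  ultimately have "plus_part X \<in> ?S" "minus_part X \<in> ?S"
    using plus_part_M[of X] minus_part_M'[of X] by (auto simp: M'_def)
  then have "plus_part X + minus_part X \<in> ?S" using cx.subspace_add[OF S] by blast
  then show ?thesis by (simp add: plus_part_minus_part)
qed

lemma decomposition: "X = h_part X + (\<Sum>\<alpha>\<in>\<Delta>. cscale (root_coeff \<alpha> X) (E \<alpha>))"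
  by (simp add: h_part_def)

lemma eqI_root_coeff:
  assumes "h_part X = h_part Y" "\<And>\<alpha>. \<alpha> \<in> \<Delta> \<Longrightarrow> root_coeff \<alpha> X = root_coeff \<alpha> Y" shows "X = Y"
  using decomposition[of X] decomposition[of Y] assms by simp

lemma eqI_root_coeff_P:
  assumes "h_part X = h_part Y" "\<And>\<beta>. \<beta> \<in> P \<Longrightarrow> root_coeff \<beta> X = root_coeff \<beta> Y"
    "\<And>\<beta>. \<beta> \<in> P \<Longrightarrow> root_coeff (- \<beta>) X = root_coeff (- \<beta>) Y"
  shows "X = Y"
proof (rule eqI_root_coeff[OF assms(1)])
  fix \<alpha> assume "\<alpha> \<in> \<Delta>"
  then show "root_coeff \<alpha> X = root_coeff \<alpha> Y" using root_P[of \<alpha>] assms(2)[of \<alpha>] assms(3)[of "- \<alpha>"] by auto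
qed

lemma in_h_iff: "X \<in> h \<longleftrightarrow> (\<forall>\<alpha>\<in>\<Delta>. root_coeff \<alpha> X = 0)"
proof
  assume "\<forall>\<alpha>\<in>\<Delta>. root_coeff \<alpha> X = 0"
  then have "h_part X = X" by (simp add: h_part_def)
  then show "X \<in> h" using h_part_in_h[of X] by simp
qed (simp add: root_coeff_h)

lemma in_hI:
  assumes "\<And>\<beta>. \<beta> \<in> P \<Longrightarrow> root_coeff \<beta> X = 0" "\<And>\<beta>. \<beta> \<in> P \<Longrightarrow> root_coeff (- \<beta>) X = 0"
  shows "X \<in> h"
proof -
  have "root_coeff \<alpha> X = 0" if "\<alpha> \<in> \<Delta>" for \<alpha>
    using root_P[OF that] assms(1)[of \<alpha>] assms(2)[of "- \<alpha>"] by auto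
  then show ?thesis by (simp add: in_h_iff)
qed

lemma root_coeff_rs_ne:
  assumes "\<alpha> \<in> \<Delta>" "\<beta> \<in> dual_space h" "\<alpha> \<noteq> \<beta>" "X \<in> rs \<beta>"
  shows "root_coeff \<alpha> X = 0"
  using root_coeff_rs_other[OF assms(1) _ assms(3,4)] rootI[OF assms(2,4)] by (cases "X = 0") (auto simp: root_coeff_simps)

lemma h_part_rs_ne:
  assumes "\<beta> \<in> dual_space h" "\<beta> \<noteq> 0" "X \<in> rs \<beta>"
  shows "h_part X = 0"
  using h_part_rs[OF _ assms(3)] rootI[OF assms(1,3)] assms(2) by (cases "X = 0") (auto simp: h_part_simps)

text \<open>The M'-part of E_alpha has no root coordinates: none at positive roots as an element of
  M', and none at negative roots because neither E_alpha nor its M-part has any. So it lies in h and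
  is annihilated by ad H_alpha. As ad H_alpha preserves M, applying it to the M-part shows that 2
  E_alpha is in M.\<close>

lemma E_M: "\<alpha> \<in> P \<Longrightarrow> E \<alpha> \<in> M"
proof -
  assume \<alpha>: "\<alpha> \<in> P"
  note r = P_root[OF \<alpha>]
  let ?A = "plus_part (E \<alpha>)" and ?B = "minus_part (E \<alpha>)"
  have B: "?B \<in> h"
  proof (rule in_hI)
    fix \<beta> assume \<beta>: "\<beta> \<in> P"
    show "root_coeff \<beta> ?B = 0" by (rule root_coeff_M'[OF minus_part_M' \<beta>])
    have ne: "- \<beta> \<noteq> \<alpha>" using P_uminus[OF \<beta>] \<alpha> by auto
    have "root_coeff (- \<beta>) (?A + ?B) = 0"
      unfolding plus_part_minus_part using P_root[OF \<beta>] by (intro root_coeff_rs_other[OF _ _ ne E_rs[OF r]]) (auto simp: r)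
    then show "root_coeff (- \<beta>) ?B = 0" using root_coeff_M[OF plus_part_M \<beta>] by (simp add: root_coeff_simps)
  qed
  have "?A = E \<alpha> - ?B" using plus_part_minus_part[of "E \<alpha>"] by (metis add_diff_cancel_right')
  then have "cb (cr \<alpha>) ?A = cscale 2 (E \<alpha>)"
    using rs_D[OF E_rs[OF r] coroot(1)[OF r]] h_abelian[OF coroot(1)[OF r] B] coroot(2)[OF r]
    by (simp add: cb_simps)
  then have "cscale 2 (E \<alpha>) \<in> M" using cb_h_M[OF coroot(1)[OF r] plus_part_M[of "E \<alpha>"]] by simp
  from cx.subspace_scale[OF subspace_M this, of "1/2"] show ?thesis by simp
qed

lemma E_M': "\<alpha> \<in> P \<Longrightarrow> E (- \<alpha>) \<in> M'"
  using E_M[of \<alpha>] conjugation_E[of "- \<alpha>"] P_root[of \<alpha>] M_closed(3) by (simp add: M'_iff)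

lemma cI_E: "\<alpha> \<in> P \<Longrightarrow> cI (E \<alpha>) = cscale \<i> (E \<alpha>)"
  using E_M by (simp add: M_iff)

lemma cI_E': "\<alpha> \<in> P \<Longrightarrow> cI (E (- \<alpha>)) = cscale (- \<i>) (E (- \<alpha>))"
  using E_M' by (simp add: M'_iff2)

text \<open>M has no coordinates at negative roots and M' none at positive ones. The two parts of
  \<open>H\<close> have opposite coordinates, so neither has any.\<close>

lemma plus_part_minus_part_h:
  assumes "H \<in> h" shows "plus_part H \<in> h" "minus_part H \<in> h"
proof -
  have sum: "root_coeff \<alpha> (plus_part H) + root_coeff \<alpha> (minus_part H) = 0" if "\<alpha> \<in> \<Delta>" for \<alpha>
    using root_coeff_h[OF that assms] plus_part_minus_part[of H] by (metis root_coeff_simps(1))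
  show "plus_part H \<in> h"
  proof (rule in_hI)
    fix \<beta> assume \<beta>: "\<beta> \<in> P"
    show "root_coeff (- \<beta>) (plus_part H) = 0" by (rule root_coeff_M[OF plus_part_M \<beta>])
    show "root_coeff \<beta> (plus_part H) = 0" using sum[OF P_root[OF \<beta>]] root_coeff_M'[OF minus_part_M' \<beta>, of H] by simp
  qed
  moreover have "minus_part H = H - plus_part H" using plus_part_minus_part[of H] by (metis add_diff_cancel_left')
  ultimately show "minus_part H \<in> h" using assms by (simp add: h_closed)
qed

lemma cI_h: "H \<in> h \<Longrightarrow> cI H \<in> h"
  unfolding cI_plus_part by (simp add: plus_part_minus_part_h h_closed)

lemma h_part_M: "X \<in> M \<Longrightarrow> h_part X \<in> M"
proof -
  assume X: "X \<in> M"
  have "cscale (root_coeff \<alpha> X) (E \<alpha>) \<in> M" if "\<alpha> \<in> \<Delta>" for \<alpha>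
  proof (cases "\<alpha> \<in> P")
    case True
    then show ?thesis by (intro M_closed E_M)
  next
    case False
    then have "root_coeff \<alpha> X = 0" using root_P[OF that] root_coeff_M[OF X, of "- \<alpha>"] by simp
    then show ?thesis by (simp add: cx.subspace_0[OF subspace_M])
  qed
  then show ?thesis unfolding h_part_def using X by (intro M_closed(2) cx.subspace_sum[OF subspace_M]) auto
qed

lemma h_part_M': "X \<in> M' \<Longrightarrow> h_part X \<in> M'"
proof -
  assume X: "X \<in> M'"
  have "cscale (root_coeff \<alpha> X) (E \<alpha>) \<in> M'" if "\<alpha> \<in> \<Delta>" for \<alpha>
  proof (cases "\<alpha> \<in> P")
    case True
    then show ?thesis by (simp add: root_coeff_M'[OF X] cx.subspace_0[OF subspace_M'])
  next
    case False
    then have "- \<alpha> \<in> P" using root_P[OF that] by simp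
    from E_M'[OF this] show ?thesis by (intro M'_closed) simp
  qed
  then show ?thesis unfolding h_part_def using X by (intro M'_closed(2) cx.subspace_sum[OF subspace_M']) auto
qed

section \<open>Coordinates of brackets\<close>

lemma root_coeff_cb_h:
  assumes "\<mu> \<in> \<Delta>" "H \<in> h" shows "root_coeff \<mu> (cb H Z) = \<mu> H * root_coeff \<mu> Z"
proof -
  have "hf (cb H Z) (E \<mu>) = - cnj (\<mu> (conjugation H)) * hf Z (E \<mu>)"
    using rs_D[OF E_rs[OF assms(1)] conjugation_h[OF assms(2)]] by (simp add: hf_cb hf_simps)
  then show ?thesis by (simp add: root_coeff_def root_conjugation[OF assms])
qed

lemma h_part_cb_h:
  assumes "H \<in> h" shows "h_part (cb H Z) = 0"
proof -
  have "cb H Z = cb H (h_part Z) + (\<Sum>\<alpha>\<in>\<Delta>. cscale (root_coeff \<alpha> Z) (cb H (E \<alpha>)))"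
    using arg_cong[OF decomposition[of Z], of "cb H"] by (simp add: cb_simps cb_sum)
  moreover have "h_part (cb H (E \<alpha>)) = 0" if "\<alpha> \<in> \<Delta>" for \<alpha>
    using rs_D[OF E_rs[OF that] assms] h_part_rs[OF that E_rs[OF that]] by (simp add: h_part_simps)
  ultimately show ?thesis
    by (simp add: h_abelian[OF assms h_part_in_h] h_part_simps h_part_sum)
qed

lemma cb_E_expand: "cb X (E \<alpha>) = cb (h_part X) (E \<alpha>) + (\<Sum>\<delta>\<in>\<Delta>. cscale (root_coeff \<delta> X) (cb (E \<delta>) (E \<alpha>)))"
  using arg_cong[OF decomposition[of X], of "\<lambda>X. cb X (E \<alpha>)"] by (simp add: cb_simps cb_sum)

lemma root_coeff_cb_E:
  assumes "\<alpha> \<in> \<Delta>" "\<mu> \<in> \<Delta>" "\<mu> \<noteq> \<alpha>"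
  shows "root_coeff \<mu> (cb X (E \<alpha>)) =
    (if \<mu> - \<alpha> \<in> \<Delta> then root_coeff (\<mu> - \<alpha>) X * root_coeff \<mu> (cb (E (\<mu> - \<alpha>)) (E \<alpha>)) else 0)"
proof -
  have 0: "root_coeff \<mu> (cb (h_part X) (E \<alpha>)) = 0"
    using rs_D[OF E_rs[OF assms(1)] h_part_in_h] root_coeff_rs_other[of \<mu> \<alpha> "E \<alpha>"] E_rs[OF assms(1)] assms
    by (simp add: root_coeff_simps)
  have *: "root_coeff \<mu> (cb (E \<delta>) (E \<alpha>)) = 0" if "\<delta> \<in> \<Delta>" "\<delta> \<noteq> \<mu> - \<alpha>" for \<delta>
  proof (rule root_coeff_rs_ne[OF assms(2)])
    show "cb (E \<delta>) (E \<alpha>) \<in> rs (\<delta> + \<alpha>)" using that assms by (intro cb_rs E_rs)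
    show "\<delta> + \<alpha> \<in> dual_space h" using that assms by (intro dual_closed root_dual)
    show "\<mu> \<noteq> \<delta> + \<alpha>" using that by auto
  qed
  have "root_coeff \<mu> (cb X (E \<alpha>)) = (\<Sum>\<delta>\<in>\<Delta>. root_coeff \<delta> X * root_coeff \<mu> (cb (E \<delta>) (E \<alpha>)))"
    by (subst cb_E_expand) (simp add: root_coeff_simps root_coeff_sum 0)
  also have "\<dots> = (\<Sum>\<delta>\<in>\<Delta>. if \<delta> = \<mu> - \<alpha> then root_coeff (\<mu> - \<alpha>) X * root_coeff \<mu> (cb (E (\<mu> - \<alpha>)) (E \<alpha>)) else 0)"
    by (intro sum.cong refl) (auto simp: *)
  finally show ?thesis using finite_roots by simp
qed

lemma h_part_cb_E:
  assumes "\<alpha> \<in> \<Delta>"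
  shows "h_part (cb X (E \<alpha>)) = cscale (- root_coeff (- \<alpha>) X) (cr \<alpha>)"
proof -
  have 0: "h_part (cb (h_part X) (E \<alpha>)) = 0"
    using rs_D[OF E_rs[OF assms] h_part_in_h] h_part_rs[OF assms E_rs[OF assms]] by (simp add: h_part_simps)
  have *: "h_part (cb (E \<delta>) (E \<alpha>)) = 0" if "\<delta> \<in> \<Delta>" "\<delta> \<noteq> - \<alpha>" for \<delta>
  proof (rule h_part_rs_ne)
    show "cb (E \<delta>) (E \<alpha>) \<in> rs (\<delta> + \<alpha>)" using that assms by (intro cb_rs E_rs)
    show "\<delta> + \<alpha> \<in> dual_space h" using that assms by (intro dual_closed root_dual)
    show "\<delta> + \<alpha> \<noteq> 0" using that by (simp add: add_eq_0_iff2)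
  qed
  have "h_part (cb X (E \<alpha>)) = (\<Sum>\<delta>\<in>\<Delta>. cscale (root_coeff \<delta> X) (h_part (cb (E \<delta>) (E \<alpha>))))"
    by (subst cb_E_expand) (simp add: h_part_simps h_part_sum 0)
  also have "\<dots> = (\<Sum>\<delta>\<in>\<Delta>. if \<delta> = - \<alpha> then cscale (- root_coeff (- \<alpha>) X) (cr \<alpha>) else 0)"
    using coroot(1)[OF assms]
    by (intro sum.cong refl) (auto simp: * cb_E'[OF assms] h_part_h h_closed)
  finally show ?thesis using finite_roots assms by simp
qed

lemma root_cI_cr_real:
  assumes "\<alpha> \<in> \<Delta>" "\<beta> \<in> \<Delta>"
  shows "\<beta> (cI (cr \<alpha>)) = of_real (Re (\<beta> (cI (cr \<alpha>))))"
proof -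
  have "conjugation (cI (cr \<alpha>)) = - cI (cr \<alpha>)"
    by (simp add: conjugation_cr[OF assms(1)] cI_simps flip: cI_simps(6))
  then show ?thesis
    using root_conjugation[OF assms(2) cI_h[OF coroot(1)[OF assms(1)]]] cI_h[OF coroot(1)[OF assms(1)]]
    by (simp add: dual_simps[OF root_dual[OF assms(2)]] complex_eq_iff)
qed

text \<open>Conjugation negates both H_alpha and I H_alpha, so every root is real on them. For beta
  = alpha the real part is 1, which justifies the later division by this number.\<close>

lemma root_plus_part_cr:
  assumes "\<alpha> \<in> \<Delta>" "\<beta> \<in> \<Delta>"
  shows "\<beta> (plus_part (cr \<alpha>)) = Complex (Re (\<beta> (cr \<alpha>)) / 2) (- Re (\<beta> (cI (cr \<alpha>))) / 2)"
proof -
  have "\<beta> (plus_part (cr \<alpha>)) = (\<beta> (cr \<alpha>) - \<i> * \<beta> (cI (cr \<alpha>))) / 2"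
    using coroot(1)[OF assms(1)] cI_h[OF coroot(1)[OF assms(1)]]
    by (simp add: plus_part_def dual_simps[OF root_dual[OF assms(2)]] h_closed)
  then show ?thesis
    using root_cr_real[OF assms] root_cI_cr_real[OF assms] by (simp add: complex_eq_iff)
qed

end

section \<open>The matching structure\<close>

text \<open>Integrability closes the i-eigenspace of J under brackets, and conjugation gives the
  same for the eigenvalue -i. The vectors X - i J X and X + i J X lie in these two spaces; adding
  the equations obtained from them isolates the identity.\<close>

lemma Nijenhuis:
  assumes "lie_algebra br" "is_complex_structure J" "is_integrable br J"
  shows "cbracket br (cext J X) Y + cbracket br X (cext J Y)
    = cext J (cbracket br X Y) - cext J (cbracket br (cext J X) (cext J Y))"
proof -
  interpret lie_algebra br by fact
  let ?J = "cext J"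
  have lin: "linear J" using assms(2) by (simp add: is_complex_structure_def)
  note J_simps = cext_simps[OF lin]
  have JJ: "?J (?J X) = - X" for X
    using assms(2) by (simp add: cext_def is_complex_structure_def prod_eq_iff)
  have plus: "?J (cb X Y) = cscale \<i> (cb X Y)" if "?J X = cscale \<i> X" "?J Y = cscale \<i> Y" for X Y
    using assms(3) that by (auto simp: is_integrable_def is_csubalgebra_def m_plus_def)
  have minus: "?J (cb X Y) = cscale (- \<i>) (cb X Y)"
    if "?J X = cscale (- \<i>) X" "?J Y = cscale (- \<i>) Y" for X Y
  proof -
    have "?J (conjugation Z) = cscale \<i> (conjugation Z)" if "?J Z = cscale (- \<i>) Z" for Z
      by (simp add: J_simps that)
    then have "?J (cb (conjugation X) (conjugation Y)) = cscale \<i> (cb (conjugation X) (conjugation Y))"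
      using plus that by blast
    then have "conjugation (?J (cb X Y)) = conjugation (cscale (- \<i>) (cb X Y))"
      by (simp add: J_simps flip: J_simps(6))
    then show ?thesis by (metis conjugation_simps(6))
  qed
  let ?A = "cb X Y - cb (?J X) (?J Y)" and ?S = "cb (?J X) Y + cb X (?J Y)"
  have "cb (X - cscale \<i> (?J X)) (Y - cscale \<i> (?J Y)) = ?A - cscale \<i> ?S"
    by (simp add: cb_simps cx.scale_right_distrib algebra_simps)
  moreover have "?J (cb (X - cscale \<i> (?J X)) (Y - cscale \<i> (?J Y)))
      = cscale \<i> (cb (X - cscale \<i> (?J X)) (Y - cscale \<i> (?J Y)))"
    by (rule plus) (simp_all add: J_simps JJ cx.scale_right_diff_distrib)
  ultimately have 1: "?J ?A - cscale \<i> (?J ?S) = cscale \<i> ?A + ?S"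
    by (simp add: J_simps cx.scale_right_diff_distrib cx.scale_right_distrib)
  have "cb (X + cscale \<i> (?J X)) (Y + cscale \<i> (?J Y)) = ?A + cscale \<i> ?S"
    by (simp add: cb_simps cx.scale_right_distrib algebra_simps)
  moreover have "?J (cb (X + cscale \<i> (?J X)) (Y + cscale \<i> (?J Y)))
      = cscale (- \<i>) (cb (X + cscale \<i> (?J X)) (Y + cscale \<i> (?J Y)))"
    by (rule minus) (simp_all add: J_simps JJ cx.scale_right_distrib)
  ultimately have 2: "?J ?A + cscale \<i> (?J ?S) = - cscale \<i> ?A + ?S"
    by (simp add: J_simps cx.scale_right_diff_distrib cx.scale_right_distrib)
  have "2 *\<^sub>R ?J ?A = (?J ?A - cscale \<i> (?J ?S)) + (?J ?A + cscale \<i> (?J ?S))"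
    by (simp add: scaleR_2)
  also have "\<dots> = 2 *\<^sub>R ?S" unfolding 1 2 by (simp add: scaleR_2)
  finally have "?J ?A = ?S" by (simp only: scaleR_cancel_left) simp
  then show ?thesis by (simp add: J_simps)
qed

locale matched_structures = borel_structure br Q h E P \<Gamma> I
  for br :: "'u::euclidean_space \<Rightarrow> 'u \<Rightarrow> 'u" and Q h E P \<Gamma> I +
  fixes J :: "'u \<Rightarrow> 'u"
  assumes matches: "matches br J I"
begin

abbreviation cJ where "cJ \<equiv> cext J"

lemma linear_J: "linear J" and J_J: "J (J x) = - x" and I_J: "I (J x) = - J (I x)"
  using matches by (auto simp: matches_def is_complex_structure_def)

lemmas cJ_simps = cext_simps[OF linear_J]

lemma cJ_cJ [simp]: "cJ (cJ X) = - X"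
  by (simp add: cext_def J_J prod_eq_iff)

lemma cI_cJ: "cI (cJ X) = - cJ (cI X)"
  by (simp add: cext_def I_J prod_eq_iff)

lemma cJ_M: "X \<in> M \<Longrightarrow> cJ X \<in> M'"
  by (simp add: M_iff M'_iff2 cI_cJ cJ_simps)

lemma cJ_M': "X \<in> M' \<Longrightarrow> cJ X \<in> M"
  by (simp add: M_iff M'_iff2 cI_cJ cJ_simps)

lemma Nijenhuis_J: "cb (cJ X) Y + cb X (cJ Y) = cJ (cb X Y) - cJ (cb (cJ X) (cJ Y))"
  using Nijenhuis[OF lie_algebra_axioms] matches by (simp add: matches_def)

text \<open>On \<open>M\<close>, the map \<open>J\<close> is a 1-cocycle with values in \<open>\<gg> / M\<close>: modulo \<open>M\<close> the last term of
  the Nijenhuis identity disappears.\<close>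

lemma cocycle_root_coeff:
  assumes "X \<in> M" "Y \<in> M" "\<beta> \<in> P"
  shows "root_coeff (- \<beta>) (cJ (cb X Y)) = root_coeff (- \<beta>) (cb (cJ X) Y) + root_coeff (- \<beta>) (cb X (cJ Y))"
proof -
  have "root_coeff (- \<beta>) (cJ (cb (cJ X) (cJ Y))) = 0"
    using assms by (intro root_coeff_M cJ_M' cb_M' cJ_M)
  then show ?thesis using arg_cong[OF Nijenhuis_J[of X Y], of "root_coeff (- \<beta>)"] by (simp add: root_coeff_simps)
qed

text \<open>The component of the cocycle with values in h: on h, passing to the quotient by M
  amounts to \<open>minus_part\<close>.\<close>

lemma cocycle_h_part:
  assumes "X \<in> M" "Y \<in> M"
  shows "h_part (cJ (cb X Y)) = minus_part (h_part (cb (cJ X) Y) + h_part (cb X (cJ Y)))"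
proof -
  have "minus_part (h_part (cJ (cb (cJ X) (cJ Y)))) = 0"
    using assms by (intro minus_part_M h_part_M cJ_M' cb_M' cJ_M)
  moreover have "minus_part (h_part (cJ (cb X Y))) = h_part (cJ (cb X Y))"
    using assms by (intro minus_part_M'_eq h_part_M' cJ_M cb_M)
  ultimately show ?thesis
    using arg_cong[OF Nijenhuis_J[of X Y], of "\<lambda>Z. minus_part (h_part Z)"] by (simp add: h_part_simps minus_part_simps)
qed

text \<open>The cocycle is the coboundary of \<open>\<Sum>\<beta>\<in>P. v \<beta> E (- \<beta>)\<close>, up to a part supported
  on \<open>h\<close>.\<close>

definition v where
  "v \<beta> = - root_coeff (- \<beta>) (cJ (plus_part (cr \<beta>))) / \<beta> (plus_part (cr \<beta>))"

lemma root_plus_part_cr_nonzero: "\<beta> \<in> \<Delta> \<Longrightarrow> \<beta> (plus_part (cr \<beta>)) \<noteq> 0"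
  using root_plus_part_cr[of \<beta> \<beta>] coroot(2)[of \<beta>] by (simp add: complex_eq_iff)

text \<open>Let c be the coordinate of \<open>cJ\<close> at -beta. For commuting H, K in h \<inter>
  M the cocycle identity reads beta(K) c(H) = beta(H) c(K), so c is proportional to beta, and K =
  \<open>plus_part (cr \<beta>)\<close> fixes the factor.\<close>

lemma root_coeff_cJ_h:
  assumes "H \<in> h" "H \<in> M" "\<beta> \<in> P"
  shows "root_coeff (- \<beta>) (cJ H) = - v \<beta> * \<beta> H"
proof -
  note r = P_root[OF assms(3)]
  let ?K = "plus_part (cr \<beta>)"
  have K: "?K \<in> h" "?K \<in> M" using coroot(1)[OF r] plus_part_minus_part_h plus_part_M by auto
  have "0 = root_coeff (- \<beta>) (cb (cJ H) ?K) + root_coeff (- \<beta>) (cb H (cJ ?K))"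
    using cocycle_root_coeff[OF assms(2) K(2) assms(3)] by (simp add: h_abelian assms K cJ_simps root_coeff_simps)
  also have "root_coeff (- \<beta>) (cb (cJ H) ?K) = \<beta> ?K * root_coeff (- \<beta>) (cJ H)"
    using root_coeff_cb_h[of "- \<beta>" ?K "cJ H"] r K cb_skew[of "cJ H" ?K] by (simp add: root_coeff_simps)
  also have "root_coeff (- \<beta>) (cb H (cJ ?K)) = - \<beta> H * root_coeff (- \<beta>) (cJ ?K)"
    using root_coeff_cb_h[of "- \<beta>" H "cJ ?K"] r assms by simp
  finally have "0 = \<beta> ?K * root_coeff (- \<beta>) (cJ H) + - \<beta> H * root_coeff (- \<beta>) (cJ ?K)" .
  moreover have "a = - (- b / k) * c" if "0 = k * a + - c * b" "k \<noteq> 0" for a b c k :: complex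
    using that by (simp add: field_simps)
  ultimately show ?thesis using root_plus_part_cr_nonzero[OF r] unfolding v_def by blast
qed

text \<open>Bracketing E_alpha with H in h \<inter> M multiplies this coordinate by (alpha +
  beta)(H) and expresses it through the already known \<open>cJ H\<close>.\<close>

lemma root_coeff_cJ_E:
  assumes "\<alpha> \<in> P" "\<beta> \<in> P"
  shows "root_coeff (- \<beta>) (cJ (E \<alpha>)) =
    (if \<alpha> + \<beta> \<in> \<Delta> then v (\<alpha> + \<beta>) * root_coeff (- \<beta>) (cb (E \<alpha>) (E (- (\<alpha> + \<beta>)))) else 0)"
proof -
  note r = P_root[OF assms(1)] P_root[OF assms(2)]
  let ?\<delta> = "\<alpha> + \<beta>"
  \<comment> \<open>H must lie in h \<inter> M with (alpha + beta)(H) nonzero. If alpha + beta is a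
    root, its own coroot provides it. If not, beta(H_alpha) cannot be negative, so alpha + beta has
    real part at least 1 on the M-part of H_alpha.\<close>
  define H where "H = (if ?\<delta> \<in> \<Delta> then plus_part (cr ?\<delta>) else plus_part (cr \<alpha>))"
  have H: "H \<in> h" "H \<in> M" using coroot(1) plus_part_minus_part_h plus_part_M r by (auto simp: H_def)
  have nz: "?\<delta> H \<noteq> 0"
  proof (cases "?\<delta> \<in> \<Delta>")
    case True
    with root_plus_part_cr_nonzero[OF True] show ?thesis by (simp add: H_def del: plus_fun_apply)
  next
    case False
    then have "\<not> Re (\<beta> (cr \<alpha>)) < 0"
      using root_add[OF r] P_sum2[OF assms] by (auto simp: add.commute)
    then have "Re (?\<delta> H) > 0"
      using False root_plus_part_cr[OF r] root_plus_part_cr[OF r(1,1)] coroot(2)[OF r(1)] by (simp add: H_def)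
    then show ?thesis by (metis less_irrefl zero_complex.sel(1))
  qed
  have ne: "- \<beta> \<noteq> \<alpha>" using P_uminus assms by auto
  have d: "- \<beta> - \<alpha> = - ?\<delta>" by simp
  have "\<alpha> H * root_coeff (- \<beta>) (cJ (E \<alpha>)) = root_coeff (- \<beta>) (cb (cJ H) (E \<alpha>)) - \<beta> H * root_coeff (- \<beta>) (cJ (E \<alpha>))"
    using cocycle_root_coeff[OF H(2) E_M[OF assms(1)] assms(2)] root_coeff_cb_h[of "- \<beta>" H "cJ (E \<alpha>)"]
      rs_D[OF E_rs[OF r(1)] H(1)] r H by (simp add: cJ_simps root_coeff_simps)
  then have eq: "?\<delta> H * root_coeff (- \<beta>) (cJ (E \<alpha>)) = root_coeff (- \<beta>) (cb (cJ H) (E \<alpha>))"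
    by (simp add: algebra_simps)
  also have "\<dots> = (if ?\<delta> \<in> \<Delta> then root_coeff (- ?\<delta>) (cJ H) * root_coeff (- \<beta>) (cb (E (- ?\<delta>)) (E \<alpha>)) else 0)"
    using root_coeff_cb_E[OF r(1) _ ne, of "cJ H"] r(2) unfolding d uminus_root_iff by blast
  also have "\<dots> = (if ?\<delta> \<in> \<Delta> then ?\<delta> H * (v ?\<delta> * root_coeff (- \<beta>) (cb (E \<alpha>) (E (- ?\<delta>)))) else 0)"
    using root_coeff_cJ_h[OF H, of ?\<delta>] P_add[OF assms] cb_skew[of "E (- ?\<delta>)" "E \<alpha>"]
    by (simp add: root_coeff_simps)
  finally have "?\<delta> H * root_coeff (- \<beta>) (cJ (E \<alpha>)) =
     ?\<delta> H * (if ?\<delta> \<in> \<Delta> then v ?\<delta> * root_coeff (- \<beta>) (cb (E \<alpha>) (E (- ?\<delta>))) else 0)"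
    by (simp only: if_distrib[of "(*) (?\<delta> H)"] mult_zero_right)
  then show ?thesis using nz by (simp only: mult_cancel_left simp_thms)
qed

lemma h_part_cJ_E:
  assumes "\<alpha> \<in> P"
  shows "h_part (cJ (E \<alpha>)) = cscale (v \<alpha>) (minus_part (cr \<alpha>))"
proof -
  note r = P_root[OF assms]
  let ?H = "plus_part (cr \<alpha>)"
  have H: "?H \<in> h" "?H \<in> M" using coroot(1)[OF r] plus_part_minus_part_h plus_part_M by auto
  have "cscale (\<alpha> ?H) (h_part (cJ (E \<alpha>))) = minus_part (h_part (cb (cJ ?H) (E \<alpha>)))"
    using cocycle_h_part[OF H(2) E_M[OF assms]] rs_D[OF E_rs[OF r] H(1)]
    by (simp add: cJ_simps h_part_simps h_part_cb_h[OF H(1)])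
  also have "\<dots> = cscale (\<alpha> ?H) (cscale (v \<alpha>) (minus_part (cr \<alpha>)))"
    using h_part_cb_E[OF r, of "cJ ?H"] root_coeff_cJ_h[OF H assms] by (simp add: minus_part_simps mult.commute)
  finally show ?thesis using root_plus_part_cr_nonzero[OF r] by (simp only: cx.scale_cancel_left simp_thms)
qed

lemma root_coeff_cJ_E_pos: "\<alpha> \<in> P \<Longrightarrow> \<beta> \<in> P \<Longrightarrow> root_coeff \<beta> (cJ (E \<alpha>)) = 0"
  by (intro root_coeff_M' cJ_M E_M)

section \<open>Equations from the square of J\<close>

lemma cJ_E_top:
  assumes "\<gamma> \<in> P" "\<And>\<beta>. \<beta> \<in> P \<Longrightarrow> \<gamma> + \<beta> \<in> \<Delta> \<Longrightarrow> v (\<gamma> + \<beta>) = 0"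
  shows "cJ (E \<gamma>) = cscale (v \<gamma>) (minus_part (cr \<gamma>))"
proof (rule eqI_root_coeff_P)
  have K: "cscale (v \<gamma>) (minus_part (cr \<gamma>)) \<in> h"
    by (intro h_closed plus_part_minus_part_h coroot P_root assms)
  show "h_part (cJ (E \<gamma>)) = h_part (cscale (v \<gamma>) (minus_part (cr \<gamma>)))"
    by (simp only: h_part_cJ_E[OF assms(1)] h_part_h[OF K])
  fix \<beta> assume \<beta>: "\<beta> \<in> P"
  show "root_coeff \<beta> (cJ (E \<gamma>)) = root_coeff \<beta> (cscale (v \<gamma>) (minus_part (cr \<gamma>)))"
    by (simp only: root_coeff_cJ_E_pos[OF assms(1) \<beta>] root_coeff_h[OF P_root[OF \<beta>] K])
  have "- \<beta> \<in> \<Delta>" using P_root[OF \<beta>] by simp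
  then show "root_coeff (- \<beta>) (cJ (E \<gamma>)) = root_coeff (- \<beta>) (cscale (v \<gamma>) (minus_part (cr \<gamma>)))"
    using root_coeff_cJ_E[OF assms(1) \<beta>] assms(2)[OF \<beta>] by (simp add: root_coeff_h[OF _ K])
qed

text \<open>Applying J to the hypothesis returns -E_gamma. The M'-part of H_gamma is minus the
  conjugate of its M-part, and J commutes with conjugation, so its image has coordinates at beta
  governed by v_beta. Comparison with the coordinates of E_gamma gives one scalar equation for each
  beta.\<close>

lemma v_pairing:
  assumes "\<gamma> \<in> P" "cJ (E \<gamma>) = cscale (v \<gamma>) (minus_part (cr \<gamma>))" "\<beta> \<in> P"
  shows "v \<gamma> * cnj (v \<beta>) * cnj (\<beta> (plus_part (cr \<gamma>))) = (if \<beta> = \<gamma> then 1 else 0)"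
proof -
  note r = P_root[OF assms(1)] P_root[OF assms(3)]
  let ?K = "plus_part (cr \<gamma>)"
  have K: "?K \<in> h" "?K \<in> M" using coroot(1)[OF r(1)] plus_part_minus_part_h plus_part_M by auto
  have "minus_part (cr \<gamma>) = - conjugation ?K"
    by (simp add: conjugation_plus_part conjugation_cr[OF r(1)] minus_part_def cI_simps flip: cx.scale_minus_right)
  then have "root_coeff \<beta> (cJ (minus_part (cr \<gamma>))) = cnj (root_coeff (- \<beta>) (cJ ?K))"
    by (simp add: cJ_simps root_coeff_simps root_coeff_conjugation[OF r(2)])
  then have 1: "root_coeff \<beta> (cJ (minus_part (cr \<gamma>))) = - cnj (v \<beta>) * cnj (\<beta> ?K)"
    by (simp add: root_coeff_cJ_h[OF K assms(3)])
  have "- E \<gamma> = cscale (v \<gamma>) (cJ (minus_part (cr \<gamma>)))"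
    using arg_cong[OF assms(2), of cJ] by (simp add: cJ_simps)
  then have "- root_coeff \<beta> (E \<gamma>) = v \<gamma> * root_coeff \<beta> (cJ (minus_part (cr \<gamma>)))"
    by (metis root_coeff_simps(3,4))
  moreover have "root_coeff \<beta> (E \<gamma>) = (if \<beta> = \<gamma> then 1 else 0)"
    using root_coeff_E[OF r(2)] root_coeff_rs_other[OF r(2) disjI2[OF r(1)] _ E_rs[OF r(1)]] by auto
  ultimately show ?thesis by (simp add: 1 split: if_splits)
qed

text \<open>Both claims go through one induction from the top. A root gamma + beta lies in Phi_delta
  for a higher delta, where v is already known to vanish; so \<open>cJ_E_top\<close> applies, and
  \<open>v_pairing\<close> then kills v on Phi_gamma.\<close>

lemma v_\<Phi>: "\<gamma> \<in> \<Gamma> \<longrightarrow> (\<forall>\<beta>\<in>\<Phi> \<gamma>. v \<beta> = 0) \<and> cJ (E \<gamma>) = cscale (v \<gamma>) (minus_part (cr \<gamma>))"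
  using wf_above
proof (induction \<gamma> rule: wf_induct_rule)
  case (less \<gamma>)
  show ?case
  proof
    assume \<gamma>: "\<gamma> \<in> \<Gamma>"
    note P = \<Gamma>_P[OF \<gamma>]
    have top: "cJ (E \<gamma>) = cscale (v \<gamma>) (minus_part (cr \<gamma>))"
    proof (rule cJ_E_top[OF P])
      fix \<beta> assume \<beta>: "\<beta> \<in> P" "\<gamma> + \<beta> \<in> \<Delta>"
      have sP: "\<gamma> + \<beta> \<in> P" using P_add[OF P \<beta>] .
      have "\<gamma> + \<beta> \<notin> \<Gamma>" using \<Gamma>_not_\<Phi>[OF \<gamma>, of "\<gamma> + \<beta>"] P \<beta> by (auto simp: \<Phi>_iff)
      then obtain \<delta> where \<delta>: "\<delta> \<in> \<Gamma>" "\<gamma> + \<beta> \<in> \<Phi> \<delta>" using P_cases[OF sP] by blast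
      have "(\<delta>, \<gamma> + \<beta>) \<in> above" "(\<gamma> + \<beta>, \<gamma>) \<in> above"
        using \<delta> sP \<Gamma>_P[OF \<delta>(1)] P \<beta> by (auto simp: above_def \<Phi>_iff)
      then have "(\<delta>, \<gamma>) \<in> above\<^sup>+" by auto
      from less[OF this] \<delta> show "v (\<gamma> + \<beta>) = 0" by blast
    qed
    have "v \<beta> = 0" if \<beta>: "\<beta> \<in> \<Phi> \<gamma>" for \<beta>
    proof -
      have "\<beta> \<noteq> \<gamma>" using \<Gamma>_not_\<Phi>[OF \<gamma> \<gamma>] \<beta> by auto
      \<comment> \<open>Its real part is 1/2, because beta(H_gamma) = 1.\<close>
      moreover have "\<beta> (plus_part (cr \<gamma>)) \<noteq> 0"
        using root_plus_part_cr[OF \<Gamma>_root[OF \<gamma>] P_root[OF \<Phi>_P[OF \<beta>]]] \<Phi>_cr[OF \<gamma> \<beta>] by (simp add: complex_eq_iff)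
      moreover have "v \<gamma> \<noteq> 0" using v_pairing[OF P top P] by auto
      ultimately show ?thesis using v_pairing[OF P top \<Phi>_P[OF \<beta>]] by simp
    qed
    with top show "(\<forall>\<beta>\<in>\<Phi> \<gamma>. v \<beta> = 0) \<and> cJ (E \<gamma>) = cscale (v \<gamma>) (minus_part (cr \<gamma>))" by blast
  qed
qed

lemma cJ_E: "\<gamma> \<in> \<Gamma> \<Longrightarrow> cJ (E \<gamma>) = cscale (v \<gamma>) (minus_part (cr \<gamma>))"
  using v_\<Phi> by blast

lemma v_eq_0: "\<beta> \<in> P \<Longrightarrow> \<beta> \<notin> \<Gamma> \<Longrightarrow> v \<beta> = 0"
  using P_cases v_\<Phi> by blast

text \<open>Both follow from the single equation |v_gamma|^2 (1 + i w / 2) = 1 with real w = gamma(I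
  H_gamma): compare imaginary and real parts.\<close>

lemma v_pairing_\<Gamma>:
  assumes "\<gamma> \<in> \<Gamma>"
  shows "v \<gamma> * cnj (v \<gamma>) = 1" "Re (\<gamma> (cI (cr \<gamma>))) = 0"
proof -
  note r = \<Gamma>_root[OF assms]
  have "v \<gamma> * cnj (v \<gamma>) * cnj (\<gamma> (plus_part (cr \<gamma>))) = 1"
    using v_pairing[OF \<Gamma>_P[OF assms] cJ_E[OF assms] \<Gamma>_P[OF assms]] by simp
  moreover have "v \<gamma> * cnj (v \<gamma>) = of_real ((cmod (v \<gamma>))\<^sup>2)" by (simp only: complex_norm_square)
  moreover have "\<gamma> (plus_part (cr \<gamma>)) = Complex 1 (- Re (\<gamma> (cI (cr \<gamma>))) / 2)"
    by (simp add: root_plus_part_cr[OF r r] coroot(2)[OF r])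
  moreover have "m = 1 \<and> w = 0" if "of_real m * cnj (Complex 1 (- w / 2)) = 1" for m w :: real
    using that by (auto simp: complex_eq_iff)
  ultimately have "(cmod (v \<gamma>))\<^sup>2 = 1 \<and> Re (\<gamma> (cI (cr \<gamma>))) = 0" by metis
  then show "v \<gamma> * cnj (v \<gamma>) = 1" "Re (\<gamma> (cI (cr \<gamma>))) = 0"
    by (simp_all only: complex_norm_square[symmetric] of_real_1)
qed

text \<open>This makes I H_gamma commute with the generator of the Cayley transform and hence a
  fixed vector.\<close>

lemma \<Gamma>_cI_cr:
  assumes "\<gamma> \<in> \<Gamma>" "\<delta> \<in> \<Gamma>"
  shows "\<delta> (cI (cr \<gamma>)) = 0"
proof -
  note r = \<Gamma>_root[OF assms(1)] \<Gamma>_root[OF assms(2)]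
  have "Re (\<delta> (cI (cr \<gamma>))) = 0"
  proof (cases "\<delta> = \<gamma>")
    case True then show ?thesis using v_pairing_\<Gamma>(2)[OF assms(1)] by simp
  next
    case False
    have "v \<gamma> \<noteq> 0" "v \<delta> \<noteq> 0" using v_pairing_\<Gamma>(1) assms by force+
    then have "\<delta> (plus_part (cr \<gamma>)) = 0"
      using v_pairing[OF \<Gamma>_P[OF assms(1)] cJ_E[OF assms(1)] \<Gamma>_P[OF assms(2)]] False by simp
    then show ?thesis by (simp add: root_plus_part_cr[OF r] complex_eq_iff)
  qed
  then show ?thesis using root_cI_cr_real[OF r] by simp
qed

lemma plus_part_uminus: "plus_part (- X) = - plus_part X"
  by (simp add: plus_part_def cI_simps flip: cx.scale_minus_right)

lemma conjugation_minus_part: "conjugation (minus_part X) = plus_part (conjugation X)"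
  by (simp add: plus_part_def minus_part_def cI_simps)

lemma cJ_E_uminus: "\<gamma> \<in> \<Gamma> \<Longrightarrow> cJ (E (- \<gamma>)) = cscale (cnj (v \<gamma>)) (plus_part (cr \<gamma>))"
proof -
  assume \<gamma>: "\<gamma> \<in> \<Gamma>"
  note r = \<Gamma>_root[OF \<gamma>]
  have "E (- \<gamma>) = - conjugation (E \<gamma>)" by (simp add: conjugation_E[OF r])
  then have "cJ (E (- \<gamma>)) = - conjugation (cJ (E \<gamma>))" by (simp only: cJ_simps)
  then show ?thesis
    by (simp add: cJ_E[OF \<gamma>] conjugation_minus_part conjugation_cr[OF r] plus_part_uminus)
qed

text \<open>Only one term of the coboundary survives: v is supported on the stem, and alpha + beta
  in the stem puts alpha into Phi_(alpha + beta), which forces alpha + beta = gamma. The part in h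
  disappears because v_alpha = 0.\<close>

lemma cJ_E_\<Phi>:
  assumes "\<gamma> \<in> \<Gamma>" "\<alpha> \<in> \<Phi> \<gamma>"
  shows "cJ (E \<alpha>) = cscale (v \<gamma>) (cb (E \<alpha>) (E (- \<gamma>)))" (is "_ = ?R")
proof -
  have P: "\<alpha> \<in> P" "\<gamma> - \<alpha> \<in> P" using assms by (auto simp: \<Phi>_iff)
  have "\<alpha> \<notin> \<Gamma>" using assms \<Gamma>_not_\<Phi> by blast
  have R: "?R \<in> rs (\<alpha> + - \<gamma>)"
    using P_root[OF P(1)] \<Gamma>_root[OF assms(1)] by (intro rs_closed cb_rs E_rs) auto
  have root: "\<alpha> + - \<gamma> \<in> \<Delta>" using P_root[OF P(2)] uminus_root[of "\<gamma> - \<alpha>"] by simp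
  show ?thesis
  proof (rule eqI_root_coeff_P)
    show "h_part (cJ (E \<alpha>)) = h_part ?R"
      using h_part_cJ_E[OF P(1)] v_eq_0[OF P(1) \<open>\<alpha> \<notin> \<Gamma>\<close>] h_part_rs[OF root R] by simp
    fix \<beta> assume \<beta>: "\<beta> \<in> P"
    have "\<beta> \<noteq> \<alpha> + - \<gamma>" using P_uminus[OF P(2)] \<beta> by auto
    then show "root_coeff \<beta> (cJ (E \<alpha>)) = root_coeff \<beta> ?R"
      using root_coeff_cJ_E_pos[OF P(1) \<beta>] root_coeff_rs_other[OF P_root[OF \<beta>] _ _ R] root by simp
    have u\<beta>: "- \<beta> \<in> \<Delta>" using P_root[OF \<beta>] by simp
    show "root_coeff (- \<beta>) (cJ (E \<alpha>)) = root_coeff (- \<beta>) ?R"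
    proof (cases "\<alpha> + \<beta> = \<gamma>")
      case True
      then show ?thesis using root_coeff_cJ_E[OF P(1) \<beta>] \<Gamma>_root[OF assms(1)] by (simp add: root_coeff_simps)
    next
      case False
      have "- \<beta> \<noteq> \<alpha> + - \<gamma>"
      proof
        assume "- \<beta> = \<alpha> + - \<gamma>"
        then have "\<alpha> + - \<gamma> + (\<gamma> + \<beta>) = - \<beta> + (\<gamma> + \<beta>)" by (rule arg_cong[OF sym])
        then have "\<alpha> + \<beta> = \<gamma>" by (simp add: add_ac del: plus_fun_apply)
        with False show False by blast
      qed
      then have "root_coeff (- \<beta>) ?R = 0" using root_coeff_rs_other[OF u\<beta> disjI2[OF root] _ R] by blast
      moreover have "v (\<alpha> + \<beta>) = 0" if "\<alpha> + \<beta> \<in> \<Delta>"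
      proof (rule v_eq_0)
        show "\<alpha> + \<beta> \<in> P" using P_add[OF P(1) \<beta> that] .
        show "\<alpha> + \<beta> \<notin> \<Gamma>"
          using \<Phi>_unique[OF assms(1) _ assms(2), of "\<alpha> + \<beta>"] P(1) \<beta> False by (auto simp: \<Phi>_iff)
      qed
      ultimately show ?thesis using root_coeff_cJ_E[OF P(1) \<beta>] by auto
    qed
  qed
qed

lemma cJ_E_\<Phi>_uminus:
  assumes "\<gamma> \<in> \<Gamma>" "\<alpha> \<in> \<Phi> \<gamma>"
  shows "cJ (E (- \<alpha>)) = cscale (- cnj (v \<gamma>)) (cb (E (- \<alpha>)) (E \<gamma>))"
proof -
  note r = P_root[OF \<Phi>_P[OF assms(2)]] \<Gamma>_root[OF assms(1)]
  have "E (- \<alpha>) = - conjugation (E \<alpha>)" by (simp add: conjugation_E[OF r(1)])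
  then have "cJ (E (- \<alpha>)) = - conjugation (cJ (E \<alpha>))" by (simp only: cJ_simps)
  then show ?thesis using conjugation_E[of "- \<gamma>"] r
    by (simp add: cJ_E_\<Phi>[OF assms] conjugation_E cb_simps)
qed

end

section \<open>The Cayley transform\<close>

lemma cx_subspace_imp_subspace: "cx.subspace S \<Longrightarrow> subspace S"
  using cx.subspace_scale[of S _ "of_real _"]
  by (auto simp: subspace_def cx.subspace_0 cx.subspace_add cscale_of_real)

lemma cx_subspace_image:
  assumes "cx.subspace U" "\<And>X Y. f (X + Y) = f X + f Y" "\<And>z X. f (cscale z X) = cscale z (f X)"
  shows "cx.subspace (f ` U)"
  unfolding cx.subspace_def
proof (intro conjI ballI allI)
  have "f (cscale 0 0) = 0" unfolding assms(3) by simp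
  then show "0 \<in> f ` U" using cx.subspace_0[OF assms(1)] by (simp add: image_iff) metis
next
  fix X Y assume "X \<in> f ` U" "Y \<in> f ` U"
  then obtain X' Y' where "X' \<in> U" "Y' \<in> U" "X = f X'" "Y = f Y'" by blast
  then show "X + Y \<in> f ` U"
    using cx.subspace_add[OF assms(1)] by (simp only: assms(2)[symmetric] imageI)
next
  fix z X assume "X \<in> f ` U"
  then obtain X' where "X' \<in> U" "X = f X'" by blast
  then show "cscale z X \<in> f ` U"
    using cx.subspace_scale[OF assms(1)] by (simp only: assms(3)[symmetric] imageI)
qed

lemma cscale_half_double: "cscale (1/2) (X + X) = X"
proof -
  have "cscale (1/2) (X + X) = cscale (1/2 + 1/2) X"
    unfolding cx.scale_right_distrib cx.scale_left_distrib ..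
  then show ?thesis by simp
qed

lemma bilinear_cscale: "bilinear (cscale :: complex \<Rightarrow> 'u::real_vector \<times> 'u \<Rightarrow> _)"
  unfolding bilinear_def
  by (intro conjI allI linearI)
    (simp_all add: cx.scale_left_distrib cx.scale_right_distrib mult.commute scaleR_conv_of_real
      flip: cscale_of_real)

lemma exp_op_eigenvector:
  fixes A :: "'u::euclidean_space \<times> 'u \<Rightarrow> 'u \<times> 'u"
  assumes "linear A" "\<And>z X. A (cscale z X) = cscale z (A X)" "A X = cscale k X"
  shows "exp_op A X = cscale (exp k) X"
proof -
  have pow: "(A ^^ n) X = cscale (k ^ n) X" for n
    by (induction n) (simp_all add: assms mult.commute)
  have "bounded_linear (\<lambda>z. cscale z X)"
    using bilinear_cscale unfolding bilinear_def linear_conv_bounded_linear[symmetric] by blast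
  from bounded_linear.sums[OF this exp_converges[of k]]
  have "(\<lambda>n. (1 / fact n) *\<^sub>R (A ^^ n) X) sums cscale (exp k) X"
    by (simp add: pow scaleR_conv_of_real divide_inverse flip: cscale_of_real)
  then show ?thesis using exp_op_sums[OF assms(1)] sums_unique2 by blast
qed

context matched_structures
begin

definition \<rho> where "\<rho> \<gamma> = \<i> * \<gamma> (cJ (E (- \<gamma>)))"

text \<open>J E_-gamma is cnj(v_gamma) times the M-part of H_gamma, on which gamma takes the value 1
  since gamma(I H_gamma) = 0.\<close>

lemma \<rho>: "\<gamma> \<in> \<Gamma> \<Longrightarrow> \<rho> \<gamma> = \<i> * cnj (v \<gamma>)"
proof -
  assume \<gamma>: "\<gamma> \<in> \<Gamma>"
  note r = \<Gamma>_root[OF \<gamma>]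
  have "\<gamma> (plus_part (cr \<gamma>)) = 1"
    using root_plus_part_cr[OF r r] coroot(2)[OF r] v_pairing_\<Gamma>(2)[OF \<gamma>] by (simp add: complex_eq_iff)
  then show ?thesis
    using plus_part_minus_part_h(1)[OF coroot(1)[OF r]]
    by (simp add: \<rho>_def cJ_E_uminus[OF \<gamma>] dual_simps[OF root_dual[OF r]])
qed

lemma v_norm: "\<gamma> \<in> \<Gamma> \<Longrightarrow> v \<gamma> * cnj (v \<gamma>) = 1" "\<gamma> \<in> \<Gamma> \<Longrightarrow> cnj (v \<gamma>) * v \<gamma> = 1"
  using v_pairing_\<Gamma>(1) by (simp_all add: mult.commute)

lemma \<rho>_norm: "\<gamma> \<in> \<Gamma> \<Longrightarrow> \<rho> \<gamma> * cnj (\<rho> \<gamma>) = 1"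
proof -
  assume \<gamma>: "\<gamma> \<in> \<Gamma>"
  have "\<i> * a * cnj (\<i> * a) = a * cnj a" for a by (simp add: complex_eq_iff)
  then show ?thesis by (simp only: \<rho>[OF \<gamma>] complex_cnj_cnj v_norm[OF \<gamma>])
qed

abbreviation Xv where "Xv \<equiv> X_vec E \<rho>"
definition Xs where "Xs = (\<Sum>\<gamma>\<in>\<Gamma>. Xv \<gamma>)"
definition A where "A X = (pi / 2) *\<^sub>R cb Xs X"
definition cay where "cay = cayley br \<Gamma> E \<rho>"
text \<open>Up to sign the bracket of \<open>Xs\<close> with \<open>cr \<gamma>\<close>; these two
  vectors span the plane rotated by the Cayley transform.\<close>

definition Tv where "Tv \<gamma> = cscale (\<rho> \<gamma>) (E \<gamma>) + cscale (cnj (\<rho> \<gamma>)) (E (- \<gamma>))"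

lemma cay_eq: "cay = exp_op A"
  by (simp add: cay_def cayley_def A_def[abs_def] Xs_def)

lemma linear_A: "linear A"
  unfolding A_def[abs_def] by (intro linear_compose_scale_right linear_cb)

lemma A_eq: "A X = cscale (of_real (pi / 2)) (cb Xs X)"
  by (simp only: A_def cscale_of_real)

lemma A_cscale: "A (cscale z X) = cscale z (A X)"
  by (simp add: A_eq cb_simps mult.commute)

lemma linear_cay: "linear cay"
  unfolding cay_eq by (rule linear_exp_op[OF linear_A])

lemma cay_cscale: "cay (cscale z X) = cscale z (cay X)"
proof -
  have "exp_op A (cscale z X) = cscale (exp_op (\<lambda>_. 0) z) (exp_op A X)"
    by (rule exp_op_bilinear) (auto simp: linear_A bilinear_cscale A_cscale linear_zero)
  then show ?thesis by (simp add: cay_eq exp_op_zero)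
qed

lemmas cay_simps = linear_add[OF linear_cay] linear_diff[OF linear_cay] linear_neg[OF linear_cay]
  linear_0[OF linear_cay] cay_cscale

lemma cay_cb: "cay (cb X Y) = cb (cay X) (cay Y)"
  unfolding cay_eq
  by (rule exp_op_bilinear[OF linear_A linear_A linear_A bilinear_cb])
    (simp add: A_eq cb_simps cb_derivation[of Xs X Y for X Y] cx.scale_right_distrib)

lemma conjugation_Xs: "conjugation Xs = Xs"
  unfolding Xs_def conjugation_sum
proof (rule sum.cong[OF refl])
  fix \<gamma> assume "\<gamma> \<in> \<Gamma>"
  then show "conjugation (Xv \<gamma>) = Xv \<gamma>"
    using conjugation_E[of \<gamma>] conjugation_E[of "- \<gamma>"] \<Gamma>_root
    by (simp add: X_vec_def cx.scale_right_diff_distrib)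
qed

text \<open>\<open>Xs\<close> lies in the compact form, so \<open>cay\<close> is an isometry.\<close>

lemma inj_cay: "inj cay"
proof -
  let ?R = "\<lambda>X Y. Re (hf X Y)"
  have bil: "bilinear ?R"
    unfolding bilinear_def
    by (intro conjI allI linearI) (simp_all add: hf_simps flip: cscale_of_real)
  have "hf (A X) Y + hf X (A Y) = 0" for X Y
    by (simp add: A_eq hf_simps hf_cb conjugation_Xs)
  then have deriv: "0 = ?R (A X) Y + ?R X (A Y)" for X Y
    by (metis plus_complex.sel(1) zero_complex.sel(1))
  have "exp_op (\<lambda>_. 0) (?R X Y) = ?R (cay X) (cay Y)" for X Y
    unfolding cay_eq
    using exp_op_bilinear[of A A "\<lambda>_. 0" ?R X Y, OF linear_A linear_A linear_zero bil deriv] by simp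
  then have "nrm (cay X) = nrm X" for X by (simp add: nrm_def exp_op_zero)
  then have "X = 0" if "cay X = 0" for X using that nrm_eq_0_iff by metis
  then show ?thesis using linear_injective_0[OF linear_cay] by blast
qed

section \<open>The generator on coroots and stem root vectors\<close>

lemma cb_Xv_h:
  assumes "\<gamma> \<in> \<Gamma>" "K \<in> h" shows "cb (Xv \<gamma>) K = cscale (- \<gamma> K / 2) (Tv \<gamma>)"
proof -
  note r = \<Gamma>_root[OF assms(1)]
  have "cb (E \<gamma>) K = cscale (- \<gamma> K) (E \<gamma>)" "cb (E (- \<gamma>)) K = cscale (\<gamma> K) (E (- \<gamma>))"
    using rs_D'[OF E_rs[OF r] assms(2)] rs_D'[OF E_rs[of "- \<gamma>"] assms(2)] r by auto
  then show ?thesis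
    by (simp add: X_vec_def Tv_def cb_simps cx.scale_right_distrib cx.scale_right_diff_distrib mult.commute)
qed

lemma strongly_orthogonal:
  assumes "\<gamma> \<in> \<Gamma>" "\<delta> \<in> \<Gamma>" "\<gamma> \<noteq> \<delta>"
  shows "cb (E \<delta>) (E \<gamma>) = 0" "cb (E (- \<delta>)) (E \<gamma>) = 0" "cb (E \<delta>) (E (- \<gamma>)) = 0"
    "cb (E (- \<delta>)) (E (- \<gamma>)) = 0"
proof -
  note r = \<Gamma>_root[OF assms(1)] \<Gamma>_root[OF assms(2)]
  have sum: "\<delta> + \<gamma> \<noteq> 0" "\<delta> + \<gamma> \<notin> \<Delta>"
    using P_sum2 \<Gamma>_P \<Gamma>_add assms by blast+
  show "cb (E \<delta>) (E \<gamma>) = 0" by (rule cb_E_eq_0[OF r(2,1) sum])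
  have diff: "\<delta> - \<gamma> \<noteq> 0" "\<delta> - \<gamma> \<notin> \<Delta>" using \<Gamma>_diff assms by auto
  have eqs: "- \<delta> + \<gamma> = - (\<delta> - \<gamma>)" "\<delta> + - \<gamma> = \<delta> - \<gamma>" "- \<delta> + - \<gamma> = - (\<delta> + \<gamma>)" by simp_all
  show "cb (E (- \<delta>)) (E \<gamma>) = 0"
    by (rule cb_E_eq_0) (simp_all only: uminus_root_iff r eqs neg_equal_0_iff_equal diff not_False_eq_True)
  show "cb (E \<delta>) (E (- \<gamma>)) = 0"
    by (rule cb_E_eq_0) (simp_all only: uminus_root_iff r eqs neg_equal_0_iff_equal diff not_False_eq_True)
  show "cb (E (- \<delta>)) (E (- \<gamma>)) = 0"
    by (rule cb_E_eq_0) (simp_all only: uminus_root_iff r eqs neg_equal_0_iff_equal sum not_False_eq_True)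
qed

lemma cb_Xs:
  assumes "\<gamma> \<in> \<Gamma>" "\<And>\<delta>. \<delta> \<in> \<Gamma> \<Longrightarrow> \<delta> \<noteq> \<gamma> \<Longrightarrow> cb (Xv \<delta>) Y = 0"
  shows "cb Xs Y = cb (Xv \<gamma>) Y"
proof -
  have "cb Xs Y = (\<Sum>\<delta>\<in>\<Gamma>. if \<delta> = \<gamma> then cb (Xv \<gamma>) Y else 0)"
    unfolding Xs_def cb_sum using assms(2) by (intro sum.cong refl) auto
  then show ?thesis using finite_\<Gamma> assms(1) by simp
qed

lemma cb_Xs_cr: "\<gamma> \<in> \<Gamma> \<Longrightarrow> cb Xs (cr \<gamma>) = - Tv \<gamma>"
proof -
  assume \<gamma>: "\<gamma> \<in> \<Gamma>"
  note r = \<Gamma>_root[OF \<gamma>]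
  have "cb Xs (cr \<gamma>) = cb (Xv \<gamma>) (cr \<gamma>)"
    by (rule cb_Xs[OF \<gamma>]) (simp add: cb_Xv_h coroot(1)[OF r] \<Gamma>_cr[OF _ \<gamma>])
  then show ?thesis by (simp add: cb_Xv_h[OF \<gamma> coroot(1)[OF r]] coroot(2)[OF r])
qed

lemma cb_Xs_cI_cr: "\<gamma> \<in> \<Gamma> \<Longrightarrow> cb Xs (cI (cr \<gamma>)) = 0"
  unfolding Xs_def cb_sum
  by (rule sum.neutral) (simp add: cb_Xv_h cI_h coroot \<Gamma>_root \<Gamma>_cI_cr)

text \<open>Here |rho_gamma| = 1 enters: \<open>cb Xs\<close> has square -1 on the plane of
  \<open>cr \<gamma>\<close> and \<open>Tv \<gamma>\<close>, so the factor pi/2 yields a quarter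
  turn.\<close>

lemma cb_Xs_Tv: "\<gamma> \<in> \<Gamma> \<Longrightarrow> cb Xs (Tv \<gamma>) = cr \<gamma>"
proof -
  assume \<gamma>: "\<gamma> \<in> \<Gamma>"
  note r = \<Gamma>_root[OF \<gamma>]
  have "cb Xs (Tv \<gamma>) = cb (Xv \<gamma>) (Tv \<gamma>)"
    by (rule cb_Xs[OF \<gamma>]) (simp add: X_vec_def Tv_def cb_simps strongly_orthogonal[OF \<gamma>])
  also have "\<dots> = cscale (1/2) (cscale (\<rho> \<gamma> * cnj (\<rho> \<gamma>)) (cr \<gamma>) + cscale (\<rho> \<gamma> * cnj (\<rho> \<gamma>)) (cr \<gamma>))"
    by (simp add: X_vec_def Tv_def cb_simps cb_E[OF r] cb_E'[OF r] cx.scale_right_distrib mult.commute)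
  also have "\<dots> = cr \<gamma>"
    unfolding \<rho>_norm[OF \<gamma>] by (simp add: cscale_half_double)
  finally show ?thesis .
qed

lemma cb_Xs_Xv: "\<gamma> \<in> \<Gamma> \<Longrightarrow> cb Xs (Xv \<gamma>) = 0"
proof -
  assume \<gamma>: "\<gamma> \<in> \<Gamma>"
  have "cb Xs (Xv \<gamma>) = cb (Xv \<gamma>) (Xv \<gamma>)"
    by (rule cb_Xs[OF \<gamma>]) (simp add: X_vec_def cb_simps strongly_orthogonal[OF \<gamma>])
  then show ?thesis by simp
qed

lemma cay_fixed: "cb Xs Y = 0 \<Longrightarrow> cay Y = Y"
proof -
  assume "cb Xs Y = 0"
  then have "A Y = cscale 0 Y" by (simp add: A_eq)
  from exp_op_eigenvector[OF linear_A A_cscale this] show ?thesis by (simp add: cay_eq)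
qed

text \<open>\<open>cr \<gamma> \<plusminus> \<i> Tv \<gamma>\<close> are eigenvectors with eigenvalues \<open>\<plusminus>\<i>\<pi>/2\<close>.\<close>

lemma cay_cr_Tv:
  assumes "\<gamma> \<in> \<Gamma>"
  shows "cay (cr \<gamma>) = - Tv \<gamma>" "cay (Tv \<gamma>) = cr \<gamma>"
proof -
  let ?H = "cr \<gamma>" and ?T = "Tv \<gamma>"
  have eig: "cay (?H + cscale s ?T) = cscale s (?H + cscale s ?T)" if s: "s = \<i> \<or> s = - \<i>" for s
  proof -
    have ss: "s * s = -1" using s by auto
    have "cb Xs (?H + cscale s ?T) = cscale s (?H + cscale s ?T)"
      by (simp add: cb_simps cb_Xs_cr[OF assms] cb_Xs_Tv[OF assms] cx.scale_right_distrib ss)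
    then have "A (?H + cscale s ?T) = cscale (of_real (pi/2) * s) (?H + cscale s ?T)"
      by (simp only: A_eq cx.scale_scale)
    then have "cay (?H + cscale s ?T) = cscale (exp (of_real (pi/2) * s)) (?H + cscale s ?T)"
      unfolding cay_eq by (rule exp_op_eigenvector[OF linear_A A_cscale])
    moreover have "exp (of_real (pi/2) * s) = s"
    proof -
      have "cis (pi/2) = \<i>" "cis (- (pi/2)) = - \<i>" by (simp_all add: complex_eq_iff)
      then have "exp (\<i> * of_real (pi/2)) = \<i>" "exp (\<i> * of_real (- (pi/2))) = - \<i>"
        by (simp_all only: cis_conv_exp)
      moreover have "of_real (pi/2) * \<i> = \<i> * of_real (pi/2)"
        "of_real (pi/2) * - \<i> = \<i> * of_real (- (pi/2))" by simp_all
      ultimately show ?thesis using s by metis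
    qed
    ultimately show ?thesis by simp
  qed
  have p: "cay ?H + cscale \<i> (cay ?T) = cscale \<i> ?H - ?T"
    using eig[of \<i>] by (simp add: cay_simps cx.scale_right_distrib)
  have m: "cay ?H - cscale \<i> (cay ?T) = - cscale \<i> ?H - ?T"
    using eig[of "- \<i>"] by (simp add: cay_simps cx.scale_right_distrib cx.scale_right_diff_distrib)
  have "2 *\<^sub>R cay ?H = 2 *\<^sub>R (- ?T)"
    using arg_cong2[OF p m, of "(+)"] by (simp add: scaleR_2)
  then show H: "cay ?H = - ?T" by (simp only: scaleR_cancel_left) simp
  have "cscale \<i> (cay ?T) = cscale \<i> ?H" using p unfolding H by simp
  then show "cay ?T = ?H" by (simp add: cx.scale_cancel_left)
qed

text \<open>Its image under \<open>cay\<close> is the set on which J agrees with the conjugated I.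
  It is a complex subspace, so generators suffice, and no inverse of \<open>cay\<close> appears in
  the condition.\<close>

definition S where "S = {Y. cJ (cay Y) = cay (cI Y)}"

lemma subspace_S: "cx.subspace S"
  by (simp add: S_def cx.subspace_def cay_simps cI_simps cJ_simps)

lemma subspace_cay_image: "cx.subspace U \<Longrightarrow> cx.subspace (cay ` U)"
  by (rule cx_subspace_image) (simp_all only: cay_simps)

lemmas S_closed = cx.subspace_add[OF subspace_S] cx.subspace_diff[OF subspace_S]
  cx.subspace_neg[OF subspace_S] cx.subspace_scale[OF subspace_S]

lemma cI_Tv: "\<gamma> \<in> \<Gamma> \<Longrightarrow> cI (Tv \<gamma>) = cscale (2 * \<i>) (Xv \<gamma>)"
  using cI_E[of \<gamma>] cI_E'[of \<gamma>] \<Gamma>_P[of \<gamma>]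
  by (simp add: Tv_def X_vec_def cI_simps cx.scale_right_diff_distrib mult.commute)

lemma cI_Xv: "\<gamma> \<in> \<Gamma> \<Longrightarrow> cI (Xv \<gamma>) = cscale (\<i> / 2) (Tv \<gamma>)"
  using cI_E[of \<gamma>] cI_E'[of \<gamma>] \<Gamma>_P[of \<gamma>]
  by (simp add: Tv_def X_vec_def cI_simps cx.scale_right_diff_distrib cx.scale_right_distrib mult.commute)

text \<open>With rho_gamma = i cnj(v_gamma) the coefficients collapse to v_gamma cnj(v_gamma) = 1.
  The two parts of H_gamma then recombine to I H_gamma for \<open>Tv\<close> and to H_gamma for
  \<open>Xv\<close>. The other two values result from applying J once more.\<close>

lemma
  assumes "\<gamma> \<in> \<Gamma>"
  shows cJ_Tv: "cJ (Tv \<gamma>) = - cI (cr \<gamma>)"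
    and cJ_Xv: "cJ (Xv \<gamma>) = cscale (\<i> / 2) (cr \<gamma>)"
    and cJ_cr: "cJ (cr \<gamma>) = cscale (2 * \<i>) (Xv \<gamma>)"
    and cJ_cI_cr: "cJ (cI (cr \<gamma>)) = Tv \<gamma>"
proof -
  note J = cJ_E[OF assms] cJ_E_uminus[OF assms] and v = v_norm[OF assms] and \<rho> = \<rho>[OF assms]
  have "cJ (Tv \<gamma>) = cscale (\<i> * (cnj (v \<gamma>) * v \<gamma>)) (minus_part (cr \<gamma>))
      + cscale (- \<i> * (v \<gamma> * cnj (v \<gamma>))) (plus_part (cr \<gamma>))"
    by (simp add: Tv_def \<rho> cJ_simps J mult.assoc)
  also have "\<dots> = - cI (cr \<gamma>)"
    by (simp only: v cI_plus_part) (simp add: cx.scale_right_diff_distrib)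
  finally show T: "cJ (Tv \<gamma>) = - cI (cr \<gamma>)" .
  have "cJ (Xv \<gamma>) = cscale (1/2) (cscale (\<i> * (cnj (v \<gamma>) * v \<gamma>)) (minus_part (cr \<gamma>))
      + cscale (\<i> * (v \<gamma> * cnj (v \<gamma>))) (plus_part (cr \<gamma>)))"
    by (simp add: X_vec_def \<rho> cJ_simps J mult.assoc)
  also have "\<dots> = cscale (\<i> / 2) (plus_part (cr \<gamma>) + minus_part (cr \<gamma>))"
    by (simp only: v) (simp add: cx.scale_right_distrib add.commute)
  finally show X: "cJ (Xv \<gamma>) = cscale (\<i> / 2) (cr \<gamma>)" by (simp only: plus_part_minus_part)
  have "- Xv \<gamma> = cscale (\<i> / 2) (cJ (cr \<gamma>))"
    using arg_cong[OF X, of cJ] by (simp add: cJ_simps)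
  then have "cscale (- 2 * \<i>) (- Xv \<gamma>) = cJ (cr \<gamma>)"
    by simp
  then show "cJ (cr \<gamma>) = cscale (2 * \<i>) (Xv \<gamma>)" by simp
  show "cJ (cI (cr \<gamma>)) = Tv \<gamma>"
    using arg_cong[OF T, of cJ] by (simp add: cJ_simps)
qed

lemma S_generators:
  assumes "\<gamma> \<in> \<Gamma>"
  shows "cr \<gamma> \<in> S" "Tv \<gamma> \<in> S" "Xv \<gamma> \<in> S" "cI (cr \<gamma>) \<in> S"
  using cay_cr_Tv[OF assms] cay_fixed[OF cb_Xs_Xv[OF assms]] cay_fixed[OF cb_Xs_cI_cr[OF assms]]
  by (simp_all add: S_def cI_Tv cI_Xv cJ_Tv cJ_Xv cJ_cr cJ_cI_cr cJ_simps cay_simps assms)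

lemma E_combinations:
  assumes "\<gamma> \<in> \<Gamma>"
  shows "E \<gamma> = cscale (cnj (\<rho> \<gamma>) / 2) (Tv \<gamma> + cscale 2 (Xv \<gamma>))"
    and "E (- \<gamma>) = cscale (\<rho> \<gamma> / 2) (Tv \<gamma> - cscale 2 (Xv \<gamma>))"
proof -
  let ?a = "cscale (\<rho> \<gamma>) (E \<gamma>)" and ?b = "cscale (cnj (\<rho> \<gamma>)) (E (- \<gamma>))"
  have X: "cscale 2 (Xv \<gamma>) = ?a - ?b" by (simp only: X_vec_def cx.scale_scale) simp
  have T: "Tv \<gamma> = ?a + ?b" by (simp only: Tv_def)
  have half: "cscale (z / 2) (Y + Y) = cscale z Y" for z Y
    using arg_cong[OF cscale_half_double[of Y], of "cscale z"] by simp
  have "Tv \<gamma> + cscale 2 (Xv \<gamma>) = ?a + ?a" unfolding X T by simp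
  moreover have "cscale (cnj (\<rho> \<gamma>)) ?a = E \<gamma>"
    using \<rho>_norm[OF assms] by (simp add: mult.commute)
  ultimately show "E \<gamma> = cscale (cnj (\<rho> \<gamma>) / 2) (Tv \<gamma> + cscale 2 (Xv \<gamma>))"
    by (simp only: half)
  have "Tv \<gamma> - cscale 2 (Xv \<gamma>) = ?b + ?b" unfolding X T by simp
  moreover have "cscale (\<rho> \<gamma>) ?b = E (- \<gamma>)"
    using \<rho>_norm[OF assms] by simp
  ultimately show "E (- \<gamma>) = cscale (\<rho> \<gamma> / 2) (Tv \<gamma> - cscale 2 (Xv \<gamma>))"
    by (simp only: half)
qed

text \<open>The complexification of the extended stem subalgebra, as \<open>e_eq\<close> shows. I, J
  and \<open>cay\<close> are complex linear, so the real subspace is treated through its complex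
  span.\<close>

definition eC where "eC = cx.span (\<Union>\<gamma>\<in>\<Gamma>. {E \<gamma>, E (- \<gamma>), cr \<gamma>, cI (cr \<gamma>)})"

lemma eC_generators:
  assumes "\<gamma> \<in> \<Gamma>"
  shows "E \<gamma> \<in> eC" "E (- \<gamma>) \<in> eC" "cr \<gamma> \<in> eC" "cI (cr \<gamma>) \<in> eC"
  using assms by (auto simp: eC_def intro!: cx.span_base)

lemma eC_minimal:
  assumes "cx.subspace U"
    "\<And>\<gamma>. \<gamma> \<in> \<Gamma> \<Longrightarrow> E \<gamma> \<in> U \<and> E (- \<gamma>) \<in> U \<and> cr \<gamma> \<in> U \<and> cI (cr \<gamma>) \<in> U"
  shows "eC \<subseteq> U"
  unfolding eC_def using assms by (intro cx.span_minimal) auto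

lemma subspace_eC: "cx.subspace eC"
  by (simp add: eC_def)

lemmas eC_closed = cx.subspace_add[OF subspace_eC] cx.subspace_diff[OF subspace_eC]
  cx.subspace_neg[OF subspace_eC] cx.subspace_scale[OF subspace_eC]

text \<open>The quarter turn sends -H_gamma to T_gamma and T_gamma to H_gamma, while X_gamma and I
  H_gamma are fixed. So each of these vectors is the image of an element of \<open>S\<close>;
  E_gamma and E_-gamma are combinations of T_gamma and X_gamma.\<close>

lemma eC_subset: "eC \<subseteq> cay ` S"
proof (rule eC_minimal[OF subspace_cay_image[OF subspace_S]])
  fix \<gamma> assume \<gamma>: "\<gamma> \<in> \<Gamma>"
  note cS = subspace_cay_image[OF subspace_S]
  have H: "cr \<gamma> \<in> cay ` S" using cay_cr_Tv(2)[OF \<gamma>] S_generators(2)[OF \<gamma>] by (metis imageI)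
  have "cay (- cr \<gamma>) = Tv \<gamma>" by (simp add: cay_simps cay_cr_Tv[OF \<gamma>])
  then have T: "Tv \<gamma> \<in> cay ` S" using S_closed(3)[OF S_generators(1)[OF \<gamma>]] by (metis imageI)
  have X: "Xv \<gamma> \<in> cay ` S" using cay_fixed[OF cb_Xs_Xv[OF \<gamma>]] S_generators(3)[OF \<gamma>] by (metis imageI)
  have IH: "cI (cr \<gamma>) \<in> cay ` S"
    using cay_fixed[OF cb_Xs_cI_cr[OF \<gamma>]] S_generators(4)[OF \<gamma>] by (metis imageI)
  have "E \<gamma> \<in> cay ` S" "E (- \<gamma>) \<in> cay ` S"
    unfolding E_combinations[OF \<gamma>]
    by (intro cx.subspace_add[OF cS] cx.subspace_diff[OF cS] cx.subspace_scale[OF cS] T X)+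
  with H IH show "E \<gamma> \<in> cay ` S \<and> E (- \<gamma>) \<in> cay ` S \<and> cr \<gamma> \<in> cay ` S \<and> cI (cr \<gamma>) \<in> cay ` S"
    by blast
qed

lemma cJ_eC: "X \<in> eC \<Longrightarrow> cJ X \<in> eC"
proof -
  have "eC \<subseteq> {X. cJ X \<in> eC}"
  proof (rule eC_minimal)
    show "cx.subspace {X. cJ X \<in> eC}"
      using subspace_eC by (simp add: cx.subspace_def cJ_simps)
    fix \<gamma> assume \<gamma>: "\<gamma> \<in> \<Gamma>"
    have "plus_part (cr \<gamma>) \<in> eC" "minus_part (cr \<gamma>) \<in> eC"
      unfolding plus_part_def minus_part_def by (intro eC_closed eC_generators \<gamma>)+
    moreover have "Xv \<gamma> \<in> eC" "Tv \<gamma> \<in> eC"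
      unfolding X_vec_def Tv_def by (intro eC_closed eC_generators \<gamma>)+
    ultimately show "E \<gamma> \<in> {X. cJ X \<in> eC} \<and> E (- \<gamma>) \<in> {X. cJ X \<in> eC} \<and>
        cr \<gamma> \<in> {X. cJ X \<in> eC} \<and> cI (cr \<gamma>) \<in> {X. cJ X \<in> eC}"
      by (simp add: cJ_E cJ_E_uminus cJ_cr cJ_cI_cr \<gamma> eC_closed)
  qed
  then show "X \<in> eC \<Longrightarrow> cJ X \<in> eC" by blast
qed

section \<open>The summands of V attached to the stem roots\<close>

definition \<Psi> where "\<Psi> \<gamma> = \<Phi> \<gamma> \<union> uminus ` \<Phi> \<gamma>"

lemma \<Psi>_iff: "\<alpha> \<in> \<Psi> \<gamma> \<longleftrightarrow> \<alpha> \<in> \<Phi> \<gamma> \<or> - \<alpha> \<in> \<Phi> \<gamma>"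
  by (auto simp: \<Psi>_def image_iff) (metis minus_minus)

lemma \<Psi>_uminus: "- \<alpha> \<in> \<Psi> \<gamma> \<longleftrightarrow> \<alpha> \<in> \<Psi> \<gamma>"
  by (auto simp: \<Psi>_iff)

lemma \<Psi>_root: "\<alpha> \<in> \<Psi> \<gamma> \<Longrightarrow> \<alpha> \<in> \<Delta>"
  using \<Phi>_P[of _ \<gamma>] P_root[of \<alpha>] P_root[of "- \<alpha>"] by (auto simp: \<Psi>_iff)

text \<open>For delta = gamma the shift alpha - gamma is minus the reflected root, which is why
  \<open>\<Psi> \<gamma>\<close> collects both signs.\<close>

lemma \<Phi>_shift:
  assumes "\<gamma> \<in> \<Gamma>" "\<alpha> \<in> \<Phi> \<gamma>" "\<delta> \<in> \<Gamma>"
  shows "\<alpha> + \<delta> \<in> \<Delta> \<Longrightarrow> \<alpha> + \<delta> \<in> \<Psi> \<gamma>" "\<alpha> - \<delta> \<in> \<Delta> \<Longrightarrow> \<alpha> - \<delta> \<in> \<Psi> \<gamma>"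
    "\<alpha> + \<delta> \<noteq> 0" "\<alpha> - \<delta> \<noteq> 0"
proof -
  show "\<alpha> + \<delta> \<in> \<Psi> \<gamma>" if "\<alpha> + \<delta> \<in> \<Delta>"
    using \<Phi>_add_other[OF assms _ that] \<Phi>_add_\<Gamma>[OF assms(1,2)] that by (cases "\<delta> = \<gamma>") (auto simp: \<Psi>_iff)
  show "\<alpha> - \<delta> \<in> \<Psi> \<gamma>" if "\<alpha> - \<delta> \<in> \<Delta>"
    using \<Phi>_diff_other[OF assms _ that] \<Phi>_reflect[OF assms(2)] by (cases "\<delta> = \<gamma>") (auto simp: \<Psi>_iff)
  show "\<alpha> + \<delta> \<noteq> 0" using P_sum2 \<Phi>_P \<Gamma>_P assms by blast
  show "\<alpha> - \<delta> \<noteq> 0" using \<Gamma>_not_\<Phi> assms by auto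
qed

definition VV where "VV \<gamma> = cx.span (\<Union>\<alpha>\<in>\<Psi> \<gamma>. rs \<alpha>)"

lemma subspace_VV: "cx.subspace (VV \<gamma>)"
  by (simp add: VV_def)

lemmas VV_closed = cx.subspace_0[OF subspace_VV] cx.subspace_add[OF subspace_VV] cx.subspace_diff[OF subspace_VV]
  cx.subspace_neg[OF subspace_VV] cx.subspace_scale[OF subspace_VV]

lemma rs_VV: "\<alpha> \<in> \<Psi> \<gamma> \<Longrightarrow> X \<in> rs \<alpha> \<Longrightarrow> X \<in> VV \<gamma>"
  unfolding VV_def by (rule cx.span_base) blast

lemma VV_minimal:
  assumes "cx.subspace U" "\<And>\<alpha>. \<alpha> \<in> \<Phi> \<gamma> \<Longrightarrow> E \<alpha> \<in> U" "\<And>\<alpha>. \<alpha> \<in> \<Phi> \<gamma> \<Longrightarrow> E (- \<alpha>) \<in> U"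
  shows "VV \<gamma> \<subseteq> U"
  unfolding VV_def
proof (rule cx.span_minimal[OF _ assms(1)], rule UN_least, rule subsetI)
  fix \<alpha> X assume \<alpha>: "\<alpha> \<in> \<Psi> \<gamma>" and X: "X \<in> rs \<alpha>"
  have "E \<alpha> \<in> U" using \<alpha> assms(2)[of \<alpha>] assms(3)[of "- \<alpha>"] by (auto simp: \<Psi>_iff)
  then show "X \<in> U" using rs_eq[OF \<Psi>_root[OF \<alpha>] X] cx.subspace_scale[OF assms(1)] by metis
qed

lemma cb_E_VV:
  assumes "\<gamma> \<in> \<Gamma>" "\<delta> \<in> \<Gamma>" "X \<in> VV \<gamma>"
  shows "cb (E \<delta>) X \<in> VV \<gamma>" "cb (E (- \<delta>)) X \<in> VV \<gamma>"
proof -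
  note r = \<Gamma>_root[OF assms(2)]
  have mem: "cb (E \<mu>) (E \<nu>) \<in> VV \<gamma>"
    if "\<mu> \<in> \<Delta>" "\<nu> \<in> \<Delta>" "\<mu> + \<nu> \<noteq> 0" "\<mu> + \<nu> \<in> \<Delta> \<Longrightarrow> \<mu> + \<nu> \<in> \<Psi> \<gamma>" for \<mu> \<nu>
    using rs_VV[OF that(4) cb_rs[OF E_rs[OF that(1)] E_rs[OF that(2)]]] cb_E_eq_0[OF that(1,2,3)] VV_closed(1)
    by (cases "\<mu> + \<nu> \<in> \<Delta>") auto
  have "VV \<gamma> \<subseteq> {X. cb (E \<delta>) X \<in> VV \<gamma> \<and> cb (E (- \<delta>)) X \<in> VV \<gamma>}"
  proof (rule VV_minimal)
    show "cx.subspace {X. cb (E \<delta>) X \<in> VV \<gamma> \<and> cb (E (- \<delta>)) X \<in> VV \<gamma>}"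
      using subspace_VV[of \<gamma>] by (simp add: cx.subspace_def cb_simps)
    fix \<alpha> assume \<alpha>: "\<alpha> \<in> \<Phi> \<gamma>"
    note a = P_root[OF \<Phi>_P[OF \<alpha>]] and sh = \<Phi>_shift[OF assms(1) \<alpha> assms(2)]
    have eqs: "\<delta> + \<alpha> = \<alpha> + \<delta>" "- \<delta> + \<alpha> = \<alpha> - \<delta>" "\<delta> + - \<alpha> = - (\<alpha> - \<delta>)" "- \<delta> + - \<alpha> = - (\<alpha> + \<delta>)"
      by simp_all
    have "cb (E \<delta>) (E \<alpha>) \<in> VV \<gamma>" "cb (E (- \<delta>)) (E \<alpha>) \<in> VV \<gamma>"
      "cb (E \<delta>) (E (- \<alpha>)) \<in> VV \<gamma>" "cb (E (- \<delta>)) (E (- \<alpha>)) \<in> VV \<gamma>"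
      by (rule mem; simp only: eqs uminus_root_iff r a neg_equal_0_iff_equal \<Psi>_uminus sh not_False_eq_True)+
    then show "E \<alpha> \<in> {X. cb (E \<delta>) X \<in> VV \<gamma> \<and> cb (E (- \<delta>)) X \<in> VV \<gamma>}"
      "E (- \<alpha>) \<in> {X. cb (E \<delta>) X \<in> VV \<gamma> \<and> cb (E (- \<delta>)) X \<in> VV \<gamma>}" by simp_all
  qed
  with assms(3) show "cb (E \<delta>) X \<in> VV \<gamma>" "cb (E (- \<delta>)) X \<in> VV \<gamma>" by blast+
qed

lemma A_VV:
  assumes "\<gamma> \<in> \<Gamma>" "X \<in> VV \<gamma>" shows "A X \<in> VV \<gamma>"
proof -
  have "cb (Xv \<delta>) X \<in> VV \<gamma>" if "\<delta> \<in> \<Gamma>" for \<delta>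
    unfolding X_vec_def cb_simps by (intro VV_closed cb_E_VV assms that)
  then have "cb Xs X \<in> VV \<gamma>" unfolding Xs_def cb_sum by (intro cx.subspace_sum[OF subspace_VV])
  then show ?thesis unfolding A_eq by (rule VV_closed)
qed

text \<open>The generator preserves \<open>VV \<gamma>\<close>, so its exponential maps this space
  into itself; injectivity preserves the dimension and makes the map onto.\<close>

lemma cay_VV: assumes "\<gamma> \<in> \<Gamma>" shows "cay ` VV \<gamma> = VV \<gamma>"
proof (rule subspace_dim_equal)
  note sub = cx_subspace_imp_subspace[OF subspace_VV]
  show "subspace (VV \<gamma>)" by (rule sub)
  show "subspace (cay ` VV \<gamma>)" by (rule linear_subspace_image[OF linear_cay sub])
  show "cay ` VV \<gamma> \<subseteq> VV \<gamma>"
    unfolding cay_eq using exp_op_mem_subspace[OF linear_A sub] A_VV[OF assms] by blast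
  have "dim (cay ` VV \<gamma>) = dim (VV \<gamma>)"
    using linear_cay inj_cay by (intro dim_image_eq) (auto intro: inj_on_subset)
  then show "dim (VV \<gamma>) \<le> dim (cay ` VV \<gamma>)" by simp
qed

definition Zv where "Zv \<gamma> = cscale (cnj (v \<gamma>)) (E \<gamma>) - cscale (v \<gamma>) (E (- \<gamma>))"

lemma cay_iH: "\<gamma> \<in> \<Gamma> \<Longrightarrow> cay (cscale \<i> (cr \<gamma>)) = Zv \<gamma>"
  by (simp add: cay_simps cay_cr_Tv Tv_def Zv_def \<rho> cx.scale_right_distrib cx.scale_right_diff_distrib flip: mult.assoc)

text \<open>On \<open>VV \<gamma>\<close> both structures are inner derivations, and \<open>cay\<close> carries one into the other.\<close>

lemma cI_VV: assumes "\<gamma> \<in> \<Gamma>" "X \<in> VV \<gamma>" shows "cI X = cb (cscale \<i> (cr \<gamma>)) X"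
proof -
  have "VV \<gamma> \<subseteq> {X. cI X = cb (cscale \<i> (cr \<gamma>)) X}"
  proof (rule VV_minimal)
    show "cx.subspace {X. cI X = cb (cscale \<i> (cr \<gamma>)) X}"
      by (simp add: cx.subspace_def cb_simps cI_simps cx.scale_right_distrib mult.commute)
    fix \<alpha> assume \<alpha>: "\<alpha> \<in> \<Phi> \<gamma>"
    note a = P_root[OF \<Phi>_P[OF \<alpha>]] and H = coroot(1)[OF \<Gamma>_root[OF assms(1)]]
    show "E \<alpha> \<in> {X. cI X = cb (cscale \<i> (cr \<gamma>)) X}"
      using rs_D[OF E_rs[OF a] H] by (simp add: cI_E[OF \<Phi>_P[OF \<alpha>]] cb_simps \<Phi>_cr[OF assms(1) \<alpha>])
    show "E (- \<alpha>) \<in> {X. cI X = cb (cscale \<i> (cr \<gamma>)) X}"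
      using rs_D[OF E_rs[of "- \<alpha>"] H] a by (simp add: cI_E'[OF \<Phi>_P[OF \<alpha>]] cb_simps \<Phi>_cr[OF assms(1) \<alpha>])
  qed
  with assms(2) show ?thesis by blast
qed

lemma cJ_VV: assumes "\<gamma> \<in> \<Gamma>" "X \<in> VV \<gamma>" shows "cJ X = cb (Zv \<gamma>) X"
proof -
  have "VV \<gamma> \<subseteq> {X. cJ X = cb (Zv \<gamma>) X}"
  proof (rule VV_minimal)
    show "cx.subspace {X. cJ X = cb (Zv \<gamma>) X}"
      by (simp add: cx.subspace_def cb_simps cJ_simps)
    fix \<alpha> assume \<alpha>: "\<alpha> \<in> \<Phi> \<gamma>"
    note a = P_root[OF \<Phi>_P[OF \<alpha>]] and g = \<Gamma>_root[OF assms(1)]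
    \<comment> \<open>Only one half of Z_gamma acts on each root vector: as gamma + alpha is not a
      root, E_gamma annihilates E_alpha and E_-gamma annihilates E_-alpha.\<close>
    have n: "\<gamma> + \<alpha> \<noteq> 0" "\<gamma> + \<alpha> \<notin> \<Delta>"
      using P_sum2[OF \<Gamma>_P[OF assms(1)] \<Phi>_P[OF \<alpha>]] \<Phi>_add_\<Gamma>[OF assms(1) \<alpha>] by (simp_all add: add.commute)
    have 1: "cb (E \<gamma>) (E \<alpha>) = 0" by (rule cb_E_eq_0[OF g a n])
    have "- \<gamma> + - \<alpha> = - (\<gamma> + \<alpha>)" by simp
    then have 2: "cb (E (- \<gamma>)) (E (- \<alpha>)) = 0"
      using n by (intro cb_E_eq_0) (simp_all only: uminus_root_iff neg_equal_0_iff_equal a g not_False_eq_True)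
    show "E \<alpha> \<in> {X. cJ X = cb (Zv \<gamma>) X}"
      using cb_skew[of "E (- \<gamma>)" "E \<alpha>"] by (simp add: cJ_E_\<Phi>[OF assms(1) \<alpha>] Zv_def cb_simps 1)
    show "E (- \<alpha>) \<in> {X. cJ X = cb (Zv \<gamma>) X}"
      using cb_skew[of "E \<gamma>" "E (- \<alpha>)"] by (simp add: cJ_E_\<Phi>_uminus[OF assms(1) \<alpha>] Zv_def cb_simps 2)
  qed
  with assms(2) show ?thesis by blast
qed

text \<open>As \<open>cay\<close> is an automorphism sending i H_gamma to Z_gamma, J cay Y =
  [cay(i H_gamma), cay Y] = cay [i H_gamma, Y] = cay I Y. The first equality uses that cay Y is
  again in \<open>VV \<gamma>\<close>.\<close>

lemma VV_subset: assumes "\<gamma> \<in> \<Gamma>" shows "VV \<gamma> \<subseteq> cay ` S"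
proof -
  have "Y \<in> S" if Y: "Y \<in> VV \<gamma>" for Y
  proof -
    have "cay Y \<in> VV \<gamma>" using cay_VV[OF assms] Y by blast
    then have "cJ (cay Y) = cb (cay (cscale \<i> (cr \<gamma>))) (cay Y)"
      by (simp only: cJ_VV[OF assms] cay_iH[OF assms])
    then show ?thesis unfolding S_def by (simp add: cI_VV[OF assms Y] cay_cb)
  qed
  then have "cay ` VV \<gamma> \<subseteq> cay ` S" by blast
  then show ?thesis by (simp only: cay_VV[OF assms])
qed

abbreviation V where "V \<equiv> V_space br h P \<Gamma>"

lemma V_eq: "V = cx.span (\<Union>\<gamma>\<in>\<Gamma>. VV \<gamma>)"
proof
  have "rs \<alpha> \<union> rs (- \<alpha>) \<subseteq> VV \<gamma>" if "\<alpha> \<in> \<Phi> \<gamma>" for \<alpha> \<gamma>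
    using rs_VV[of \<alpha> \<gamma>] rs_VV[of "- \<alpha>" \<gamma>] that by (auto simp: \<Psi>_iff)
  then have "(\<Union>\<alpha>\<in>(\<Union>\<gamma>\<in>\<Gamma>. \<Phi> \<gamma>). rs \<alpha> \<union> rs (- \<alpha>)) \<subseteq> (\<Union>\<gamma>\<in>\<Gamma>. VV \<gamma>)" by blast
  then show "V \<subseteq> cx.span (\<Union>\<gamma>\<in>\<Gamma>. VV \<gamma>)"
    unfolding V_space_def by (rule cx.span_mono)
  have "VV \<gamma> \<subseteq> V" if "\<gamma> \<in> \<Gamma>" for \<gamma>
  proof (rule VV_minimal)
    show "cx.subspace V" by (simp add: V_space_def)
    fix \<alpha> assume \<alpha>: "\<alpha> \<in> \<Phi> \<gamma>"
    note a = P_root[OF \<Phi>_P[OF \<alpha>]]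
    show "E \<alpha> \<in> V" unfolding V_space_def using \<alpha> that E_rs[OF a] by (intro cx.span_base) blast
    show "E (- \<alpha>) \<in> V" unfolding V_space_def using \<alpha> that E_rs[of "- \<alpha>"] a by (intro cx.span_base) auto
  qed
  then show "cx.span (\<Union>\<gamma>\<in>\<Gamma>. VV \<gamma>) \<subseteq> V"
    by (intro cx.span_minimal) (auto simp: V_space_def)
qed

lemma subspace_V: "cx.subspace V"
  by (simp add: V_space_def)

lemma V_minimal: "cx.subspace U \<Longrightarrow> (\<And>\<gamma>. \<gamma> \<in> \<Gamma> \<Longrightarrow> VV \<gamma> \<subseteq> U) \<Longrightarrow> V \<subseteq> U"
  unfolding V_eq by (intro cx.span_minimal) auto

lemma VV_V: "\<gamma> \<in> \<Gamma> \<Longrightarrow> X \<in> VV \<gamma> \<Longrightarrow> X \<in> V"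
  unfolding V_eq by (rule cx.span_base) blast

lemma V_subset: "V \<subseteq> cay ` S"
  by (intro V_minimal subspace_cay_image subspace_S VV_subset)

lemma cJ_V: "X \<in> V \<Longrightarrow> cJ X \<in> V"
proof -
  have "V \<subseteq> {X. cJ X \<in> V}"
  proof (rule V_minimal)
    show "cx.subspace {X. cJ X \<in> V}"
      using subspace_V by (simp add: cx.subspace_def cJ_simps)
    fix \<gamma> assume \<gamma>: "\<gamma> \<in> \<Gamma>"
    have "cb (Zv \<gamma>) X \<in> VV \<gamma>" if "X \<in> VV \<gamma>" for X
      unfolding Zv_def cb_simps by (intro VV_closed cb_E_VV \<gamma> that)
    then have "cJ X \<in> V" if "X \<in> VV \<gamma>" for X
      unfolding cJ_VV[OF \<gamma> that] using VV_V[OF \<gamma>] that by blast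
    then show "VV \<gamma> \<subseteq> {X. cJ X \<in> V}" by blast
  qed
  then show "X \<in> V \<Longrightarrow> cJ X \<in> V" by blast
qed

section \<open>The real form and the directness of the sum\<close>

abbreviation e where "e \<equiv> extended_stem_subalgebra br h \<Gamma> E I"

text \<open>A real element of \<open>eC\<close> is F + I K with F in the stem subalgebra and K in
  the complex span of the coroots. Averaging it with its conjugate changes nothing, but makes F real
  and moves K into \<open>w_space\<close>.\<close>

lemma e_eq: "e = eC \<inter> real_form"
proof
  let ?f = "stem_subalgebra br h \<Gamma> E" and ?w = "w_space br h \<Gamma>"
  have W: "?w \<subseteq> {K. cI K \<in> eC \<and> conjugation K = K}"
    unfolding w_space_def
  proof (rule span_minimal)
    show "subspace {K. cI K \<in> eC \<and> conjugation K = K}"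
      unfolding subspace_def
      by (auto simp: cI_simps eC_closed cx.subspace_0[OF subspace_eC] simp flip: cscale_of_real)
    show "(\<lambda>\<gamma>. cscale (\<i> / 2) (cr \<gamma>)) ` \<Gamma> \<subseteq> {K. cI K \<in> eC \<and> conjugation K = K}"
      by (auto simp: cI_simps eC_closed eC_generators conjugation_cr \<Gamma>_root)
  qed
  have f: "?f \<subseteq> eC"
    unfolding stem_subalgebra_def
    by (rule cx.span_minimal[OF _ subspace_eC]) (auto simp: eC_generators)
  show "e \<subseteq> eC \<inter> real_form"
    unfolding extended_stem_subalgebra_def
  proof (rule subsetI, elim set_plus_elim imageE)
    fix X F KI K assume "F \<in> ?f \<inter> real_form" "KI = cI K" "K \<in> ?w" "X = F + KI"
    then show "X \<in> eC \<inter> real_form"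
      using f W by (auto simp: real_form_iff eC_closed subset_iff simp flip: cI_simps(6))
  qed
  let ?hG = "cx.span (cr ` \<Gamma>)"
  have sub_w: "subspace ?w" by (simp add: w_space_def)
  have sub_f: "cx.subspace ?f" by (simp add: stem_subalgebra_def)
  have gen: "E \<gamma> \<in> ?f" "E (- \<gamma>) \<in> ?f" "cr \<gamma> \<in> ?f" if "\<gamma> \<in> \<Gamma>" for \<gamma>
    unfolding stem_subalgebra_def using that by (auto intro!: cx.span_base)
  have conj_f: "?f \<subseteq> {X. conjugation X \<in> ?f}"
  proof -
    have sub: "cx.subspace {X. conjugation X \<in> ?f}"
      using sub_f by (simp add: cx.subspace_def)
    have "conjugation (E \<gamma>) \<in> ?f \<and> conjugation (E (- \<gamma>)) \<in> ?f \<and> conjugation (cr \<gamma>) \<in> ?f"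
      if "\<gamma> \<in> \<Gamma>" for \<gamma>
      using \<Gamma>_root[OF that] conjugation_E[of "- \<gamma>"] gen[OF that]
      by (simp add: conjugation_E conjugation_cr cx.subspace_neg[OF sub_f])
    then have "(\<Union>\<gamma>\<in>\<Gamma>. {E \<gamma>, E (- \<gamma>), cr \<gamma>}) \<subseteq> {X. conjugation X \<in> ?f}" by blast
    from cx.span_minimal[OF this sub] show ?thesis
      by (simp only: stem_subalgebra_def)
  qed
  have real_w: "cscale z K + conjugation (cscale z K) \<in> ?w" if "K \<in> ?hG" for z K
  proof -
    \<comment> \<open>The quantifier over z makes this set closed under complex scaling, so only the
      coroots themselves have to be checked.\<close>
    have "?hG \<subseteq> {K. \<forall>z. cscale z K + conjugation (cscale z K) \<in> ?w}"
    proof (rule cx.span_minimal)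
      show "cx.subspace {K. \<forall>z. cscale z K + conjugation (cscale z K) \<in> ?w}"
        unfolding cx.subspace_def
      proof (intro conjI ballI allI CollectI)
        fix z show "cscale z 0 + conjugation (cscale z 0) \<in> ?w" by (simp add: subspace_0[OF sub_w])
      next
        fix X Y z assume "X \<in> {K. \<forall>z. cscale z K + conjugation (cscale z K) \<in> ?w}"
          "Y \<in> {K. \<forall>z. cscale z K + conjugation (cscale z K) \<in> ?w}"
        then have "cscale z X + conjugation (cscale z X) \<in> ?w" "cscale z Y + conjugation (cscale z Y) \<in> ?w"
          by blast+
        from subspace_add[OF sub_w this]
        show "cscale z (X + Y) + conjugation (cscale z (X + Y)) \<in> ?w"
          by (simp add: cx.scale_right_distrib add_ac)
      next
        fix X z z' assume "X \<in> {K. \<forall>z. cscale z K + conjugation (cscale z K) \<in> ?w}"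
        then show "cscale z (cscale z' X) + conjugation (cscale z (cscale z' X)) \<in> ?w"
          unfolding cx.scale_scale by blast
      qed
      show "cr ` \<Gamma> \<subseteq> {K. \<forall>z. cscale z K + conjugation (cscale z K) \<in> ?w}"
      proof (rule image_subsetI, rule CollectI, rule allI)
        fix \<gamma> z assume \<gamma>: "\<gamma> \<in> \<Gamma>"
        \<comment> \<open>Conjugation negates the coroot, so the sum has coefficient z - cnj z = 2 i
          Im z; the generators of \<open>w_space\<close> carry i/2, whence the 4.\<close>
        have "z - cnj z = of_real (4 * Im z) * (\<i> / 2)" by (simp add: complex_eq_iff)
        then have "cscale z (cr \<gamma>) + conjugation (cscale z (cr \<gamma>)) = (4 * Im z) *\<^sub>R cscale (\<i> / 2) (cr \<gamma>)"
          by (simp add: conjugation_cr[OF \<Gamma>_root[OF \<gamma>]] flip: cscale_of_real cx.scale_left_diff_distrib)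
        moreover have "cscale (\<i> / 2) (cr \<gamma>) \<in> ?w"
          unfolding w_space_def using \<gamma> by (intro span_base) blast
        ultimately show "cscale z (cr \<gamma>) + conjugation (cscale z (cr \<gamma>)) \<in> ?w"
          using subspace_scale[OF sub_w] by metis
      qed
    qed
    with that show ?thesis by blast
  qed
  let ?D = "{F + IK | F IK. F \<in> ?f \<and> IK \<in> cI ` ?hG}"
  have split: "eC \<subseteq> ?D"
  proof (rule eC_minimal)
    show "cx.subspace ?D"
      by (intro cx.subspace_sums sub_f cx_subspace_image cx.subspace_span cI_simps)
    fix \<gamma> assume \<gamma>: "\<gamma> \<in> \<Gamma>"
    have F: "F \<in> ?D" if "F \<in> ?f" for F
    proof -
      have "0 \<in> cI ` ?hG" using cx.span_zero[of "cr ` \<Gamma>"] cI_simps(4) by (metis imageI)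
      moreover have "F = F + 0" by simp
      ultimately show ?thesis using that by blast
    qed
    have "cr \<gamma> \<in> ?hG" using \<gamma> by (intro cx.span_base) blast
    moreover have "cI (cr \<gamma>) = 0 + cI (cr \<gamma>)" by simp
    ultimately have "cI (cr \<gamma>) \<in> ?D" using cx.subspace_0[OF sub_f] by blast
    then show "E \<gamma> \<in> ?D \<and> E (- \<gamma>) \<in> ?D \<and> cr \<gamma> \<in> ?D \<and> cI (cr \<gamma>) \<in> ?D"
      using F gen[OF \<gamma>] by blast
  qed
  show "eC \<inter> real_form \<subseteq> e"
  proof
    fix X assume "X \<in> eC \<inter> real_form"
    then obtain F K where X: "X = F + cI K" "F \<in> ?f" "K \<in> ?hG" "conjugation X = X"
      using split by (auto simp: real_form_iff)
    let ?F = "cscale (1/2) (F + conjugation F)" and ?K = "cscale (1/2) K + conjugation (cscale (1/2) K)"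
    have "?F + cI ?K = cscale (1/2) (X + conjugation X)"
      by (simp add: X(1) cI_simps cx.scale_right_distrib add_ac)
    also have "\<dots> = X" unfolding X(4) by (rule cscale_half_double)
    finally have "X = ?F + cI ?K" ..
    moreover have "?F \<in> ?f"
      using conj_f X(2) by (intro cx.subspace_scale[OF sub_f] cx.subspace_add[OF sub_f]) auto
    moreover have "?F \<in> real_form" by (simp add: real_form_iff add.commute)
    moreover have "?K \<in> ?w" by (rule real_w[OF X(3)])
    ultimately show "X \<in> e" unfolding extended_stem_subalgebra_def
      by (metis (no_types, lifting) IntI imageI set_plus_intro)
  qed
qed

lemma cJ_e: "X \<in> e \<Longrightarrow> cJ X \<in> e"
  by (simp add: e_eq cJ_eC real_form_iff flip: cJ_simps(6))

lemma root_coeff_E_other: "\<alpha> \<in> \<Delta> \<Longrightarrow> \<beta> \<in> \<Delta> \<Longrightarrow> \<alpha> \<noteq> \<beta> \<Longrightarrow> root_coeff \<alpha> (E \<beta>) = 0"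
  using root_coeff_rs_other[of \<alpha> \<beta> "E \<beta>"] E_rs by blast

text \<open>The supports are disjoint: \<open>eC\<close> lives on h and the roots of the stem up to
  sign, V on the roots of the sets Phi_gamma up to sign. A common element has no coordinate
  left.\<close>

lemma e_Int_V: "e \<inter> V = {0}"
proof -
  have "X = 0" if e: "X \<in> eC" and V: "X \<in> V" for X
  proof (rule eqI_root_coeff)
    have ne: "\<gamma> \<noteq> \<alpha>" "\<gamma> \<noteq> - \<alpha>" "- \<gamma> \<noteq> \<alpha>" "- \<gamma> \<noteq> - \<alpha>" if "\<gamma> \<in> \<Gamma>" "\<delta> \<in> \<Gamma>" "\<alpha> \<in> \<Phi> \<delta>" for \<alpha> \<gamma> \<delta>
      using that \<Gamma>_not_\<Phi> \<Gamma>_P \<Phi>_P P_uminus by (metis minus_minus)+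
    have sub: "cx.subspace {X. h_part X = h_part 0}" by (simp add: cx.subspace_def h_part_simps)
    have "V \<subseteq> {X. h_part X = h_part 0}"
    proof (intro V_minimal VV_minimal sub)
      fix \<gamma> \<alpha> assume "\<alpha> \<in> \<Phi> \<gamma>"
      then have a: "\<alpha> \<in> \<Delta>" "- \<alpha> \<in> \<Delta>" using P_root \<Phi>_P by auto
      show "E \<alpha> \<in> {X. h_part X = h_part 0}" using h_part_rs[OF a(1) E_rs[OF a(1)]] by (simp add: h_part_simps)
      show "E (- \<alpha>) \<in> {X. h_part X = h_part 0}" using h_part_rs[OF a(2) E_rs[OF a(2)]] by (simp add: h_part_simps)
    qed
    with V show "h_part X = h_part 0" by blast
    have V0: "root_coeff \<gamma> X = 0 \<and> root_coeff (- \<gamma>) X = 0" if \<gamma>: "\<gamma> \<in> \<Gamma>" for \<gamma>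
    proof -
      have r: "\<gamma> \<in> \<Delta>" "- \<gamma> \<in> \<Delta>" using \<Gamma>_root[OF \<gamma>] by auto
      have sub: "cx.subspace {X. root_coeff \<gamma> X = 0 \<and> root_coeff (- \<gamma>) X = 0}" by (simp add: cx.subspace_def root_coeff_simps)
      have "V \<subseteq> {X. root_coeff \<gamma> X = 0 \<and> root_coeff (- \<gamma>) X = 0}"
      proof (intro V_minimal VV_minimal sub)
        fix \<delta> \<alpha> assume \<delta>: "\<delta> \<in> \<Gamma>" "\<alpha> \<in> \<Phi> \<delta>"
        then have a: "\<alpha> \<in> \<Delta>" "- \<alpha> \<in> \<Delta>" using P_root \<Phi>_P by auto
        note n = ne[OF \<gamma> \<delta>]
        show "E \<alpha> \<in> {X. root_coeff \<gamma> X = 0 \<and> root_coeff (- \<gamma>) X = 0}"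
          using root_coeff_E_other[OF r(1) a(1) n(1)] root_coeff_E_other[OF r(2) a(1) n(3)] by simp
        show "E (- \<alpha>) \<in> {X. root_coeff \<gamma> X = 0 \<and> root_coeff (- \<gamma>) X = 0}"
          using root_coeff_E_other[OF r(1) a(2) n(2)] root_coeff_E_other[OF r(2) a(2) n(4)] by simp
      qed
      with V show ?thesis by blast
    qed
    have e0: "root_coeff \<alpha> X = 0 \<and> root_coeff (- \<alpha>) X = 0" if \<delta>: "\<delta> \<in> \<Gamma>" "\<alpha> \<in> \<Phi> \<delta>" for \<alpha> \<delta>
    proof -
      have a: "\<alpha> \<in> \<Delta>" "- \<alpha> \<in> \<Delta>" using P_root \<Phi>_P \<delta> by auto
      have "eC \<subseteq> {X. root_coeff \<alpha> X = 0 \<and> root_coeff (- \<alpha>) X = 0}"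
      proof (rule eC_minimal)
        show "cx.subspace {X. root_coeff \<alpha> X = 0 \<and> root_coeff (- \<alpha>) X = 0}" by (simp add: cx.subspace_def root_coeff_simps)
        fix \<gamma> assume \<gamma>: "\<gamma> \<in> \<Gamma>"
        have r: "\<gamma> \<in> \<Delta>" "- \<gamma> \<in> \<Delta>" using \<Gamma>_root[OF \<gamma>] by auto
        note n = ne[OF \<gamma> \<delta>, symmetric]
        show "E \<gamma> \<in> {X. root_coeff \<alpha> X = 0 \<and> root_coeff (- \<alpha>) X = 0} \<and> E (- \<gamma>) \<in> {X. root_coeff \<alpha> X = 0 \<and> root_coeff (- \<alpha>) X = 0} \<and>
          cr \<gamma> \<in> {X. root_coeff \<alpha> X = 0 \<and> root_coeff (- \<alpha>) X = 0} \<and> cI (cr \<gamma>) \<in> {X. root_coeff \<alpha> X = 0 \<and> root_coeff (- \<alpha>) X = 0}"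
          using root_coeff_E_other[OF a(1) r(1) n(1)] root_coeff_E_other[OF a(2) r(1) n(2)]
            root_coeff_E_other[OF a(1) r(2) n(3)] root_coeff_E_other[OF a(2) r(2) n(4)]
            root_coeff_h[OF a(1) coroot(1)[OF r(1)]] root_coeff_h[OF a(2) coroot(1)[OF r(1)]]
            root_coeff_h[OF a(1) cI_h[OF coroot(1)[OF r(1)]]] root_coeff_h[OF a(2) cI_h[OF coroot(1)[OF r(1)]]]
          by simp
      qed
      with e show ?thesis by blast
    qed
    have P0: "root_coeff \<alpha> X = 0 \<and> root_coeff (- \<alpha>) X = 0" if "\<alpha> \<in> P" for \<alpha>
      using P_cases[OF that] V0 e0 by blast
    show "root_coeff \<alpha> X = root_coeff \<alpha> 0" if "\<alpha> \<in> \<Delta>" for \<alpha>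
      using root_P[OF that] P0[of \<alpha>] P0[of "- \<alpha>"] by (auto simp: root_coeff_simps)
  qed
  moreover have "0 \<in> e \<inter> V"
    by (simp add: e_eq cx.subspace_0[OF subspace_eC] cx.subspace_0[OF subspace_V] real_form_iff)
  ultimately show ?thesis by (auto simp: e_eq)
qed

lemma cJ_conjugate:
  assumes "X \<in> e + V" shows "cJ X = cay (cI (inv cay X))"
proof -
  have "X \<in> cay ` S"
    using assms
  proof (rule set_plus_elim)
    fix a b assume "X = a + b" "a \<in> e" "b \<in> V"
    then show ?thesis using eC_subset V_subset e_eq cx.subspace_add[OF subspace_cay_image[OF subspace_S]] by blast
  qed
  \<comment> \<open>Injectivity identifies \<open>inv cay X\<close> with Y, and the claim becomes
    the condition defining \<open>S\<close>.\<close>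
  then obtain Y where "X = cay Y" "Y \<in> S" by blast
  then show ?thesis by (simp add: S_def inv_f_f[OF inj_cay])
qed

end

theorem corollary4p22:
  fixes br :: "'u::euclidean_space \<Rightarrow> 'u \<Rightarrow> 'u"
    and h :: "('u \<times> 'u) set"
    and P \<Gamma> :: "'u functional set"
    and E :: "'u functional \<Rightarrow> 'u \<times> 'u"
    and I J :: "'u \<Rightarrow> 'u"
  assumes "compact_lie_algebra br"
    and "is_cartan_subalgebra br h" and "conjugation ` h = h"
    and "is_positive_system br h P"
    and "is_weyl_chevalley_basis br h E"
    and "is_stem P \<Gamma>"
    and "is_borel_complex_structure br h P I" and "is_admissible br I"
    and "matches br J I"
  defines "\<e> \<equiv> extended_stem_subalgebra br h \<Gamma> E I"
    and "\<V> \<equiv> V_space br h P \<Gamma>"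
    and "\<c> \<equiv> cayley br \<Gamma> E (\<lambda>\<gamma>. \<i> * \<gamma> (cext J (E (- \<gamma>))))"
  shows "cext J ` \<e> \<subseteq> \<e> \<and> cext J ` \<V> \<subseteq> \<V> \<and>
    \<e> \<inter> \<V> = {0} \<and> (\<forall>X \<in> \<e> + \<V>. cext J X = \<c> (cext I (inv \<c> X)))"
proof -
  interpret compact_lie_algebra br by fact
  obtain Q :: "'u \<Rightarrow> 'u \<Rightarrow> real" where Q: "bilinear Q \<and> (\<forall>x y. Q x y = Q y x)
      \<and> (\<forall>x. x \<noteq> 0 \<longrightarrow> Q x x > 0) \<and> (\<forall>x y z. Q (br x y) z = - Q y (br x z))"
    using invariant_form by (elim exE) (rule that)
  interpret matched_structures br Q h E P \<Gamma> I J
  proof unfold_locales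
    show "bilinear Q" using Q by (elim conjE)
    show "Q x y = Q y x" for x y using Q by (elim conjE allE)
    show "Q x x > 0" if "x \<noteq> 0" for x using Q that by (elim conjE) simp
    show "Q (br x y) z = - Q y (br x z)" for x y z using Q by (elim conjE allE)
  qed (fact assms)+
  have "\<c> = cay"
    by (simp add: \<c>_def cay_def \<rho>_def[abs_def])
  then show ?thesis
    unfolding \<e>_def \<V>_def using cJ_e cJ_V e_Int_V cJ_conjugate by blast
qed

end
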